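(* Let $-\infty\le a<b\le\infty$, $m,n_1,n_2\in\mathbb{N}$, $n=n_1+n_2$, $f_j\in L^2((a,b);dx)^{m\times n_j}$, $g_j\in L^2((a,b);dx)^{n_j\times m}$, $j=1,2$. Let $K$ be the integral operator in $L^2((a,b);dx)^m$ with kernel $K(x,x')=f_1(x)g_1(x')$ for $a<x'<x<b$ and $K(x,x')=f_2(x)g_2(x')$ for $a<x<x'<b$, and suppose that $K$ is a trace class operator. Let $\alpha\in\mathbb{C}$, and let $H_a,H_b,Q,R,S,T,\hat f_1,\hat f_2$ be as in the context. Then $$\operatorname{tr}(H_a)=\operatorname{tr}(H_b)=0,\qquad \det(I-\alpha H_a)=\det(I-\alpha H_b)=1,$$ $$\operatorname{tr}(K)=\int_a^b dx\,\operatorname{tr}_{\mathbb{C}^{n_1}}(g_1(x)f_1(x))=\int_a^b dx\,\operatorname{tr}_{\mathbb{C}^m}(f_1(x)g_1(x))=\int_a^b dx\,\operatorname{tr}_{\mathbb{C}^{n_2}}(g_2(x)f_2(x))=\int_a^b dx\,\operatorname{tr}_{\mathbb{C}^m}(f_2(x)g_2(x)).$$ Moreover, if $U(\cdot,\alpha)$ is the $n\times n$ matrix function $$U(x,\alpha)=\begin{pmatrix} I_{n_1}-\alpha\int_x^b dx'\,g_1(x')\hat f_1(x',\alpha) & \alpha\int_a^x dx'\,g_1(x')\hat f_2(x',\alpha)\\ \alpha\int_x^b dx'\,g_2(x')\hat f_1(x',\alpha) & I_{n_2}-\alpha\int_a^x dx'\,g_2(x')\hat f_2(x',\alpha)\end{pmatrix},$$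 then $$\begin{aligned}\det(I-\alpha K)&=\det\nolimits_{\mathbb{C}^{n_1}}\big(I_{n_1}-\alpha T(I-\alpha H_b)^{-1}S\big)\\&=\det\nolimits_{\mathbb{C}^{n_1}}\Big(I_{n_1}-\alpha\int_a^b dx\,g_1(x)\hat f_1(x,\alpha)\Big)=\det\nolimits_{\mathbb{C}^n}(U(a,\alpha))\\&=\det\nolimits_{\mathbb{C}^{n_2}}\big(I_{n_2}-\alpha R(I-\alpha H_a)^{-1}Q\big)\\&=\det\nolimits_{\mathbb{C}^{n_2}}\Big(I_{n_2}-\alpha\int_a^b dx\,g_2(x)\hat f_2(x,\alpha)\Big)=\det\nolimits_{\mathbb{C}^n}(U(b,\alpha)).\end{aligned}$$
   Context: $I$ is the identity operator in $L^2((a,b);dx)^m$, $I_k$ the $k\times k$ identity matrix; $\det(I-\cdot)$ is the Fredholm determinant and $\operatorname{tr}$ the operator trace. With $H(x,x')=f_1(x)g_1(x')-f_2(x)g_2(x')$, the Volterra operators $H_a,H_b$ in $L^2((a,b);dx)^m$ are $$(H_af)(x)=\int_a^x dx'\,H(x,x')f(x'),\qquad (H_bf)(x)=-\int_x^b dx'\,H(x,x')f(x').$$ ($I-\alpha H_a$ and $I-\alpha H_b$ are boundedly invertible for all $\alpha\in\mathbb{C}$.) The linear maps $Q:\mathbb{C}^{n_2}\to L^2((a,b);dx)^m$, $R:L^2((a,b);dx)^m\to\mathbb{C}^{n_2}$, $S:\mathbb{C}^{n_1}\to L^2((a,b);dx)^m$, $T:L^2((a,b);dx)^m\to\mathbb{C}^{n_1}$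 are $$(Q\underline u)(x)=f_2(x)\underline u,\quad Rf=\int_a^b dx'\,g_2(x')f(x'),\quad (S\underline v)(x)=f_1(x)\underline v,\quad Tf=\int_a^b dx'\,g_1(x')f(x').$$ One has $K=H_a+QR=H_b+ST$. The functions $\hat f_j(\cdot,\alpha)\in L^2((a,b);dx)^{m\times n_j}$ are the solutions of the Volterra integral equations $$\hat f_1(x,\alpha)=f_1(x)-\alpha\int_x^b dx'\,H(x,x')\hat f_1(x',\alpha),\qquad \hat f_2(x,\alpha)=f_2(x)+\alpha\int_a^x dx'\,H(x,x')\hat f_2(x',\alpha).$$ $U(a,\alpha)$ and $U(b,\alpha)$ denote the values of the formula for $U$ at $x=a$ and $x=b$ (limits $x\downarrow a$, $x\uparrow b$). *)

theory Defs
  imports "HOL-Analysis.Analysis"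
begin

section \<open>The Hilbert space \<open>L\<^sup>2((a,b); dx)\<^sup>m\<close>\<close>

text \<open>
  Elements of \<open>L\<^sup>2\<close> are represented by functions, and equality in \<open>L\<^sup>2\<close> is equality almost everywhere
  on \<open>(a,b)\<close>. The end points are extended reals. The same set serves for the vector-valued space
  (\<open>'c = complex^'m\<close>) and the matrix-valued ones (\<open>'c = complex^'n^'m\<close>, the \<open>m \<times> n\<close> matrices, whose norm
  is the Frobenius norm, so that membership means that every entry is square integrable).
\<close>

abbreviation lebesgue_ab :: "ereal \<Rightarrow> ereal \<Rightarrow> real measure" where
  "lebesgue_ab a b \<equiv> lebesgue_on (einterval a b)"

definition L2 :: "ereal \<Rightarrow> ereal \<Rightarrow> (real \<Rightarrow> 'c::euclidean_space) set" where
  "L2 a b = {f. f \<in> borel_measurable (lebesgue_ab a b) \<and>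
                integrable (lebesgue_ab a b) (\<lambda>x. (norm (f x))\<^sup>2)}"

definition eq_L2 :: "ereal \<Rightarrow> ereal \<Rightarrow> (real \<Rightarrow> 'c::euclidean_space) \<Rightarrow> (real \<Rightarrow> 'c) \<Rightarrow> bool" where
  "eq_L2 a b f g \<longleftrightarrow> (AE x in lebesgue_ab a b. f x = g x)"

definition norm_L2 :: "ereal \<Rightarrow> ereal \<Rightarrow> (real \<Rightarrow> 'c::euclidean_space) \<Rightarrow> real" where
  "norm_L2 a b f = sqrt (LINT x|lebesgue_ab a b. (norm (f x))\<^sup>2)"

text \<open>The scalar product is antilinear in the first and linear in the second argument.\<close>

definition inner_L2 ::
  "ereal \<Rightarrow> ereal \<Rightarrow> (real \<Rightarrow> complex^'m) \<Rightarrow> (real \<Rightarrow> complex^'m) \<Rightarrow> complex" where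
  "inner_L2 a b f g = (LINT x|lebesgue_ab a b. (\<Sum>i\<in>UNIV. cnj (f x $ i) * g x $ i))"

definition onb_L2 :: "ereal \<Rightarrow> ereal \<Rightarrow> (real \<Rightarrow> complex^'m) set \<Rightarrow> bool" where
  "onb_L2 a b B \<longleftrightarrow>
     B \<subseteq> L2 a b \<and>
     (\<forall>e\<in>B. \<forall>e'\<in>B. inner_L2 a b e e' = (if e = e' then 1 else 0)) \<and>
     (\<forall>f\<in>L2 a b. (\<forall>e\<in>B. inner_L2 a b e f = 0) \<longrightarrow> eq_L2 a b f (\<lambda>x. 0))"

section \<open>Trace class operators, trace and Fredholm determinant\<close>

text \<open>
  Bounded linear operators on \<open>L\<^sup>2\<close>, acting on representatives. Linearity and boundedness together
  imply that the operator respects equality almost everywhere.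
\<close>

definition bounded_op ::
  "ereal \<Rightarrow> ereal \<Rightarrow> ((real \<Rightarrow> complex^'m) \<Rightarrow> (real \<Rightarrow> complex^'m)) \<Rightarrow> bool" where
  "bounded_op a b A \<longleftrightarrow>
     (\<forall>f\<in>L2 a b. A f \<in> L2 a b) \<and>
     (\<forall>f\<in>L2 a b. \<forall>g\<in>L2 a b. eq_L2 a b (A (\<lambda>x. f x + g x)) (\<lambda>x. A f x + A g x)) \<and>
     (\<forall>c. \<forall>f\<in>L2 a b. eq_L2 a b (A (\<lambda>x. c *s f x)) (\<lambda>x. c *s A f x)) \<and>
     (\<exists>C. \<forall>f\<in>L2 a b. norm_L2 a b (A f) \<le> C * norm_L2 a b f)"

text \<open>
  \<open>P = \<bar>A\<bar> = (A\<^sup>* A)\<^sup>1\<^sup>/\<^sup>2\<close>: the operator \<open>P\<close> is nonnegative and \<open>P\<^sup>2 = A\<^sup>* A\<close>, the latter identity being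
  written as \<open>\<langle>f, P P g\<rangle> = \<langle>A f, A g\<rangle>\<close>.
\<close>

definition is_abs_op ::
  "ereal \<Rightarrow> ereal \<Rightarrow> ((real \<Rightarrow> complex^'m) \<Rightarrow> (real \<Rightarrow> complex^'m)) \<Rightarrow>
     ((real \<Rightarrow> complex^'m) \<Rightarrow> (real \<Rightarrow> complex^'m)) \<Rightarrow> bool" where
  "is_abs_op a b A P \<longleftrightarrow>
     bounded_op a b P \<and>
     (\<forall>f\<in>L2 a b. Im (inner_L2 a b f (P f)) = 0 \<and> 0 \<le> Re (inner_L2 a b f (P f))) \<and>
     (\<forall>f\<in>L2 a b. \<forall>g\<in>L2 a b. inner_L2 a b f (P (P g)) = inner_L2 a b (A f) (A g))"

text \<open>
  \<open>A\<close> is of trace class iff \<open>tr \<bar>A\<bar> < \<infinity>\<close>. As \<open>\<bar>A\<bar>\<close> is nonnegative, its trace can be computed in any one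
  orthonormal basis.
\<close>

definition trace_class ::
  "ereal \<Rightarrow> ereal \<Rightarrow> ((real \<Rightarrow> complex^'m) \<Rightarrow> (real \<Rightarrow> complex^'m)) \<Rightarrow> bool" where
  "trace_class a b A \<longleftrightarrow>
     bounded_op a b A \<and>
     (\<exists>P B. is_abs_op a b A P \<and> onb_L2 a b B \<and>
            (\<lambda>e. Re (inner_L2 a b e (P e))) summable_on B)"

text \<open>
  The trace is the common value of \<open>\<Sum>\<^sub>e \<langle>e, A e\<rangle>\<close> over all orthonormal bases. For bounded \<open>A\<close> these sums
  converge for all orthonormal bases exactly if \<open>A\<close> is of trace class.
\<close>

definition op_trace ::
  "ereal \<Rightarrow> ereal \<Rightarrow> ((real \<Rightarrow> complex^'m) \<Rightarrow> (real \<Rightarrow> complex^'m)) \<Rightarrow> complex" where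
  "op_trace a b A =
     (THE t. \<forall>B. onb_L2 a b B \<longrightarrow> ((\<lambda>e. inner_L2 a b e (A e)) has_sum t) B)"

text \<open>
  For a finite subset \<open>I = {e\<^sub>1, \<dots>, e\<^sub>k}\<close> of an orthonormal basis, the diagonal matrix element of the
  exterior power \<open>\<Lambda>\<^sup>k A\<close> at \<open>e\<^sub>1 \<and> \<dots> \<and> e\<^sub>k\<close> is the \<open>k \<times> k\<close> determinant \<open>det (\<langle>e\<^sub>p, A e\<^sub>q\<rangle>)\<close>, here in its Leibniz
  expansion. These vectors form an orthonormal basis of \<open>\<Lambda>\<^sup>k (L\<^sup>2)\<close>, so summing over all \<open>I\<close> with \<open>k\<close>
  elements gives \<open>tr (\<Lambda>\<^sup>k A)\<close>.
\<close>

definition minor_op ::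
  "ereal \<Rightarrow> ereal \<Rightarrow> ((real \<Rightarrow> complex^'m) \<Rightarrow> (real \<Rightarrow> complex^'m)) \<Rightarrow>
     (real \<Rightarrow> complex^'m) set \<Rightarrow> complex" where
  "minor_op a b A I =
     (\<Sum>p | p permutes I. of_int (sign p) * (\<Prod>e\<in>I. inner_L2 a b e (A (p e))))"

definition op_trace_ext ::
  "ereal \<Rightarrow> ereal \<Rightarrow> nat \<Rightarrow> ((real \<Rightarrow> complex^'m) \<Rightarrow> (real \<Rightarrow> complex^'m)) \<Rightarrow> complex" where
  "op_trace_ext a b k A =
     (THE t. \<forall>B. onb_L2 a b B \<longrightarrow>
        (minor_op a b A has_sum t) {I. I \<subseteq> B \<and> finite I \<and> card I = k})"

text \<open>The Fredholm determinant \<open>det (I - A) = \<Sum>\<^sub>k (-1)\<^sup>k tr (\<Lambda>\<^sup>k A)\<close>.\<close>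

definition fredholm_det_I_minus ::
  "ereal \<Rightarrow> ereal \<Rightarrow> ((real \<Rightarrow> complex^'m) \<Rightarrow> (real \<Rightarrow> complex^'m)) \<Rightarrow> complex" where
  "fredholm_det_I_minus a b A = (\<Sum>k. (-1) ^ k * op_trace_ext a b k A)"

text \<open>
  \<open>A\<^sup>-\<^sup>1 h\<close>, as the solution \<open>f \<in> L\<^sup>2\<close> of \<open>A f = h\<close>; it is determined up to equality almost everywhere when
  \<open>A\<close> is invertible.
\<close>

definition inverse_op ::
  "ereal \<Rightarrow> ereal \<Rightarrow> ((real \<Rightarrow> complex^'m) \<Rightarrow> (real \<Rightarrow> complex^'m)) \<Rightarrow>
     (real \<Rightarrow> complex^'m) \<Rightarrow> (real \<Rightarrow> complex^'m)" where
  "inverse_op a b A h = (SOME f. f \<in> L2 a b \<and> eq_L2 a b (A f) h)"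

definition scale_op ::
  "complex \<Rightarrow> ((real \<Rightarrow> complex^'m) \<Rightarrow> (real \<Rightarrow> complex^'m)) \<Rightarrow>
     (real \<Rightarrow> complex^'m) \<Rightarrow> (real \<Rightarrow> complex^'m)" where
  "scale_op \<alpha> A f = (\<lambda>x. \<alpha> *s A f x)"

definition I_minus_op ::
  "((real \<Rightarrow> complex^'m) \<Rightarrow> (real \<Rightarrow> complex^'m)) \<Rightarrow>
     (real \<Rightarrow> complex^'m) \<Rightarrow> (real \<Rightarrow> complex^'m)" where
  "I_minus_op A f = (\<lambda>x. f x - A f x)"

section \<open>Matrices\<close>

definition mat_scale :: "complex \<Rightarrow> complex^'q^'p \<Rightarrow> complex^'q^'p"  (infixr "*\<^sub>m" 75) where
  "\<alpha> *\<^sub>m A = (\<chi> i j. \<alpha> * A $ i $ j)"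

definition block_mat ::
  "complex^'p^'p \<Rightarrow> complex^'q^'p \<Rightarrow> complex^'p^'q \<Rightarrow> complex^'q^'q \<Rightarrow>
     complex^('p + 'q)^('p + 'q)" where
  "block_mat A B C D =
     (\<chi> i j. case i of
        Inl p \<Rightarrow> (case j of Inl p' \<Rightarrow> A $ p $ p' | Inr q' \<Rightarrow> B $ p $ q')
      | Inr q \<Rightarrow> (case j of Inl p' \<Rightarrow> C $ q $ p' | Inr q' \<Rightarrow> D $ q $ q'))"

section \<open>Semi-separable kernels\<close>

text \<open>The value of the kernel of \<open>K\<close> on the diagonal, a null set, is irrelevant.\<close>

definition kernel_K ::
  "(real \<Rightarrow> complex^'n1^'m) \<Rightarrow> (real \<Rightarrow> complex^'m^'n1) \<Rightarrow>
   (real \<Rightarrow> complex^'n2^'m) \<Rightarrow> (real \<Rightarrow> complex^'m^'n2) \<Rightarrow> real \<Rightarrow> real \<Rightarrow> complex^'m^'m" where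
  "kernel_K f1 g1 f2 g2 x x' =
     (if x' < x then f1 x ** g1 x' else if x < x' then f2 x ** g2 x' else 0)"

definition op_K ::
  "ereal \<Rightarrow> ereal \<Rightarrow> (real \<Rightarrow> complex^'n1^'m) \<Rightarrow> (real \<Rightarrow> complex^'m^'n1) \<Rightarrow>
   (real \<Rightarrow> complex^'n2^'m) \<Rightarrow> (real \<Rightarrow> complex^'m^'n2) \<Rightarrow>
     (real \<Rightarrow> complex^'m) \<Rightarrow> (real \<Rightarrow> complex^'m)" where
  "op_K a b f1 g1 f2 g2 f =
     (\<lambda>x. LINT x'|lebesgue_ab a b. kernel_K f1 g1 f2 g2 x x' *v f x')"

definition kernel_H ::
  "(real \<Rightarrow> complex^'n1^'m) \<Rightarrow> (real \<Rightarrow> complex^'m^'n1) \<Rightarrow>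
   (real \<Rightarrow> complex^'n2^'m) \<Rightarrow> (real \<Rightarrow> complex^'m^'n2) \<Rightarrow> real \<Rightarrow> real \<Rightarrow> complex^'m^'m" where
  "kernel_H f1 g1 f2 g2 x x' = f1 x ** g1 x' - f2 x ** g2 x'"

definition op_Ha ::
  "ereal \<Rightarrow> (real \<Rightarrow> complex^'n1^'m) \<Rightarrow> (real \<Rightarrow> complex^'m^'n1) \<Rightarrow>
   (real \<Rightarrow> complex^'n2^'m) \<Rightarrow> (real \<Rightarrow> complex^'m^'n2) \<Rightarrow>
     (real \<Rightarrow> complex^'m) \<Rightarrow> (real \<Rightarrow> complex^'m)" where
  "op_Ha a f1 g1 f2 g2 f =
     (\<lambda>x. LINT x'|lebesgue_ab a (ereal x). kernel_H f1 g1 f2 g2 x x' *v f x')"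

definition op_Hb ::
  "ereal \<Rightarrow> (real \<Rightarrow> complex^'n1^'m) \<Rightarrow> (real \<Rightarrow> complex^'m^'n1) \<Rightarrow>
   (real \<Rightarrow> complex^'n2^'m) \<Rightarrow> (real \<Rightarrow> complex^'m^'n2) \<Rightarrow>
     (real \<Rightarrow> complex^'m) \<Rightarrow> (real \<Rightarrow> complex^'m)" where
  "op_Hb b f1 g1 f2 g2 f =
     (\<lambda>x. - (LINT x'|lebesgue_ab (ereal x) b. kernel_H f1 g1 f2 g2 x x' *v f x'))"

definition op_Q :: "(real \<Rightarrow> complex^'n2^'m) \<Rightarrow> complex^'n2 \<Rightarrow> (real \<Rightarrow> complex^'m)" where
  "op_Q f2 u = (\<lambda>x. f2 x *v u)"

definition op_R ::
  "ereal \<Rightarrow> ereal \<Rightarrow> (real \<Rightarrow> complex^'m^'n2) \<Rightarrow> (real \<Rightarrow> complex^'m) \<Rightarrow> complex^'n2" where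
  "op_R a b g2 f = (LINT x'|lebesgue_ab a b. g2 x' *v f x')"

definition op_S :: "(real \<Rightarrow> complex^'n1^'m) \<Rightarrow> complex^'n1 \<Rightarrow> (real \<Rightarrow> complex^'m)" where
  "op_S f1 v = (\<lambda>x. f1 x *v v)"

definition op_T ::
  "ereal \<Rightarrow> ereal \<Rightarrow> (real \<Rightarrow> complex^'m^'n1) \<Rightarrow> (real \<Rightarrow> complex^'m) \<Rightarrow> complex^'n1" where
  "op_T a b g1 f = (LINT x'|lebesgue_ab a b. g1 x' *v f x')"

text \<open>
  The solutions in \<open>L\<^sup>2\<close> of the two Volterra equations; they exist and are unique up to equality almost
  everywhere for \<open>f\<^sub>j, g\<^sub>j\<close> in \<open>L\<^sup>2\<close>.
\<close>

definition f1_hat ::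
  "ereal \<Rightarrow> ereal \<Rightarrow> (real \<Rightarrow> complex^'n1^'m) \<Rightarrow> (real \<Rightarrow> complex^'m^'n1) \<Rightarrow>
   (real \<Rightarrow> complex^'n2^'m) \<Rightarrow> (real \<Rightarrow> complex^'m^'n2) \<Rightarrow> complex \<Rightarrow> real \<Rightarrow> complex^'n1^'m" where
  "f1_hat a b f1 g1 f2 g2 \<alpha> =
     (SOME h. h \<in> L2 a b \<and>
        eq_L2 a b h (\<lambda>x. f1 x -
          \<alpha> *\<^sub>m (LINT x'|lebesgue_ab (ereal x) b. kernel_H f1 g1 f2 g2 x x' ** h x')))"

definition f2_hat ::
  "ereal \<Rightarrow> ereal \<Rightarrow> (real \<Rightarrow> complex^'n1^'m) \<Rightarrow> (real \<Rightarrow> complex^'m^'n1) \<Rightarrow>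
   (real \<Rightarrow> complex^'n2^'m) \<Rightarrow> (real \<Rightarrow> complex^'m^'n2) \<Rightarrow> complex \<Rightarrow> real \<Rightarrow> complex^'n2^'m" where
  "f2_hat a b f1 g1 f2 g2 \<alpha> =
     (SOME h. h \<in> L2 a b \<and>
        eq_L2 a b h (\<lambda>x. f2 x +
          \<alpha> *\<^sub>m (LINT x'|lebesgue_ab a (ereal x). kernel_H f1 g1 f2 g2 x x' ** h x')))"

text \<open>
  The argument \<open>x\<close> of \<open>U\<close> is an extended real in order to cover the (possibly infinite) end points, where
  one of the two intervals of integration becomes empty.
\<close>

definition U_mat ::
  "ereal \<Rightarrow> ereal \<Rightarrow> (real \<Rightarrow> complex^'n1^'m) \<Rightarrow> (real \<Rightarrow> complex^'m^'n1) \<Rightarrow>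
   (real \<Rightarrow> complex^'n2^'m) \<Rightarrow> (real \<Rightarrow> complex^'m^'n2) \<Rightarrow> ereal \<Rightarrow> complex \<Rightarrow>
     complex^('n1 + 'n2)^('n1 + 'n2)" where
  "U_mat a b f1 g1 f2 g2 x \<alpha> =
     block_mat
       (mat 1 - \<alpha> *\<^sub>m (LINT x'|lebesgue_ab x b. g1 x' ** f1_hat a b f1 g1 f2 g2 \<alpha> x'))
       (\<alpha> *\<^sub>m (LINT x'|lebesgue_ab a x. g1 x' ** f2_hat a b f1 g1 f2 g2 \<alpha> x'))
       (\<alpha> *\<^sub>m (LINT x'|lebesgue_ab x b. g2 x' ** f1_hat a b f1 g1 f2 g2 \<alpha> x'))
       (mat 1 - \<alpha> *\<^sub>m (LINT x'|lebesgue_ab a x. g2 x' ** f2_hat a b f1 g1 f2 g2 \<alpha> x'))"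

end

theory Submission
  imports Defs
begin

text \<open>
  A trace class operator is nuclear, \<open>K = \<Sum>\<^sub>k \<langle>w\<^sub>k, \<cdot>\<rangle> z\<^sub>k\<close> with \<open>\<Sum>\<^sub>k \<parallel>w\<^sub>k\<parallel> \<parallel>z\<^sub>k\<parallel> < \<infinity>\<close>, so by Cauchy-Binet the trace of its
  \<open>n\<close>-th exterior power does not depend on the orthonormal basis and is given by the minors of the Gram matrix
  \<open>\<langle>w\<^sub>i, z\<^sub>j\<rangle>\<close>. The operators \<open>H\<^sub>a\<close> and \<open>H\<^sub>b\<close> are finite rank perturbations of \<open>K\<close>, hence nuclear, and they are
  causal: they map functions vanishing on one side of a point to such functions. All exterior powers of a causal
  nuclear operator have trace \<open>0\<close>, which gives \<open>tr H\<^sub>a = 0\<close> and \<open>det(I - \<alpha> H\<^sub>a) = 1\<close>. The formula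
  \<open>det(I - \<alpha> (H\<^sub>a + Q R)) = det(I - \<alpha> H\<^sub>a) det(I - \<alpha> R (I - \<alpha> H\<^sub>a)\<^sup>-\<^sup>1 Q)\<close> holds as an identity of formal power series
  in \<open>\<alpha>\<close>, and both sides are entire since the norms of the iterates \<open>H\<^sub>a\<^sup>l f\<close> decay like \<open>c\<^sup>l / l!\<close>.
\<close>

section \<open>The space of square integrable functions\<close>

text \<open>\<open>op_trace\<close> and \<open>op_trace_ext\<close> demand one value for all
  orthonormal bases, whereas \<open>trace_class\<close> inspects a single basis. A nuclear
  representation bridges the gap, since its Gram matrix involves no basis at all. Operators act on
  representatives, so most identities are tested against scalar products.

  On the cells of a grid a causal operator is only weakly triangular, with unknown diagonal blocks.
  A translation by one cell removes the diagonal; this is why translations and their strong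
  continuity take so much room.

  Formal power series make 1 - X G invertible for every finite section and let limits be taken
  coefficient by coefficient; the analytic estimates enter only when a series is evaluated. As the
  causal factor is the constant series 1, what remains to be evaluated is a finite determinant of
  entire functions.

  The two halves of the theorem differ only in orientation. The sign \<sigma> in
  \<open>causal\<close> and \<open>volterra\<close> covers both: 1 for \<open>op_Ha\<close>, -1 for
  \<open>op_Hb\<close>.\<close>

definition hdot :: "complex^'m \<Rightarrow> complex^'m \<Rightarrow> complex" where
  "hdot u v = (\<Sum>i\<in>UNIV. cnj (u $ i) * v $ i)"

lemma inner_L2_hdot: "inner_L2 a b f g = (LINT x|lebesgue_ab a b. hdot (f x) (g x))"
  by (simp add: inner_L2_def hdot_def)

lemma hdot_self: "hdot u u = of_real ((norm u)\<^sup>2)"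
proof -
  have "(norm u)\<^sup>2 = (\<Sum>i\<in>UNIV. (cmod (u $ i))\<^sup>2)"
    by (simp add: norm_vec_def L2_set_def sum_nonneg)
  then show ?thesis
    by (simp add: hdot_def complex_norm_square mult.commute del: of_real_power)
qed

lemma norm_hdot_le: "cmod (hdot u v) \<le> norm u * norm v"
proof -
  have "cmod (hdot u v) \<le> (\<Sum>i\<in>UNIV. \<bar>cmod (u $ i)\<bar> * \<bar>cmod (v $ i)\<bar>)"
    unfolding hdot_def by (rule order_trans[OF norm_sum]) (simp add: norm_mult)
  also have "\<dots> \<le> norm u * norm v"
    unfolding norm_vec_def by (rule L2_set_mult_ineq)
  finally show ?thesis .
qed

lemma hdot_add_right: "hdot u (v + w) = hdot u v + hdot u w"
  by (simp add: hdot_def algebra_simps sum.distrib)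

lemma hdot_smult_right: "hdot u (c *s v) = c * hdot u v"
  by (simp add: hdot_def sum_distrib_left mult_ac)

lemma hdot_commute: "hdot u v = cnj (hdot v u)"
  by (simp add: hdot_def mult.commute)

lemma continuous_on_hdot [continuous_intros]:
  "continuous_on S f \<Longrightarrow> continuous_on S g \<Longrightarrow> continuous_on S (\<lambda>x. hdot (f x) (g x))"
  unfolding hdot_def by (intro continuous_intros)

lemma measurable_hdot [measurable (raw)]:
  assumes "f \<in> borel_measurable M" "g \<in> borel_measurable M"
  shows "(\<lambda>x. hdot (f x) (g x)) \<in> borel_measurable M"
  using assms by (rule borel_measurable_continuous_Pair)
    (intro continuous_on_hdot continuous_on_fst continuous_on_snd continuous_on_id)

lemma norm_smult_vec: "norm (c *s v) = cmod c * norm (v :: complex^'m)"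
  by (simp add: norm_vec_def L2_set_def norm_mult power_mult_distrib sum_distrib_left [symmetric]
      real_sqrt_mult)

lemma continuous_on_smult_vec [continuous_intros]:
  "continuous_on S f \<Longrightarrow> continuous_on S (\<lambda>x. c *s (f x :: complex^'m))"
  unfolding vector_scalar_mult_def by (intro continuous_intros)

lemma measurable_smult_vec [measurable (raw)]:
  assumes "f \<in> borel_measurable M"
  shows "(\<lambda>x. c *s (f x :: complex^'m)) \<in> borel_measurable M"
  by (rule borel_measurable_continuous_on[OF _ assms]) (intro continuous_intros)

lemma measurable_vec_nth_complex [measurable (raw)]:
  assumes "f \<in> borel_measurable M"
  shows "(\<lambda>x. (f x :: 'b::real_normed_vector^'m) $ i) \<in> borel_measurable M"
  by (rule borel_measurable_continuous_on[OF _ assms]) (intro continuous_intros)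

lemma L2_measurable [measurable_dest]: "f \<in> L2 a b \<Longrightarrow> f \<in> borel_measurable (lebesgue_ab a b)"
  by (simp add: L2_def)

lemma L2_integrable_norm2: "f \<in> L2 a b \<Longrightarrow> integrable (lebesgue_ab a b) (\<lambda>x. (norm (f x))\<^sup>2)"
  by (simp add: L2_def)

lemma L2_bound:
  assumes "f \<in> borel_measurable (lebesgue_ab a b)" "g \<in> L2 a b"
    and "AE x in lebesgue_ab a b. norm (f x) \<le> C * norm (g x)"
  shows "f \<in> L2 a b"
proof -
  have "integrable (lebesgue_ab a b) (\<lambda>x. C\<^sup>2 * (norm (g x))\<^sup>2)"
    using L2_integrable_norm2[OF assms(2)] by simp
  moreover have "AE x in lebesgue_ab a b. norm ((norm (f x))\<^sup>2) \<le> norm (C\<^sup>2 * (norm (g x))\<^sup>2)"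
    using assms(3)
  proof eventually_elim
    case (elim x)
    then have "(norm (f x))\<^sup>2 \<le> (C * norm (g x))\<^sup>2"
      by (intro power_mono) auto
    then show ?case
      by (simp add: power_mult_distrib)
  qed
  moreover have "(\<lambda>x. (norm (f x))\<^sup>2) \<in> borel_measurable (lebesgue_ab a b)"
    using assms(1) by measurable
  ultimately have "integrable (lebesgue_ab a b) (\<lambda>x. (norm (f x))\<^sup>2)"
    using Bochner_Integration.integrable_bound by blast
  then show ?thesis
    using assms(1) by (simp add: L2_def)
qed

lemma L2_integrable_mult:
  assumes "f \<in> L2 a b" "g \<in> L2 a b"
  shows "integrable (lebesgue_ab a b) (\<lambda>x. norm (f x) * norm (g x))"
proof -
  have "integrable (lebesgue_ab a b) (\<lambda>x. (norm (f x))\<^sup>2 + (norm (g x))\<^sup>2)"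
    using assms[THEN L2_integrable_norm2] by simp
  then show ?thesis
  proof (rule Bochner_Integration.integrable_bound)
    show "(\<lambda>x. norm (f x) * norm (g x)) \<in> borel_measurable (lebesgue_ab a b)"
      using assms by measurable
    have "\<bar>s * t\<bar> \<le> s\<^sup>2 + t\<^sup>2" for s t :: real
    proof -
      have "2 * (\<bar>s\<bar> * \<bar>t\<bar>) \<le> s\<^sup>2 + t\<^sup>2" "0 \<le> \<bar>s\<bar> * \<bar>t\<bar>"
        using sum_squares_bound[of "\<bar>s\<bar>" "\<bar>t\<bar>"] by (simp_all add: mult.assoc)
      then show ?thesis
        unfolding abs_mult by linarith
    qed
    from this[of "norm (f _)" "norm (g _)"]
    show "AE x in lebesgue_ab a b. norm (norm (f x) * norm (g x)) \<le> norm ((norm (f x))\<^sup>2 + (norm (g x))\<^sup>2)"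
      by (intro AE_I2) simp
  qed
qed

lemma L2_add:
  assumes "f \<in> L2 a b" "g \<in> L2 a b"
  shows "(\<lambda>x. f x + g x) \<in> L2 a b"
proof -
  have "integrable (lebesgue_ab a b) (\<lambda>x. 2 * (norm (f x))\<^sup>2 + 2 * (norm (g x))\<^sup>2)"
    using assms[THEN L2_integrable_norm2] by simp
  then have "integrable (lebesgue_ab a b) (\<lambda>x. (norm (f x + g x))\<^sup>2)"
  proof (rule Bochner_Integration.integrable_bound)
    show "(\<lambda>x. (norm (f x + g x))\<^sup>2) \<in> borel_measurable (lebesgue_ab a b)"
      using assms by measurable
    have "(norm (u + v))\<^sup>2 \<le> 2 * (norm u)\<^sup>2 + 2 * (norm v)\<^sup>2" for u v :: 'a
    proof -
      have "(norm (u + v))\<^sup>2 \<le> (norm u + norm v)\<^sup>2"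
        by (intro power_mono norm_triangle_ineq) simp
      also have "\<dots> \<le> 2 * (norm u)\<^sup>2 + 2 * (norm v)\<^sup>2"
        using sum_squares_bound[of "norm u" "norm v"] by (simp add: power2_sum)
      finally show ?thesis .
    qed
    then show "AE x in lebesgue_ab a b. norm ((norm (f x + g x))\<^sup>2) \<le> norm (2 * (norm (f x))\<^sup>2 + 2 * (norm (g x))\<^sup>2)"
      by (auto intro!: AE_I2)
  qed
  moreover have "(\<lambda>x. f x + g x) \<in> borel_measurable (lebesgue_ab a b)"
    using assms by measurable
  ultimately show ?thesis
    by (simp add: L2_def)
qed

lemma L2_zero [simp]: "(\<lambda>x. 0) \<in> L2 a b"
  by (simp add: L2_def)

lemma L2_smult: "f \<in> L2 a b \<Longrightarrow> (\<lambda>x. c *s (f x :: complex^'m)) \<in> L2 a b"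
  by (rule L2_bound[where g = f and C = "cmod c"]) (auto simp: norm_smult_vec)

lemma L2_uminus: "f \<in> L2 a b \<Longrightarrow> (\<lambda>x. - f x) \<in> L2 a b"
  by (rule L2_bound[where g = f and C = 1]) auto

lemma L2_diff: "f \<in> L2 a b \<Longrightarrow> g \<in> L2 a b \<Longrightarrow> (\<lambda>x. f x - g x) \<in> L2 a b"
  using L2_add[of f a b "\<lambda>x. - g x"] L2_uminus[of g a b] by simp

lemma L2_sum: "(\<And>k. k \<in> F \<Longrightarrow> f k \<in> L2 a b) \<Longrightarrow> (\<lambda>x. \<Sum>k\<in>F. f k x) \<in> L2 a b"
  by (induction F rule: infinite_finite_induct) (auto intro!: L2_add)

lemma L2_eq_L2:
  assumes "f \<in> L2 a b" "g \<in> borel_measurable (lebesgue_ab a b)" "eq_L2 a b f g"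
  shows "g \<in> L2 a b"
proof (rule L2_bound[OF assms(2,1)])
  show "AE x in lebesgue_ab a b. norm (g x) \<le> 1 * norm (f x)"
    using assms(3) unfolding eq_L2_def by (rule AE_mp) (rule AE_I2, simp)
qed

lemma L2_indicator:
  assumes "f \<in> L2 a b" "S \<in> sets lebesgue"
  shows "(\<lambda>x. if x \<in> S then f x else 0) \<in> L2 a b"
proof (rule L2_bound[where g = f and C = 1])
  have "{x \<in> space (lebesgue_ab a b). x \<in> S} \<in> sets (lebesgue_ab a b)"
    using assms(2) by (auto simp: sets_restrict_space)
  then show "(\<lambda>x. if x \<in> S then f x else 0) \<in> borel_measurable (lebesgue_ab a b)"
    using assms(1) by (intro measurable_If L2_measurable) auto
qed (use assms in auto)

section \<open>Norm and scalar product of square integrable functions\<close>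

lemma norm_L2_nonneg [simp]: "0 \<le> norm_L2 a b f"
  by (simp add: norm_L2_def)

lemma norm_L2_power2: "(norm_L2 a b f)\<^sup>2 = (LINT x|lebesgue_ab a b. (norm (f x))\<^sup>2)"
  by (simp add: norm_L2_def)

lemma eq_L2_refl [simp]: "eq_L2 a b f f"
  by (simp add: eq_L2_def)

lemma eq_L2_sym: "eq_L2 a b f g \<Longrightarrow> eq_L2 a b g f"
  by (auto simp: eq_L2_def)

lemma norm_L2_eq_0_iff:
  assumes "f \<in> L2 a b"
  shows "norm_L2 a b f = 0 \<longleftrightarrow> eq_L2 a b f (\<lambda>x. 0)"
  unfolding norm_L2_def eq_L2_def
  by (subst real_sqrt_eq_0_iff, subst integral_nonneg_eq_0_iff_AE)
    (use assms in \<open>auto intro: L2_integrable_norm2\<close>)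

text \<open>The normalised functions f/p and g/q reduce the bound to integrating 2 s t \<le> s^2 +
  t^2; a vanishing norm, where no normalisation exists, is treated apart.\<close>

lemma L2_norm_mult_le:
  assumes "f \<in> L2 a b" "g \<in> L2 a b"
  shows "(LINT x|lebesgue_ab a b. norm (f x) * norm (g x)) \<le> norm_L2 a b f * norm_L2 a b g"
proof (cases "norm_L2 a b f = 0 \<or> norm_L2 a b g = 0")
  case True
  then have "AE x in lebesgue_ab a b. norm (f x) * norm (g x) = 0"
    using norm_L2_eq_0_iff[OF assms(1)] norm_L2_eq_0_iff[OF assms(2)] by (auto simp: eq_L2_def)
  then have "(LINT x|lebesgue_ab a b. norm (f x) * norm (g x)) = 0"
    by (rule integral_eq_zero_AE)
  then show ?thesis by simp
next
  case False
  define p q where "p = norm_L2 a b f" and "q = norm_L2 a b g"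
  have pq: "p > 0" "q > 0"
    using False norm_L2_nonneg[of a b f] norm_L2_nonneg[of a b g] unfolding p_def q_def by linarith+
  have i: "integrable (lebesgue_ab a b) (\<lambda>x. (norm (f x))\<^sup>2 / p\<^sup>2 + (norm (g x))\<^sup>2 / q\<^sup>2)"
    using assms[THEN L2_integrable_norm2] by simp
  have "2 * (LINT x|lebesgue_ab a b. norm (f x) * norm (g x)) / (p * q)
      = (LINT x|lebesgue_ab a b. 2 * (norm (f x) * norm (g x)) / (p * q))"
    by simp
  also have "\<dots> \<le> (LINT x|lebesgue_ab a b. (norm (f x))\<^sup>2 / p\<^sup>2 + (norm (g x))\<^sup>2 / q\<^sup>2)"
  proof (rule integral_mono)
    show "integrable (lebesgue_ab a b) (\<lambda>x. 2 * (norm (f x) * norm (g x)) / (p * q))"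
      using L2_integrable_mult[OF assms] by simp
    fix x
    show "2 * (norm (f x) * norm (g x)) / (p * q) \<le> (norm (f x))\<^sup>2 / p\<^sup>2 + (norm (g x))\<^sup>2 / q\<^sup>2"
      using sum_squares_bound[of "norm (f x) / p" "norm (g x) / q"] by (simp add: power_divide)
  qed (rule i)
  also have "\<dots> = p\<^sup>2 / p\<^sup>2 + q\<^sup>2 / q\<^sup>2"
    using assms[THEN L2_integrable_norm2] by (simp add: p_def q_def norm_L2_power2)
  also have "\<dots> = 2" using pq by simp
  finally show ?thesis
    using pq by (simp add: p_def q_def field_simps)
qed

lemma integrable_hdot:
  assumes "f \<in> L2 a b" "g \<in> L2 a b"
  shows "integrable (lebesgue_ab a b) (\<lambda>x. hdot (f x) (g x))"
  by (rule Bochner_Integration.integrable_bound[OF L2_integrable_mult[OF assms]])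
    (use assms norm_hdot_le in auto)

lemma inner_L2_commute: "inner_L2 a b f g = cnj (inner_L2 a b g f)"
  unfolding inner_L2_hdot by (simp flip: Bochner_Integration.integral_cnj hdot_commute)

lemma inner_L2_Cauchy_Schwarz:
  assumes "f \<in> L2 a b" "g \<in> L2 a b"
  shows "cmod (inner_L2 a b f g) \<le> norm_L2 a b f * norm_L2 a b g"
proof -
  have "cmod (inner_L2 a b f g) \<le> (LINT x|lebesgue_ab a b. cmod (hdot (f x) (g x)))"
    unfolding inner_L2_hdot by (rule integral_norm_bound)
  also have "\<dots> \<le> (LINT x|lebesgue_ab a b. norm (f x) * norm (g x))"
    by (intro integral_mono integrable_norm integrable_hdot L2_integrable_mult assms norm_hdot_le)
  also have "\<dots> \<le> norm_L2 a b f * norm_L2 a b g"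
    by (rule L2_norm_mult_le[OF assms])
  finally show ?thesis .
qed

lemma inner_L2_self: "inner_L2 a b f f = of_real ((norm_L2 a b f)\<^sup>2)"
  unfolding inner_L2_hdot norm_L2_power2 hdot_self by (rule integral_complex_of_real)

lemma inner_L2_cong:
  assumes "f \<in> L2 a b" "f' \<in> L2 a b" "g \<in> L2 a b" "g' \<in> L2 a b"
    and "eq_L2 a b f f'" "eq_L2 a b g g'"
  shows "inner_L2 a b f g = inner_L2 a b f' g'"
  unfolding inner_L2_hdot
  by (rule integral_cong_AE) (use assms in \<open>auto simp: eq_L2_def\<close>)

lemma inner_L2_add_right:
  assumes "f \<in> L2 a b" "g \<in> L2 a b" "h \<in> L2 a b"
  shows "inner_L2 a b f (\<lambda>x. g x + h x) = inner_L2 a b f g + inner_L2 a b f h"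
  unfolding inner_L2_hdot hdot_add_right
  by (rule Bochner_Integration.integral_add) (intro integrable_hdot assms)+

lemma inner_L2_smult_right:
  "inner_L2 a b f (\<lambda>x. c *s g x) = c * inner_L2 a b f g"
  unfolding inner_L2_hdot hdot_smult_right by simp

lemma inner_L2_uminus_right:
  "inner_L2 a b f (\<lambda>x. - g x) = - inner_L2 a b f g"
  using inner_L2_smult_right[of a b f "-1" g] by simp

lemma inner_L2_diff_right:
  assumes "f \<in> L2 a b" "g \<in> L2 a b" "h \<in> L2 a b"
  shows "inner_L2 a b f (\<lambda>x. g x - h x) = inner_L2 a b f g - inner_L2 a b f h"
  using inner_L2_add_right[OF assms(1,2) L2_uminus[OF assms(3)]]
  by (simp add: inner_L2_uminus_right)

lemma inner_L2_zero_right [simp]: "inner_L2 a b f (\<lambda>x. 0) = 0"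
  by (simp add: inner_L2_def)

lemma inner_L2_sum_right:
  assumes "f \<in> L2 a b" "\<And>k. k \<in> F \<Longrightarrow> g k \<in> L2 a b"
  shows "inner_L2 a b f (\<lambda>x. \<Sum>k\<in>F. g k x) = (\<Sum>k\<in>F. inner_L2 a b f (g k))"
  using assms(2)
  by (induction F rule: infinite_finite_induct) (simp_all add: inner_L2_add_right assms(1) L2_sum)

lemma inner_L2_add_left:
  assumes "f \<in> L2 a b" "g \<in> L2 a b" "h \<in> L2 a b"
  shows "inner_L2 a b (\<lambda>x. g x + h x) f = inner_L2 a b g f + inner_L2 a b h f"
  using arg_cong[OF inner_L2_add_right[OF assms], of cnj] by (simp flip: inner_L2_commute)

lemma inner_L2_smult_left:
  "inner_L2 a b (\<lambda>x. c *s g x) f = cnj c * inner_L2 a b g f"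
  using arg_cong[OF inner_L2_smult_right[of a b f c g], of cnj] by (simp flip: inner_L2_commute)

lemma inner_L2_diff_left:
  assumes "f \<in> L2 a b" "g \<in> L2 a b" "h \<in> L2 a b"
  shows "inner_L2 a b (\<lambda>x. g x - h x) f = inner_L2 a b g f - inner_L2 a b h f"
  using arg_cong[OF inner_L2_diff_right[OF assms], of cnj] by (simp flip: inner_L2_commute)

lemma norm_L2_add_le:
  fixes f g :: "real \<Rightarrow> complex^'m"
  assumes "f \<in> L2 a b" "g \<in> L2 a b"
  shows "norm_L2 a b (\<lambda>x. f x + g x) \<le> norm_L2 a b f + norm_L2 a b g"
proof (rule power2_le_imp_le)
  let ?h = "\<lambda>x. f x + g x"
  have "complex_of_real ((norm_L2 a b ?h)\<^sup>2) = inner_L2 a b ?h ?h"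
    by (simp add: inner_L2_self)
  also have "\<dots> = inner_L2 a b f f + inner_L2 a b f g + cnj (inner_L2 a b f g) + inner_L2 a b g g"
    using assms by (simp add: inner_L2_add_left inner_L2_add_right L2_add inner_L2_commute[of a b g f])
  finally have "(norm_L2 a b ?h)\<^sup>2 = (norm_L2 a b f)\<^sup>2 + 2 * Re (inner_L2 a b f g) + (norm_L2 a b g)\<^sup>2"
    by (simp add: inner_L2_self complex_eq_iff)
  moreover have "Re (inner_L2 a b f g) \<le> norm_L2 a b f * norm_L2 a b g"
    using inner_L2_Cauchy_Schwarz[OF assms] complex_Re_le_cmod order_trans by blast
  ultimately show "(norm_L2 a b ?h)\<^sup>2 \<le> (norm_L2 a b f + norm_L2 a b g)\<^sup>2"
    by (simp add: power2_sum)
qed simp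

lemma norm_L2_smult: "norm_L2 a b (\<lambda>x. c *s f x) = cmod c * norm_L2 a b (f :: real \<Rightarrow> complex^'m)"
  by (simp add: norm_L2_def norm_smult_vec power_mult_distrib real_sqrt_mult)

lemma norm_L2_zero [simp]: "norm_L2 a b (\<lambda>x. 0) = 0"
  by (simp add: norm_L2_def)

lemma norm_L2_minus: "norm_L2 a b (\<lambda>x. f x - g x) = norm_L2 a b (\<lambda>x. g x - f x)"
  by (simp add: norm_L2_def norm_minus_commute)

lemma norm_L2_diff_triangle:
  fixes f g h :: "real \<Rightarrow> complex^'m"
  assumes "f \<in> L2 a b" "g \<in> L2 a b" "h \<in> L2 a b"
  shows "norm_L2 a b (\<lambda>x. f x - h x) \<le> norm_L2 a b (\<lambda>x. f x - g x) + norm_L2 a b (\<lambda>x. g x - h x)"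
  using norm_L2_add_le[OF L2_diff[OF assms(1,2)] L2_diff[OF assms(2,3)]] by simp

lemma norm_L2_sum_le:
  fixes f :: "'k \<Rightarrow> real \<Rightarrow> complex^'m"
  assumes "\<And>k. k \<in> F \<Longrightarrow> f k \<in> L2 a b"
  shows "norm_L2 a b (\<lambda>x. \<Sum>k\<in>F. f k x) \<le> (\<Sum>k\<in>F. norm_L2 a b (f k))"
  using assms
proof (induction F rule: infinite_finite_induct)
  case (insert k F)
  then have "norm_L2 a b (\<lambda>x. f k x + (\<Sum>k\<in>F. f k x)) \<le> norm_L2 a b (f k) + norm_L2 a b (\<lambda>x. \<Sum>k\<in>F. f k x)"
    by (intro norm_L2_add_le L2_sum) auto
  with insert show ?case by auto
qed simp_all

lemma eq_L2_diff_0: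
  assumes "f \<in> L2 a b" "g \<in> L2 a b" "norm_L2 a b (\<lambda>x. f x - g x) = 0"
  shows "eq_L2 a b f g"
  using assms norm_L2_eq_0_iff[OF L2_diff[OF assms(1,2)]] by (auto simp: eq_L2_def)

section \<open>Completeness and orthonormal bases\<close>

text \<open>Riesz-Fischer in series form. The partial sums \<open>G n\<close> of the pointwise norms
  stay bounded in norm, so by monotone convergence the series converges absolutely almost
  everywhere, and the square \<open>W\<close> of its full sum is an integrable majorant for all
  remainders.\<close>

lemma L2_complete_series:
  fixes d :: "nat \<Rightarrow> real \<Rightarrow> complex^'m"
  assumes d: "\<And>k. d k \<in> L2 a b" and summ: "summable (\<lambda>k. norm_L2 a b (d k))"
  obtains g where "g \<in> L2 a b" "(\<lambda>n. norm_L2 a b (\<lambda>x. g x - (\<Sum>k<n. d k x))) \<longlonglongrightarrow> 0"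
proof -
  let ?M = "lebesgue_ab a b"
  define N where "N k = norm_L2 a b (d k)" for k
  define C where "C = (\<Sum>k. N k)"
  define G where "G n x = (\<Sum>k<n. norm (d k x))" for n x
  have [measurable]: "\<And>k. d k \<in> borel_measurable ?M" using d by (auto intro: L2_measurable)
  have G2: "(G n x)\<^sup>2 = (\<Sum>j<n. \<Sum>k<n. norm (d j x) * norm (d k x))" for n x
    by (simp add: G_def power2_eq_square sum_product)
  have intG: "integrable ?M (\<lambda>x. (G n x)\<^sup>2)" for n
    unfolding G2 by (intro Bochner_Integration.integrable_sum L2_integrable_mult d)
  have GC: "(LINT x|?M. (G n x)\<^sup>2) \<le> C\<^sup>2" for n
  proof -
    have "(LINT x|?M. (G n x)\<^sup>2) = (\<Sum>j<n. \<Sum>k<n. LINT x|?M. norm (d j x) * norm (d k x))"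
      unfolding G2 by (simp add: L2_integrable_mult d)
    also have "\<dots> \<le> (\<Sum>j<n. \<Sum>k<n. N j * N k)"
      unfolding N_def by (intro sum_mono L2_norm_mult_le d)
    also have "\<dots> = (\<Sum>k<n. N k)\<^sup>2" by (simp add: power2_eq_square sum_product)
    also have "\<dots> \<le> C\<^sup>2"
      unfolding C_def using summ by (intro power_mono sum_le_suminf sum_nonneg) (auto simp: N_def)
    finally show ?thesis .
  qed
  have incG: "incseq (\<lambda>n. G n x)" for x
    by (intro incseq_SucI) (simp add: G_def)
  have G0: "0 \<le> G n x" for n x by (simp add: G_def sum_nonneg)
  have AE_summable: "AE x in ?M. summable (\<lambda>k. norm (d k x))"
  proof -
    have "(\<integral>\<^sup>+x. (SUP n. ennreal ((G n x)\<^sup>2)) \<partial>?M) = (SUP n. \<integral>\<^sup>+x. ennreal ((G n x)\<^sup>2) \<partial>?M)"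
    proof (rule nn_integral_monotone_convergence_SUP)
      show "incseq (\<lambda>n x. ennreal ((G n x)\<^sup>2))"
        using incG G0 by (auto simp: incseq_def le_fun_def intro!: ennreal_leI power_mono)
      show "\<And>n. (\<lambda>x. ennreal ((G n x)\<^sup>2)) \<in> borel_measurable ?M"
        unfolding G_def by measurable
    qed
    also have "\<dots> \<le> ennreal (C\<^sup>2)"
      using GC by (intro SUP_least) (simp add: nn_integral_eq_integral[OF intG] ennreal_leI)
    finally have "(\<integral>\<^sup>+x. (SUP n. ennreal ((G n x)\<^sup>2)) \<partial>?M) \<noteq> \<infinity>"
      using ennreal_less_top[of "C\<^sup>2"] by (auto simp: top_unique)
    moreover have "(\<lambda>x. SUP n. ennreal ((G n x)\<^sup>2)) \<in> borel_measurable ?M"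
      unfolding G_def by measurable
    ultimately have "AE x in ?M. (SUP n. ennreal ((G n x)\<^sup>2)) \<noteq> \<infinity>"
      by (intro nn_integral_PInf_AE)
    then show ?thesis
    proof (rule AE_mp, intro AE_I2 impI)
      fix x assume "(SUP n. ennreal ((G n x)\<^sup>2)) \<noteq> \<infinity>"
      then obtain B where B: "B \<ge> 0" "(SUP n. ennreal ((G n x)\<^sup>2)) = ennreal B"
        by (cases "SUP n. ennreal ((G n x)\<^sup>2)") auto
      have "(\<Sum>k<n. norm (d k x)) \<le> sqrt B" for n
      proof -
        have "ennreal ((G n x)\<^sup>2) \<le> ennreal B" unfolding B(2)[symmetric] by (rule SUP_upper) simp
        then have "(G n x)\<^sup>2 \<le> B" using B(1) by (simp add: ennreal_le_iff)
        then show ?thesis using real_le_rsqrt unfolding G_def by blast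
      qed
      then show "summable (\<lambda>k. norm (d k x))" by (intro summableI_nonneg_bounded) auto
    qed
  qed
  define W where "W x = (\<Sum>k. norm (d k x))\<^sup>2" for x
  have intW: "integrable ?M W"
  proof -
    have "convergent (\<lambda>n. LINT x|?M. (G n x)\<^sup>2)"
    proof (rule Bseq_mono_convergent)
      show "Bseq (\<lambda>n. LINT x|?M. (G n x)\<^sup>2)"
        using GC by (intro BseqI'[of _ "C\<^sup>2"]) simp
      show "\<forall>m n. m \<le> n \<longrightarrow> (LINT x|?M. (G m x)\<^sup>2) \<le> (LINT x|?M. (G n x)\<^sup>2)"
        using incG G0 by (auto intro!: integral_mono intG power_mono simp: incseq_def)
    qed
    then obtain y where y: "(\<lambda>n. LINT x|?M. (G n x)\<^sup>2) \<longlonglongrightarrow> y" by (auto simp: convergent_def)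
    show ?thesis
    proof (rule integral_monotone_convergence_nonneg(1)[OF intG _ _ _ y])
      show "AE x in ?M. mono (\<lambda>n. (G n x)\<^sup>2)"
        using incG G0 by (auto simp: mono_def intro!: power_mono)
      show "AE x in ?M. (\<lambda>n. (G n x)\<^sup>2) \<longlonglongrightarrow> W x"
        using AE_summable
        by (rule AE_mp) (auto simp: G_def W_def intro!: AE_I2 tendsto_power summable_LIMSEQ)
      show "W \<in> borel_measurable ?M" unfolding W_def[abs_def] by measurable
    qed auto
  qed
  define g where "g x = (\<Sum>k. d k x)" for x
  have gm [measurable]: "g \<in> borel_measurable ?M" unfolding g_def[abs_def] by measurable
  \<comment> \<open>For n = 0 this bounds g itself, for general n it is the majorant for dominated
    convergence.\<close>
  have dom: "AE x in ?M. \<forall>n. (norm (g x - (\<Sum>k<n. d k x)))\<^sup>2 \<le> W x"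
    using AE_summable
  proof (rule AE_mp, intro AE_I2 impI allI)
    fix x n assume s: "summable (\<lambda>k. norm (d k x))"
    have "g x - (\<Sum>k<n. d k x) = (\<Sum>k. d (k + n) x)"
      unfolding g_def using suminf_minus_initial_segment[OF summable_norm_cancel[OF s], of n] by simp
    also have "norm \<dots> \<le> (\<Sum>k. norm (d (k + n) x))"
      by (rule summable_norm) (use summable_ignore_initial_segment[OF s, of n] in simp)
    also have "\<dots> = (\<Sum>k. norm (d k x)) - (\<Sum>k<n. norm (d k x))"
      by (rule suminf_minus_initial_segment[OF s])
    also have "\<dots> \<le> (\<Sum>k. norm (d k x))" by (simp add: sum_nonneg)
    finally show "(norm (g x - (\<Sum>k<n. d k x)))\<^sup>2 \<le> W x"
      unfolding W_def by (intro power_mono) auto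
  qed
  have "integrable ?M (\<lambda>x. (norm (g x))\<^sup>2)"
    by (rule Bochner_Integration.integrable_bound[OF intW])
      (measurable, rule AE_mp[OF dom], auto intro!: AE_I2 dest: spec[of _ 0])
  then have gL2: "g \<in> L2 a b" using gm by (simp add: L2_def)
  have "(\<lambda>n. LINT x|?M. (norm (g x - (\<Sum>k<n. d k x)))\<^sup>2) \<longlonglongrightarrow> (LINT x|?M. 0)"
  proof (rule integral_dominated_convergence[where w = W])
    show "AE x in ?M. (\<lambda>n. (norm (g x - (\<Sum>k<n. d k x)))\<^sup>2) \<longlonglongrightarrow> 0"
      using AE_summable
    proof (rule AE_mp, intro AE_I2 impI)
      fix x assume s: "summable (\<lambda>k. norm (d k x))"
      have "(\<lambda>n. \<Sum>k<n. d k x) \<longlonglongrightarrow> g x"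
        unfolding g_def by (rule summable_LIMSEQ[OF summable_norm_cancel[OF s]])
      from tendsto_power[OF tendsto_norm[OF tendsto_diff[OF tendsto_const this]], of "g x" 2]
      show "(\<lambda>n. (norm (g x - (\<Sum>k<n. d k x)))\<^sup>2) \<longlonglongrightarrow> 0" by simp
    qed
    show "AE x in ?M. norm ((norm (g x - (\<Sum>k<n. d k x)))\<^sup>2) \<le> W x" for n
      by (rule AE_mp[OF dom]) (auto intro!: AE_I2)
  qed (use intW in measurable)
  from tendsto_real_sqrt[OF this]
  have "(\<lambda>n. norm_L2 a b (\<lambda>x. g x - (\<Sum>k<n. d k x))) \<longlonglongrightarrow> 0"
    by (simp add: norm_L2_def)
  with gL2 show ?thesis by (rule that)
qed

text \<open>\<open>onb_L2\<close> without totality: what Bessel's inequality rests on, and the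
  property that survives unions of chains in Zorn's lemma.\<close>

definition orthonormal_L2 :: "ereal \<Rightarrow> ereal \<Rightarrow> (real \<Rightarrow> complex^'m) set \<Rightarrow> bool" where
  "orthonormal_L2 a b B \<longleftrightarrow> B \<subseteq> L2 a b \<and>
     (\<forall>e\<in>B. \<forall>e'\<in>B. inner_L2 a b e e' = (if e = e' then 1 else 0))"

definition proj_L2 ::
  "ereal \<Rightarrow> ereal \<Rightarrow> (real \<Rightarrow> complex^'m) set \<Rightarrow> (real \<Rightarrow> complex^'m) \<Rightarrow> real \<Rightarrow> complex^'m" where
  "proj_L2 a b F f = (\<lambda>x. \<Sum>e\<in>F. inner_L2 a b e f *s e x)"

lemma proj_L2_L2: "orthonormal_L2 a b B \<Longrightarrow> F \<subseteq> B \<Longrightarrow> proj_L2 a b F f \<in> L2 a b"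
  unfolding proj_L2_def orthonormal_L2_def by (intro L2_sum L2_smult) auto

lemma inner_L2_proj_right:
  assumes "orthonormal_L2 a b B" "F \<subseteq> B" "g \<in> L2 a b"
  shows "inner_L2 a b g (proj_L2 a b F f) = (\<Sum>e\<in>F. inner_L2 a b g e * inner_L2 a b e f)"
proof -
  have "inner_L2 a b g (proj_L2 a b F f) = (\<Sum>e\<in>F. inner_L2 a b g (\<lambda>x. inner_L2 a b e f *s e x))"
    unfolding proj_L2_def
    by (rule inner_L2_sum_right) (use assms in \<open>auto intro!: L2_smult simp: orthonormal_L2_def\<close>)
  then show ?thesis by (simp add: inner_L2_smult_right mult.commute)
qed

lemma inner_L2_basis_proj:
  assumes "orthonormal_L2 a b B" "finite F" "F \<subseteq> B" "e \<in> B"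
  shows "inner_L2 a b e (proj_L2 a b F f) = (if e \<in> F then inner_L2 a b e f else 0)"
proof -
  have "inner_L2 a b e (proj_L2 a b F f) = (\<Sum>e'\<in>F. if e = e' then inner_L2 a b e' f else 0)"
  proof -
    have e: "e \<in> L2 a b" using assms by (auto simp: orthonormal_L2_def)
    show ?thesis
      unfolding inner_L2_proj_right[OF assms(1,3) e]
      by (rule sum.cong) (use assms in \<open>auto simp: orthonormal_L2_def subset_iff\<close>)
  qed
  then show ?thesis using assms(2) by simp
qed

text \<open>Pythagoras. The exact defect is kept because it tends to 0 along the finite subsets of a
  basis and so controls both \<open>Parseval\<close> and \<open>bounded_op_expand\<close>.\<close>

lemma norm_L2_diff_proj:
  assumes "orthonormal_L2 a b B" "finite F" "F \<subseteq> B" "f \<in> L2 a b"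
  shows "(norm_L2 a b (\<lambda>x. f x - proj_L2 a b F f x))\<^sup>2
    = (norm_L2 a b f)\<^sup>2 - (\<Sum>e\<in>F. (cmod (inner_L2 a b e f))\<^sup>2)"
proof -
  let ?p = "proj_L2 a b F f"
  let ?S = "(\<Sum>e\<in>F. (cmod (inner_L2 a b e f))\<^sup>2)"
  have p: "?p \<in> L2 a b" using assms by (intro proj_L2_L2)
  have fp: "inner_L2 a b f ?p = of_real ?S"
    unfolding inner_L2_proj_right[OF assms(1,3,4)] of_real_sum
    by (intro sum.cong refl) (metis complex_norm_square inner_L2_commute mult.commute)
  have pp: "inner_L2 a b ?p ?p = of_real ?S"
  proof -
    have "inner_L2 a b ?p ?p = (\<Sum>e\<in>F. inner_L2 a b ?p e * inner_L2 a b e f)"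
      by (rule inner_L2_proj_right[OF assms(1,3) p])
    also have "\<dots> = (\<Sum>e\<in>F. inner_L2 a b f e * inner_L2 a b e f)"
    proof (intro sum.cong refl arg_cong2[where f = "(*)"])
      fix e assume "e \<in> F"
      then have "inner_L2 a b e ?p = inner_L2 a b e f"
        using inner_L2_basis_proj[OF assms(1-3), of e f] assms(3) by auto
      then show "inner_L2 a b ?p e = inner_L2 a b f e" by (metis inner_L2_commute)
    qed
    also have "\<dots> = inner_L2 a b f ?p" by (rule inner_L2_proj_right[OF assms(1,3,4), symmetric])
    finally show ?thesis by (simp only: fp)
  qed
  have pf: "inner_L2 a b ?p f = of_real ?S" using fp inner_L2_commute[of a b ?p f] by simp
  have "complex_of_real ((norm_L2 a b (\<lambda>x. f x - ?p x))\<^sup>2) = inner_L2 a b (\<lambda>x. f x - ?p x) (\<lambda>x. f x - ?p x)"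
    by (simp add: inner_L2_self)
  also have "\<dots> = inner_L2 a b f f - inner_L2 a b f ?p - inner_L2 a b ?p f + inner_L2 a b ?p ?p"
    using assms(4) p by (simp add: inner_L2_diff_left inner_L2_diff_right L2_diff)
  also have "\<dots> = of_real ((norm_L2 a b f)\<^sup>2) - of_real ?S"
    unfolding fp pf pp by (simp add: inner_L2_self)
  finally show ?thesis unfolding of_real_diff[symmetric] of_real_eq_iff .
qed

lemma Bessel:
  assumes "orthonormal_L2 a b B" "finite F" "F \<subseteq> B" "f \<in> L2 a b"
  shows "(\<Sum>e\<in>F. (cmod (inner_L2 a b e f))\<^sup>2) \<le> (norm_L2 a b f)\<^sup>2"
  using norm_L2_diff_proj[OF assms] zero_le_power2[of "norm_L2 a b (\<lambda>x. f x - proj_L2 a b F f x)"] by linarith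

lemma onb_orthonormal: "onb_L2 a b B \<Longrightarrow> orthonormal_L2 a b B"
  by (simp add: onb_L2_def orthonormal_L2_def)

text \<open>Totality only says that a function orthogonal to the basis vanishes, so the expansion
  needs completeness: projections onto suitable finite sets \<open>F n\<close> converge, the limit g
  has the same coefficients as f, hence f = g almost everywhere. Countability of the basis is not
  presupposed; the \<open>F n\<close> are picked from the convergence of the sum of squared
  coefficients.\<close>

lemma Parseval_norm:
  fixes f :: "real \<Rightarrow> complex^'m"
  assumes onb: "onb_L2 a b B" and f: "f \<in> L2 a b"
  shows "((\<lambda>e. (cmod (inner_L2 a b e f))\<^sup>2) has_sum (norm_L2 a b f)\<^sup>2) B"
proof -
  note on = onb_orthonormal[OF onb]
  let ?c = "\<lambda>e. (cmod (inner_L2 a b e f))\<^sup>2"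
  have pow: "((1/2)^n)\<^sup>2 = (1/4 :: real)^n" for n :: nat
    unfolding power2_eq_square power_mult_distrib[symmetric] by simp
  have summ: "?c summable_on B"
    by (rule nonneg_bdd_above_summable_on) (use Bessel[OF on _ _ f] in \<open>auto intro!: bdd_aboveI2\<close>)
  define S where "S = infsum ?c B"
  have S: "(?c has_sum S) B" using summ by (simp add: S_def)
  \<comment> \<open>Tails of size 4^-n make the increments of the projections at most 2^-n in norm,
    which is summable.\<close>
  have "\<exists>F. finite F \<and> F \<subseteq> B \<and> S - sum ?c F \<le> (1/4)^n" for n :: nat
    using has_sum_finite_approximation[OF S, of "(1/4)^n"] by (auto simp: dist_real_def abs_le_iff)
  then obtain F0 where F0: "\<And>n::nat. finite (F0 n) \<and> F0 n \<subseteq> B \<and> S - sum ?c (F0 n) \<le> (1/4)^n" by metis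
  define F where "F n = (\<Union>k\<le>n. F0 k)" for n
  have F: "finite (F n)" "F n \<subseteq> B" for n using F0 by (auto simp: F_def)
  have mono: "F n \<subseteq> F (Suc n)" for n
    unfolding F_def by (intro UN_mono) auto
  have tail: "S - sum ?c (F n) \<le> (1/4)^n" for n
  proof -
    have "sum ?c (F0 n) \<le> sum ?c (F n)" by (intro sum_mono2 F) (auto simp: F_def)
    with F0[of n] show ?thesis by linarith
  qed
  have le_S: "sum ?c E \<le> S" if "finite E" "E \<subseteq> B" for E
    unfolding S_def by (rule finite_sum_le_infsum[OF summ that]) auto
  have small: "sum ?c E \<le> (1/4)^n" if "finite E" "E \<subseteq> B" "E \<inter> F n = {}" for E n
  proof -
    have "sum ?c (E \<union> F n) = sum ?c E + sum ?c (F n)" using that F by (intro sum.union_disjoint) auto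
    then show ?thesis using le_S[of "E \<union> F n"] that F tail[of n] by auto
  qed
  let ?p = "\<lambda>n. proj_L2 a b (F n) f"
  define d where "d n = (case n of 0 \<Rightarrow> ?p 0 | Suc k \<Rightarrow> (\<lambda>x. ?p (Suc k) x - ?p k x))" for n
  have pL2: "?p n \<in> L2 a b" for n by (rule proj_L2_L2[OF on F(2)])
  have dL2: "d n \<in> L2 a b" for n using pL2 by (auto simp: d_def intro!: L2_diff split: nat.split)
  have dsum: "(\<Sum>k<Suc n. d k x) = ?p n x" for n x
    by (induction n) (auto simp: d_def)
  have nd: "norm_L2 a b (d (Suc n)) \<le> (1/2)^n" for n
  proof (rule power2_le_imp_le)
    let ?E = "F (Suc n) - F n"
    have eq: "d (Suc n) = proj_L2 a b ?E f"
      unfolding d_def proj_L2_def using F mono by (auto simp: sum_diff)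
    have E: "finite ?E" "?E \<subseteq> B" using F by auto
    have "complex_of_real ((norm_L2 a b (d (Suc n)))\<^sup>2) = inner_L2 a b (d (Suc n)) (d (Suc n))"
      by (simp add: inner_L2_self)
    also have "\<dots> = (\<Sum>e\<in>?E. inner_L2 a b (d (Suc n)) e * inner_L2 a b e f)"
      using inner_L2_proj_right[OF on E(2) dL2[of "Suc n"], of f] unfolding eq .
    also have "\<dots> = (\<Sum>e\<in>?E. of_real (?c e))"
    proof (rule sum.cong[OF refl])
      fix e assume e: "e \<in> ?E"
      then have "inner_L2 a b e (d (Suc n)) = inner_L2 a b e f"
        using inner_L2_basis_proj[OF on E, of e f] E(2) unfolding eq by auto
      then have "inner_L2 a b (d (Suc n)) e = cnj (inner_L2 a b e f)" by (metis inner_L2_commute)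
      then show "inner_L2 a b (d (Suc n)) e * inner_L2 a b e f = of_real (?c e)"
        by (simp add: complex_norm_square mult.commute del: of_real_power)
    qed
    finally have "(norm_L2 a b (d (Suc n)))\<^sup>2 = sum ?c ?E" unfolding of_real_sum[symmetric] of_real_eq_iff .
    also have "\<dots> \<le> (1/4)^n" using E by (intro small) auto
    finally show "(norm_L2 a b (d (Suc n)))\<^sup>2 \<le> ((1/2)^n)\<^sup>2"
      by (simp only: pow)
  qed simp
  have "summable (\<lambda>n. norm_L2 a b (d (Suc n)))"
    by (rule summable_comparison_test'[of "\<lambda>n. (1/2)^n" 0]) (use nd in \<open>auto intro: summable_geometric\<close>)
  then have "summable (\<lambda>n. norm_L2 a b (d n))" by (rule summable_Suc_iff[THEN iffD1])
  then obtain g where g: "g \<in> L2 a b" "(\<lambda>n. norm_L2 a b (\<lambda>x. g x - (\<Sum>k<n. d k x))) \<longlonglongrightarrow> 0"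
    using L2_complete_series[of d a b] dL2 by blast
  have lim: "(\<lambda>n. norm_L2 a b (\<lambda>x. g x - ?p n x)) \<longlonglongrightarrow> 0"
    using LIMSEQ_Suc[OF g(2)] by (simp only: dsum)
  have "inner_L2 a b e (\<lambda>x. f x - g x) = 0" if e: "e \<in> B" for e
  proof -
    have eL2: "e \<in> L2 a b" and ne: "norm_L2 a b e = 1"
      using on e inner_L2_self[of a b e] norm_L2_nonneg[of a b e]
      by (auto simp: orthonormal_L2_def power2_eq_1_iff of_real_eq_1_iff simp del: of_real_power)
    have b1: "cmod (inner_L2 a b e (\<lambda>x. f x - g x)) \<le> (1/2)^n + norm_L2 a b (\<lambda>x. g x - ?p n x)" for n
    proof -
      have "inner_L2 a b e (\<lambda>x. f x - g x) = (inner_L2 a b e f - inner_L2 a b e (?p n)) - inner_L2 a b e (\<lambda>x. g x - ?p n x)"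
        using eL2 f g(1) pL2[of n] by (simp add: inner_L2_diff_right)
      also have "cmod \<dots> \<le> cmod (inner_L2 a b e f - inner_L2 a b e (?p n)) + cmod (inner_L2 a b e (\<lambda>x. g x - ?p n x))"
        by (rule norm_triangle_ineq4)
      \<comment> \<open>If e lies in \<open>F n\<close>, the coefficients of f and of its projection
        agree; otherwise the coefficient of f is itself part of the tail beyond
        \<open>F n\<close>.\<close>
      also have "cmod (inner_L2 a b e f - inner_L2 a b e (?p n)) \<le> (1/2)^n"
      proof (cases "e \<in> F n")
        case True
        then show ?thesis by (simp add: inner_L2_basis_proj[OF on F e])
      next
        case False
        then have "(cmod (inner_L2 a b e f))\<^sup>2 \<le> (1/4)^n" using small[of "{e}" n] e by simp
        then have "(cmod (inner_L2 a b e f))\<^sup>2 \<le> ((1/2)^n)\<^sup>2"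
          by (simp only: pow)
        then have "cmod (inner_L2 a b e f) \<le> (1/2)^n" by (rule power2_le_imp_le) simp
        with False show ?thesis by (simp add: inner_L2_basis_proj[OF on F e])
      qed
      also have "cmod (inner_L2 a b e (\<lambda>x. g x - ?p n x)) \<le> 1 * norm_L2 a b (\<lambda>x. g x - ?p n x)"
        using inner_L2_Cauchy_Schwarz[OF eL2 L2_diff[OF g(1) pL2[of n]]] ne by simp
      finally show ?thesis by simp
    qed
    have "(\<lambda>n. (1/2::real)^n + norm_L2 a b (\<lambda>x. g x - ?p n x)) \<longlonglongrightarrow> 0 + 0"
      by (intro tendsto_add lim LIMSEQ_power_zero) simp
    then have "cmod (inner_L2 a b e (\<lambda>x. f x - g x)) \<le> 0 + 0"
      by (rule LIMSEQ_le_const) (use b1 in blast)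
    then show ?thesis by simp
  qed
  then have "eq_L2 a b (\<lambda>x. f x - g x) (\<lambda>x. 0)"
    using onb L2_diff[OF f g(1)] by (simp add: onb_L2_def)
  then have fg0: "norm_L2 a b (\<lambda>x. f x - g x) = 0" using norm_L2_eq_0_iff[OF L2_diff[OF f g(1)]] by simp
  have b2: "(norm_L2 a b f)\<^sup>2 - S \<le> (norm_L2 a b (\<lambda>x. g x - ?p n x))\<^sup>2" for n
  proof -
    have "(norm_L2 a b f)\<^sup>2 - S \<le> (norm_L2 a b f)\<^sup>2 - sum ?c (F n)" using le_S[OF F] by simp
    also have "\<dots> = (norm_L2 a b (\<lambda>x. f x - ?p n x))\<^sup>2" by (rule norm_L2_diff_proj[OF on F f, symmetric])
    also have "\<dots> \<le> (norm_L2 a b (\<lambda>x. g x - ?p n x))\<^sup>2"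
      using norm_L2_diff_triangle[OF f g(1) pL2[of n]] fg0 by (intro power_mono) auto
    finally show ?thesis .
  qed
  have "(\<lambda>n. (norm_L2 a b (\<lambda>x. g x - ?p n x))\<^sup>2) \<longlonglongrightarrow> 0\<^sup>2" by (intro tendsto_power lim)
  then have "(norm_L2 a b f)\<^sup>2 - S \<le> 0\<^sup>2" by (rule LIMSEQ_le_const) (use b2 in blast)
  moreover have "S \<le> (norm_L2 a b f)\<^sup>2"
    by (rule has_sum_le_finite_sums[OF S]) (use Bessel[OF on _ _ f] in auto)
  ultimately show ?thesis using S by simp
qed

text \<open>The error of a finite partial sum is the scalar product of f with the part of g
  orthogonal to F, whose norm tends to 0 by \<open>Parseval_norm\<close>.\<close>

lemma Parseval:
  fixes f g :: "real \<Rightarrow> complex^'m"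
  assumes onb: "onb_L2 a b B" and f: "f \<in> L2 a b" and g: "g \<in> L2 a b"
  shows "((\<lambda>e. inner_L2 a b f e * inner_L2 a b e g) has_sum inner_L2 a b f g) B"
  unfolding has_sum_def
proof (rule Lim_null[THEN iffD2], rule tendsto_0_le[where K = 1])
  note on = onb_orthonormal[OF onb]
  have "((\<lambda>F. (norm_L2 a b g)\<^sup>2 - (\<Sum>e\<in>F. (cmod (inner_L2 a b e g))\<^sup>2)) \<longlongrightarrow> (norm_L2 a b g)\<^sup>2 - (norm_L2 a b g)\<^sup>2)
      (finite_subsets_at_top B)"
    using Parseval_norm[OF onb g] unfolding has_sum_def by (intro tendsto_diff tendsto_const)
  from tendsto_mult[OF tendsto_const[of "norm_L2 a b f"] tendsto_real_sqrt[OF this]]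
  show "((\<lambda>F. norm_L2 a b f * sqrt ((norm_L2 a b g)\<^sup>2 - (\<Sum>e\<in>F. (cmod (inner_L2 a b e g))\<^sup>2))) \<longlongrightarrow> 0)
      (finite_subsets_at_top B)" by simp
  show "\<forall>\<^sub>F F in finite_subsets_at_top B.
      norm ((\<Sum>e\<in>F. inner_L2 a b f e * inner_L2 a b e g) - inner_L2 a b f g)
      \<le> norm (norm_L2 a b f * sqrt ((norm_L2 a b g)\<^sup>2 - (\<Sum>e\<in>F. (cmod (inner_L2 a b e g))\<^sup>2))) * 1"
  proof (rule eventually_finite_subsets_at_top_weakI)
    fix F assume F: "finite F" "F \<subseteq> B"
    let ?r = "\<lambda>x. g x - proj_L2 a b F g x"
    have p: "proj_L2 a b F g \<in> L2 a b" by (rule proj_L2_L2[OF on F(2)])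
    have "(\<Sum>e\<in>F. inner_L2 a b f e * inner_L2 a b e g) - inner_L2 a b f g = - inner_L2 a b f ?r"
      by (simp add: inner_L2_diff_right[OF f g p] inner_L2_proj_right[OF on F(2) f])
    then have "cmod ((\<Sum>e\<in>F. inner_L2 a b f e * inner_L2 a b e g) - inner_L2 a b f g)
        \<le> norm_L2 a b f * norm_L2 a b ?r"
      using inner_L2_Cauchy_Schwarz[OF f L2_diff[OF g p]] by simp
    also have "norm_L2 a b ?r = sqrt ((norm_L2 a b g)\<^sup>2 - (\<Sum>e\<in>F. (cmod (inner_L2 a b e g))\<^sup>2))"
      using norm_L2_diff_proj[OF on F g] by (metis norm_L2_nonneg real_sqrt_unique)
    finally show "norm ((\<Sum>e\<in>F. inner_L2 a b f e * inner_L2 a b e g) - inner_L2 a b f g)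
      \<le> norm (norm_L2 a b f * sqrt ((norm_L2 a b g)\<^sup>2 - (\<Sum>e\<in>F. (cmod (inner_L2 a b e g))\<^sup>2))) * 1"
      by simp
  qed
qed

text \<open>Gives the absolute summability on which later exchanges of basis sums and nuclear sums
  rely, with a bound that is independent of the basis.\<close>

lemma Bessel_product:
  assumes on: "orthonormal_L2 a b B" and F: "finite F" "F \<subseteq> B" and f: "f \<in> L2 a b" and g: "g \<in> L2 a b"
  shows "(\<Sum>e\<in>F. cmod (inner_L2 a b f e) * cmod (inner_L2 a b e g)) \<le> norm_L2 a b f * norm_L2 a b g"
proof -
  have L: "L2_set (\<lambda>e. cmod (inner_L2 a b e h)) F \<le> norm_L2 a b h" if "h \<in> L2 a b" for h
    unfolding L2_set_def by (rule real_le_lsqrt) (use Bessel[OF on F that] in \<open>auto intro: sum_nonneg\<close>)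
  have "(\<Sum>e\<in>F. cmod (inner_L2 a b f e) * cmod (inner_L2 a b e g))
      = (\<Sum>e\<in>F. \<bar>cmod (inner_L2 a b e f)\<bar> * \<bar>cmod (inner_L2 a b e g)\<bar>)"
    by (intro sum.cong refl) (metis abs_norm_cancel complex_mod_cnj inner_L2_commute)
  also have "\<dots> \<le> L2_set (\<lambda>e. cmod (inner_L2 a b e f)) F * L2_set (\<lambda>e. cmod (inner_L2 a b e g)) F"
    by (rule L2_set_mult_ineq)
  also have "\<dots> \<le> norm_L2 a b f * norm_L2 a b g"
    by (intro mult_mono L f g L2_set_nonneg norm_L2_nonneg)
  finally show ?thesis .
qed

lemma Bessel_product_summable:
  assumes on: "orthonormal_L2 a b B" and f: "f \<in> L2 a b" and g: "g \<in> L2 a b"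
  shows "(\<lambda>e. cmod (inner_L2 a b f e) * cmod (inner_L2 a b e g)) summable_on B"
    and "infsum (\<lambda>e. cmod (inner_L2 a b f e) * cmod (inner_L2 a b e g)) B \<le> norm_L2 a b f * norm_L2 a b g"
proof -
  show s: "(\<lambda>e. cmod (inner_L2 a b f e) * cmod (inner_L2 a b e g)) summable_on B"
    by (rule nonneg_bdd_above_summable_on)
      (use Bessel_product[OF on _ _ f g] in \<open>auto intro!: bdd_aboveI2\<close>)
  show "infsum (\<lambda>e. cmod (inner_L2 a b f e) * cmod (inner_L2 a b e g)) B \<le> norm_L2 a b f * norm_L2 a b g"
    by (rule infsum_le_finite_sums[OF s]) (use Bessel_product[OF on _ _ f g] in auto)
qed

text \<open>Zorn's lemma among orthonormal sets of functions each living on one level set of \<pi>.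
  A maximal set is total: if f is orthogonal to it, so is the restriction of f to any level set, and
  a nonzero restriction could be normalised and added. A constant \<pi> yields plain existence of an
  orthonormal basis.\<close>

lemma exists_localized_onb:
  fixes \<pi> :: "real \<Rightarrow> int"
  assumes meas: "\<And>i. {x. \<pi> x = i} \<in> sets lebesgue"
  shows "\<exists>B :: (real \<Rightarrow> complex^'m) set. onb_L2 a b B \<and> (\<forall>e\<in>B. \<exists>i. \<forall>x. \<pi> x \<noteq> i \<longrightarrow> e x = 0)"
proof -
  define \<A> where "\<A> = {B :: (real \<Rightarrow> complex^'m) set. orthonormal_L2 a b B \<and> (\<forall>e\<in>B. \<exists>i. \<forall>x. \<pi> x \<noteq> i \<longrightarrow> e x = 0)}"
  have "\<exists>M\<in>\<A>. \<forall>X\<in>\<A>. M \<subseteq> X \<longrightarrow> X = M"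
  proof (rule subset_Zorn')
    fix C assume C: "subset.chain \<A> C"
    have "orthonormal_L2 a b (\<Union>C)"
      unfolding orthonormal_L2_def
    proof (intro conjI ballI)
      show "\<Union>C \<subseteq> L2 a b"
        using C by (auto simp: subset_chain_def \<A>_def orthonormal_L2_def subset_iff)
      fix e e' assume "e \<in> \<Union>C" "e' \<in> \<Union>C"
      then obtain X Y where XY: "X \<in> C" "Y \<in> C" "e \<in> X" "e' \<in> Y" by auto
      then obtain Z where "Z \<in> C" "e \<in> Z" "e' \<in> Z" using C unfolding subset_chain_def by blast
      moreover have "Z \<in> \<A>" using C \<open>Z \<in> C\<close> by (auto simp: subset_chain_def)
      ultimately show "inner_L2 a b e e' = (if e = e' then 1 else 0)"
        by (auto simp: \<A>_def orthonormal_L2_def)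
    qed
    moreover have "\<forall>e\<in>\<Union>C. \<exists>i. \<forall>x. \<pi> x \<noteq> i \<longrightarrow> e x = 0"
      using C by (auto simp: subset_chain_def \<A>_def subset_iff)
    ultimately show "\<Union>C \<in> \<A>" by (simp add: \<A>_def)
  qed
  then obtain B where B: "B \<in> \<A>" and max: "\<And>X. X \<in> \<A> \<Longrightarrow> B \<subseteq> X \<Longrightarrow> X = B" by blast
  have on: "orthonormal_L2 a b B" and loc: "\<And>e. e \<in> B \<Longrightarrow> \<exists>i. \<forall>x. \<pi> x \<noteq> i \<longrightarrow> e x = 0"
    using B by (auto simp: \<A>_def)
  have "eq_L2 a b f (\<lambda>x. 0)" if f: "f \<in> L2 a b" and orth: "\<forall>e\<in>B. inner_L2 a b e f = 0" for f
  proof -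
    have "AE x in lebesgue_ab a b. \<pi> x = i \<longrightarrow> f x = 0" for i
    proof -
      define h where "h = (\<lambda>x. if x \<in> {x. \<pi> x = i} then f x else 0)"
      have h: "h \<in> L2 a b" unfolding h_def by (rule L2_indicator[OF f meas])
      have he: "inner_L2 a b e h = 0" if e: "e \<in> B" for e
      proof -
        obtain j where j: "\<And>x. \<pi> x \<noteq> j \<Longrightarrow> e x = 0" using loc[OF e] by auto
        \<comment> \<open>An element living on another cell pairs to 0 with h, and one living on
          cell i does not distinguish h from f.\<close>
        have "hdot (e x) (h x) = (if i = j then hdot (e x) (f x) else 0)" for x
          using j[of x] by (auto simp: h_def hdot_def)
        then show ?thesis using orth e by (cases "i = j") (auto simp: inner_L2_hdot)
      qed
      have "norm_L2 a b h = 0"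
      proof (rule ccontr)
        assume nz: "norm_L2 a b h \<noteq> 0"
        define c where "c = norm_L2 a b h"
        define e where "e = (\<lambda>x. complex_of_real (1 / c) *s h x)"
        have c: "c > 0" using nz by (simp add: c_def less_le)
        have e: "e \<in> L2 a b" unfolding e_def by (rule L2_smult[OF h])
        have ee: "inner_L2 a b e e = 1"
          using c unfolding e_def inner_L2_smult_left inner_L2_smult_right inner_L2_self
          by (simp add: c_def[symmetric] power2_eq_square)
        have e0: "inner_L2 a b e' e = 0" "inner_L2 a b e e' = 0" if "e' \<in> B" for e'
          using he[OF that] inner_L2_commute[of a b h e']
          unfolding e_def inner_L2_smult_left inner_L2_smult_right by auto
        have "e \<notin> B" using e0(1)[of e] ee by auto
        have "insert e B \<in> \<A>"
          unfolding \<A>_def orthonormal_L2_def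
        proof (intro CollectI conjI ballI)
          show "insert e B \<subseteq> L2 a b" using e on by (auto simp: orthonormal_L2_def)
          show "inner_L2 a b u v = (if u = v then 1 else 0)" if "u \<in> insert e B" "v \<in> insert e B" for u v
            using that e0 ee on \<open>e \<notin> B\<close> by (auto simp: orthonormal_L2_def)
          have "\<forall>x. \<pi> x \<noteq> i \<longrightarrow> e x = 0" by (simp add: e_def h_def)
          then show "\<exists>i. \<forall>x. \<pi> x \<noteq> i \<longrightarrow> u x = 0" if "u \<in> insert e B" for u
            using that loc by blast
        qed
        then have "insert e B = B" by (rule max) auto
        with \<open>e \<notin> B\<close> show False by auto
      qed
      then have "eq_L2 a b h (\<lambda>x. 0)" using norm_L2_eq_0_iff[OF h] by simp
      then show ?thesis unfolding eq_L2_def by (rule AE_mp) (auto simp: h_def intro!: AE_I2)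
    qed
    \<comment> \<open>\<pi> is integer valued, so only countably many null sets are
      combined.\<close>
    then have "AE x in lebesgue_ab a b. \<forall>i. \<pi> x = i \<longrightarrow> f x = 0"
      unfolding AE_all_countable by blast
    then show ?thesis unfolding eq_L2_def by (rule AE_mp) (auto intro!: AE_I2)
  qed
  then have "onb_L2 a b B" using on by (auto simp: onb_L2_def orthonormal_L2_def)
  then show ?thesis using loc by blast
qed

section \<open>Principal minors\<close>

text \<open>The index set is a subset of an arbitrary type and the entries lie in any commutative
  ring: the indices will be basis functions, nuclear indices and sum types, the entries complex
  numbers or formal power series.\<close>

definition minor :: "('i \<Rightarrow> 'i \<Rightarrow> 'a::comm_ring_1) \<Rightarrow> 'i set \<Rightarrow> 'a" where
  "minor M S = (\<Sum>p | p permutes S. of_int (sign p) * (\<Prod>i\<in>S. M i (p i)))"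

lemma minor_op_eq_minor: "minor_op a b A I = minor (\<lambda>e e'. inner_L2 a b e (A e')) I"
  by (simp add: minor_op_def minor_def)

lemma det_eq_minor: "det A = minor (\<lambda>i j. A $ i $ j) UNIV"
  by (simp add: det_def minor_def)

lemma minor_empty [simp]: "minor M {} = 1"
  by (simp add: minor_def permutes_empty)

lemma minor_cong: "(\<And>i j. i \<in> S \<Longrightarrow> j \<in> S \<Longrightarrow> M i j = N i j) \<Longrightarrow> minor M S = minor N S"
  unfolding minor_def by (intro sum.cong prod.cong arg_cong2[where f = "(*)"] refl) (auto simp: permutes_in_image)

text \<open>Relabelling conjugates each permutation by f, which preserves its sign.\<close>

lemma minor_reindex:
  assumes "inj_on f S" "finite S"
  shows "minor M (f ` S) = minor (\<lambda>i j. M (f i) (f j)) S"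
proof -
  have b: "bij_betw f S (f ` S)" using assms by (simp add: inj_on_imp_bij_betw)
  have b': "bij_betw (inv_into S f) (f ` S) S" using bij_betw_inv_into[OF b] .
  have "minor (\<lambda>i j. M (f i) (f j)) S
      = (\<Sum>p | p permutes f ` S. of_int (sign p) * (\<Prod>i\<in>f ` S. M i (p i)))"
    unfolding minor_def
  proof (rule sum.reindex_bij_witness[where j = "map_permutation S f"
        and i = "map_permutation (f ` S) (inv_into S f)"], goal_cases)
    case (1 p)
    then show ?case using map_permutation_compose_inv[OF b, of p "inv_into S f"] assms by auto
  next
    case (2 p)
    then show ?case using map_permutation_permutes[OF b, of p] by simp
  next
    case (3 p)
    then show ?case using map_permutation_compose_inv[OF b', of p f] by (auto simp: f_inv_into_f)
  next
    case (4 p)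
    then show ?case using map_permutation_permutes[OF b', of p] by simp
  next
    case (5 p)
    then have p: "p permutes S" by simp
    have "(\<Prod>i\<in>f ` S. M i (map_permutation S f p i)) = (\<Prod>i\<in>S. M (f i) (f (p i)))"
      by (subst prod.reindex[OF assms(1)])
        (use assms in \<open>auto intro!: prod.cong simp: map_permutation_apply\<close>)
    then show ?case using sign_map_permutation[OF assms(1) p assms(2)] by simp
  qed
  then show ?thesis by (simp add: minor_def)
qed

text \<open>A permutation moving a point of S into T picks up a zero factor. The others preserve S,
  hence also T, and factor uniquely into a permutation of S and one of T.\<close>

lemma minor_block:
  assumes "finite S" "finite T" "S \<inter> T = {}" and zero: "\<And>i j. i \<in> S \<Longrightarrow> j \<in> T \<Longrightarrow> M i j = 0"
  shows "minor M (S \<union> T) = minor M S * minor M T"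
proof -
  let ?P = "{p. p permutes (S \<union> T)}" and ?R = "{p. p permutes (S \<union> T) \<and> p ` S \<subseteq> S}"
  let ?g = "\<lambda>p. of_int (sign p) * (\<Prod>i\<in>S \<union> T. M i (p i))"
  have fin: "finite ?P" using assms by (simp add: finite_permutations)
  have split: "(\<Prod>i\<in>S \<union> T. h i) = (\<Prod>i\<in>S. h i) * (\<Prod>i\<in>T. h i)" for h :: "'a \<Rightarrow> 'b"
    using assms by (intro prod.union_disjoint) auto
  have "minor M (S \<union> T) = sum ?g ?R"
    unfolding minor_def
  proof (rule sum.mono_neutral_right[OF fin])
    show "\<forall>p\<in>?P - ?R. ?g p = 0"
    proof
      fix p assume "p \<in> ?P - ?R"
      then obtain i where i: "i \<in> S" "p i \<notin> S" "p permutes (S \<union> T)" by auto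
      then have "p i \<in> T" using permutes_in_image[OF i(3), of i] by auto
      with i zero have "(\<Prod>i\<in>S. M i (p i)) = 0" using assms(1) by (intro prod_zero) auto
      then show "?g p = 0" by (simp add: split)
    qed
  qed auto
  also have "\<dots> = (\<Sum>(p, q)\<in>{p. p permutes S} \<times> {q. q permutes T}.
      (of_int (sign p) * (\<Prod>i\<in>S. M i (p i))) * (of_int (sign q) * (\<Prod>i\<in>T. M i (q i))))"
  proof (rule sum.reindex_bij_witness[where i = "\<lambda>(p, q). p \<circ> q"
        and j = "\<lambda>r. (\<lambda>x. if x \<in> S then r x else x, \<lambda>x. if x \<in> T then r x else x)"], goal_cases)
    case (1 r)
    then have r: "r permutes (S \<union> T)" "r ` S \<subseteq> S" by auto
    have "r ` S = S" using r assms(1) permutes_inj_on[OF r(1), of S] by (intro endo_inj_surj) auto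
    moreover have "inj r" using r permutes_inj by blast
    ultimately have "r x \<in> S \<longleftrightarrow> x \<in> S" for x by (auto dest: injD)
    moreover have "x \<notin> S \<Longrightarrow> x \<notin> T \<Longrightarrow> r x = x" for x using r permutes_not_in by fastforce
    ultimately show ?case using assms(3) by (auto simp: fun_eq_iff)
  next
    case (2 r)
    then have r: "r permutes (S \<union> T)" "r ` S \<subseteq> S" by auto
    have rS: "r ` S = S" using r assms(1) permutes_inj_on[OF r(1), of S] by (intro endo_inj_surj) auto
    have inj: "inj r" using r permutes_inj by blast
    have rT: "r ` T = T"
    proof -
      have "r ` T \<subseteq> T"
      proof safe
        fix x assume x: "x \<in> T"
        then have "r x \<in> S \<union> T" using permutes_in_image[OF r(1), of x] by auto
        moreover have "r x \<notin> S" using x rS inj assms(3) by (auto dest: injD)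
        ultimately show "r x \<in> T" by auto
      qed
      then show ?thesis using assms(2) inj by (intro endo_inj_surj) (auto intro: inj_on_subset)
    qed
    have "(\<lambda>x. if x \<in> V then r x else x) permutes V" if "r ` V = V" for V
      by (rule bij_imp_permutes) (use that inj in \<open>auto simp: bij_betw_def inj_on_def dest: injD\<close>)
    then show ?case using rS rT by auto
  next
    case (3 pq)
    then obtain p q where pq: "pq = (p, q)" "p permutes S" "q permutes T" by auto
    have "q x \<in> T" if "x \<in> T" for x using that permutes_in_image[OF pq(3)] by auto
    moreover have "x \<notin> S \<Longrightarrow> p x = x" "x \<notin> T \<Longrightarrow> q x = x" for x
      using pq permutes_not_in by fastforce+
    moreover have "x \<in> S \<Longrightarrow> x \<notin> T" for x using assms(3) by auto
    ultimately show ?case using pq by (auto simp: fun_eq_iff)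
  next
    case (4 pq)
    then obtain p q where pq: "pq = (p, q)" "p permutes S" "q permutes T" by auto
    have "(p \<circ> q) permutes (S \<union> T)"
      using pq by (intro permutes_compose) (auto intro: permutes_subset)
    moreover have "(p \<circ> q) ` S \<subseteq> S"
      using pq assms(3) permutes_not_in[OF pq(3)] permutes_in_image[OF pq(2)] by fastforce
    ultimately show ?case using pq by auto
  next
    case (5 r)
    then have r: "r permutes (S \<union> T)" "r ` S \<subseteq> S" by auto
    let ?p = "\<lambda>x. if x \<in> S then r x else x" and ?q = "\<lambda>x. if x \<in> T then r x else x"
    have rS: "r ` S = S" using r assms(1) permutes_inj_on[OF r(1), of S] by (intro endo_inj_surj) auto
    have inj: "inj r" using r permutes_inj by blast
    have rT: "r ` T = T"
    proof -
      have "r ` T \<subseteq> T"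
      proof safe
        fix x assume x: "x \<in> T"
        then have "r x \<in> S \<union> T" using permutes_in_image[OF r(1), of x] by auto
        moreover have "r x \<notin> S" using x rS inj assms(3) by (auto dest: injD)
        ultimately show "r x \<in> T" by auto
      qed
      then show ?thesis using assms(2) inj by (intro endo_inj_surj) (auto intro: inj_on_subset)
    qed
    have perm: "(\<lambda>x. if x \<in> V then r x else x) permutes V" if "r ` V = V" for V
      by (rule bij_imp_permutes) (use that inj in \<open>auto simp: bij_betw_def inj_on_def dest: injD\<close>)
    have p: "?p permutes S" and q: "?q permutes T" using perm[OF rS] perm[OF rT] .
    have eq: "?p \<circ> ?q = r"
    proof
      fix x
      have "x \<notin> S \<Longrightarrow> x \<notin> T \<Longrightarrow> r x = x" using r permutes_not_in by fastforce
      moreover have "x \<in> T \<Longrightarrow> r x \<notin> S" using rT assms(3) by auto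
      ultimately show "(?p \<circ> ?q) x = r x" using assms(3) by auto
    qed
    have "sign (?p \<circ> ?q) = sign ?p * sign ?q"
      using permutes_imp_permutation[OF assms(1) p] permutes_imp_permutation[OF assms(2) q]
      by (rule sign_compose)
    then have s: "sign r = sign ?p * sign ?q" unfolding eq .
    show ?case
      unfolding prod.case s split by (simp add: mult_ac cong: prod.cong)
  qed
  also have "\<dots> = minor M S * minor M T"
    unfolding minor_def sum_product sum.cartesian_product ..
  finally show ?thesis .
qed

lemma minor_Id: "finite S \<Longrightarrow> minor (\<lambda>i j. if i = j then 1 else 0) S = 1"
proof -
  assume fin: "finite S"
  have "minor (\<lambda>i j. if i = j then 1 else 0 :: 'b) S
     = (\<Sum>p\<in>{id}. of_int (sign p) * (\<Prod>i\<in>S. if i = p i then 1 else 0))"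
    unfolding minor_def
  proof (rule sum.mono_neutral_right)
    show "\<forall>p\<in>{p. p permutes S} - {id}. of_int (sign p) * (\<Prod>i\<in>S. if i = p i then 1 else 0 :: 'b) = 0"
    proof
      fix p assume p: "p \<in> {p. p permutes S} - {id}"
      then obtain i where "p i \<noteq> i" by (auto simp: fun_eq_iff)
      with p have "i \<in> S" using permutes_not_in by fastforce
      with \<open>p i \<noteq> i\<close> fin have "(\<Prod>i\<in>S. if i = p i then 1 else 0 :: 'b) = 0"
        by (intro prod_zero) (auto intro!: bexI[of _ i])
      then show "of_int (sign p) * (\<Prod>i\<in>S. if i = p i then 1 else 0 :: 'b) = 0" by simp
    qed
  qed (use fin in \<open>auto simp: finite_permutations permutes_id\<close>)
  then show ?thesis by (simp add: sign_id)
qed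

text \<open>Composing with the transposition of i and j reverses all signs and leaves the products
  unchanged, so the minor equals its own negative; the hypothesis on 2 lets one conclude.\<close>

lemma minor_rows_eq:
  fixes M :: "'i \<Rightarrow> 'i \<Rightarrow> 'a::idom"
  assumes "(2 :: 'a) \<noteq> 0" "finite S" "i \<in> S" "j \<in> S" "i \<noteq> j" "M i = M j"
  shows "minor M S = 0"
proof -
  let ?t = "Transposition.transpose i j"
  have t: "?t permutes S" using assms by (intro permutes_swap_id)
  have Mt: "M (?t k) = M k" for k using assms(6) by (auto simp: Transposition.transpose_def)
  have "minor M S = (\<Sum>p | p permutes S. of_int (sign (p \<circ> ?t)) * (\<Prod>k\<in>S. M k ((p \<circ> ?t) k)))"
    unfolding minor_def by (rule sum_permutations_compose_right[OF t])
  also have "\<dots> = (\<Sum>p | p permutes S. - (of_int (sign p) * (\<Prod>k\<in>S. M k (p k))))"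
  proof (rule sum.cong[OF refl])
    fix p assume "p \<in> {p. p permutes S}"
    then have p: "p permutes S" by simp
    have "sign (p \<circ> ?t) = - sign p"
      using sign_compose[OF permutes_imp_permutation[OF assms(2) p] permutes_imp_permutation[OF assms(2) t]] assms(5)
      by (simp add: sign_swap_id)
    moreover have "(\<Prod>k\<in>S. M k ((p \<circ> ?t) k)) = (\<Prod>k\<in>S. M k (p k))"
      by (rule prod.reindex_bij_witness[where i = ?t and j = ?t])
        (use t Mt in \<open>auto simp: permutes_in_image\<close>)
    ultimately show "of_int (sign (p \<circ> ?t)) * (\<Prod>k\<in>S. M k ((p \<circ> ?t) k)) = - (of_int (sign p) * (\<Prod>k\<in>S. M k (p k)))"
      by simp
  qed
  also have "\<dots> = - minor M S" by (simp add: minor_def sum_negf)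
  finally have "2 * minor M S = 0" by (simp add: eq_neg_iff_add_eq_0)
  then show ?thesis using assms(1) by simp
qed

lemma minor_permute_rows:
  assumes "finite S" "q permutes S"
  shows "minor (\<lambda>i. M (q i)) S = of_int (sign q) * minor M S"
proof -
  have "minor (\<lambda>i. M (q i)) S = (\<Sum>p | p permutes S. of_int (sign (p \<circ> q)) * (\<Prod>k\<in>S. M (q k) ((p \<circ> q) k)))"
    unfolding minor_def by (rule sum_permutations_compose_right[OF assms(2)])
  also have "\<dots> = (\<Sum>p | p permutes S. of_int (sign q) * (of_int (sign p) * (\<Prod>k\<in>S. M k (p k))))"
  proof (rule sum.cong[OF refl])
    fix p assume "p \<in> {p. p permutes S}"
    then have p: "p permutes S" by simp
    have "sign (p \<circ> q) = sign p * sign q"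
      using sign_compose[OF permutes_imp_permutation[OF assms(1) p] permutes_imp_permutation[OF assms]] .
    moreover have "(\<Prod>k\<in>S. M (q k) ((p \<circ> q) k)) = (\<Prod>k\<in>S. M k (p k))"
      by (rule prod.reindex_bij_witness[where i = "inv q" and j = q])
        (use assms(2) in \<open>auto simp: permutes_in_image permutes_inverses permutes_inv\<close>)
    ultimately show "of_int (sign (p \<circ> q)) * (\<Prod>k\<in>S. M (q k) ((p \<circ> q) k)) = of_int (sign q) * (of_int (sign p) * (\<Prod>k\<in>S. M k (p k)))"
      by (simp add: mult_ac)
  qed
  finally show ?thesis by (simp add: minor_def sum_distrib_left)
qed

text \<open>The product is expanded over all maps g of S into itself. A map that is not injective
  repeats a row of B and contributes 0; the injective ones are permutations, each contributing its
  sign times the minor of B.\<close>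

lemma minor_mult:
  fixes A B :: "'i \<Rightarrow> 'i \<Rightarrow> 'a::idom"
  assumes two: "(2 :: 'a) \<noteq> 0" and fin: "finite S"
  shows "minor (\<lambda>i j. \<Sum>k\<in>S. A i k * B k j) S = minor A S * minor B S"
proof -
  let ?W = "\<lambda>g. (\<Prod>i\<in>S. A i (g i)) * minor (\<lambda>i. B (g i)) S"
  have "minor (\<lambda>i j. \<Sum>k\<in>S. A i k * B k j) S
      = (\<Sum>p | p permutes S. \<Sum>g\<in>S \<rightarrow>\<^sub>E S. of_int (sign p) * ((\<Prod>i\<in>S. A i (g i)) * (\<Prod>i\<in>S. B (g i) (p i))))"
    unfolding minor_def prod_sum_PiE[OF fin fin] prod.distrib sum_distrib_left ..
  also have "\<dots> = (\<Sum>g\<in>S \<rightarrow>\<^sub>E S. ?W g)"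
    unfolding minor_def sum_distrib_left by (subst sum.swap) (simp add: mult_ac)
  also have "\<dots> = (\<Sum>g\<in>{g\<in>S \<rightarrow>\<^sub>E S. inj_on g S}. ?W g)"
  proof (rule sum.mono_neutral_right)
    show "\<forall>g\<in>(S \<rightarrow>\<^sub>E S) - {g\<in>S \<rightarrow>\<^sub>E S. inj_on g S}. ?W g = 0"
    proof
      fix g assume "g \<in> (S \<rightarrow>\<^sub>E S) - {g\<in>S \<rightarrow>\<^sub>E S. inj_on g S}"
      then obtain i j where "i \<in> S" "j \<in> S" "i \<noteq> j" "g i = g j" by (auto simp: inj_on_def)
      then have "minor (\<lambda>i. B (g i)) S = 0" using fin two by (intro minor_rows_eq[of S i j]) auto
      then show "?W g = 0" by simp
    qed
  qed (use fin in \<open>auto intro: finite_PiE\<close>)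
  also have "\<dots> = (\<Sum>q | q permutes S. (\<Prod>i\<in>S. A i (q i)) * (of_int (sign q) * minor B S))"
  proof (rule sum.reindex_bij_witness[where i = "\<lambda>q. restrict q S" and j = "\<lambda>g x. if x \<in> S then g x else x"], goal_cases)
    case (1 g)
    then show ?case by (auto simp: fun_eq_iff restrict_def PiE_def extensional_def)
  next
    case (2 g)
    then have "g ` S = S" using fin by (intro endo_inj_surj) auto
    then show ?case using 2 by (auto intro!: bij_imp_permutes simp: bij_betw_def inj_on_def)
  next
    case (3 q)
    then show ?case using permutes_not_in by (fastforce simp: fun_eq_iff)
  next
    case (4 q)
    then show ?case using permutes_inj_on permutes_in_image by (fastforce simp: inj_on_def)
  next
    case (5 g)
    let ?q = "\<lambda>x. if x \<in> S then g x else x"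
    have "g ` S = S" using 5 fin by (intro endo_inj_surj) auto
    then have q: "?q permutes S" using 5 by (auto intro!: bij_imp_permutes simp: bij_betw_def inj_on_def)
    have "minor (\<lambda>i. B (g i)) S = minor (\<lambda>i. B (?q i)) S" by (rule minor_cong) simp
    then show ?case using minor_permute_rows[OF fin q, of B] by (simp cong: prod.cong)
  qed
  also have "\<dots> = minor A S * minor B S"
    by (simp add: minor_def[of A] sum_distrib_left mult_ac)
  finally show ?thesis .
qed

text \<open>I collects the rows in which the summand with factor -x is chosen; in the remaining rows
  the identity matrix forces the permutation to fix the index, so it permutes I. This is the finite
  model of det (I - x A) as the alternating sum of traces of exterior powers.\<close>

lemma minor_Id_minus:
  fixes x :: "'a::comm_ring_1"
  assumes fin: "finite S"
  shows "minor (\<lambda>i j. (if i = j then 1 else 0) - x * G i j) S = (\<Sum>I\<in>Pow S. (- x) ^ card I * minor G I)"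
proof -
  let ?d = "\<lambda>i j. if i = j then 1 else 0 :: 'a"
  have "minor (\<lambda>i j. ?d i j - x * G i j) S
     = (\<Sum>p | p permutes S. of_int (sign p) * (\<Prod>i\<in>S. (- x) * G i (p i) + ?d i (p i)))"
    by (simp add: minor_def)
  also have "\<dots> = (\<Sum>I\<in>Pow S. \<Sum>p | p permutes S. of_int (sign p) *
       ((\<Prod>i\<in>I. (- x) * G i (p i)) * (\<Prod>i\<in>S - I. ?d i (p i))))"
    unfolding prod_add[OF fin] sum_distrib_left by (rule sum.swap)
  also have "\<dots> = (\<Sum>I\<in>Pow S. (- x) ^ card I * minor G I)"
  proof (rule sum.cong[OF refl])
    fix I assume "I \<in> Pow S"
    then have I: "I \<subseteq> S" "finite I" using fin finite_subset by auto
    have "(\<Sum>p | p permutes S. of_int (sign p) * ((\<Prod>i\<in>I. (- x) * G i (p i)) * (\<Prod>i\<in>S - I. ?d i (p i))))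
        = (\<Sum>p | p permutes I. of_int (sign p) * ((\<Prod>i\<in>I. (- x) * G i (p i)) * (\<Prod>i\<in>S - I. ?d i (p i))))"
    proof (rule sum.mono_neutral_right)
      show "\<forall>p\<in>{p. p permutes S} - {p. p permutes I}.
          of_int (sign p) * ((\<Prod>i\<in>I. (- x) * G i (p i)) * (\<Prod>i\<in>S - I. ?d i (p i))) = 0"
      proof
        fix p assume p: "p \<in> {p. p permutes S} - {p. p permutes I}"
        have "\<exists>i\<in>S - I. p i \<noteq> i"
          using p permutes_superset[of p S I] by blast
        then obtain i where "i \<in> S - I" "p i \<noteq> i" by blast
        then have "(\<Prod>i\<in>S - I. ?d i (p i)) = 0" using fin by (intro prod_zero bexI[of _ i]) auto
        then show "of_int (sign p) * ((\<Prod>i\<in>I. (- x) * G i (p i)) * (\<Prod>i\<in>S - I. ?d i (p i))) = 0" by simp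
      qed
    qed (use fin I in \<open>auto simp: finite_permutations intro: permutes_subset\<close>)
    also have "\<dots> = (\<Sum>p | p permutes I. of_int (sign p) * ((- x) ^ card I * (\<Prod>i\<in>I. G i (p i))))"
    proof (rule sum.cong[OF refl])
      fix p assume "p \<in> {p. p permutes I}"
      then have "(\<Prod>i\<in>S - I. ?d i (p i)) = 1" by (intro prod.neutral) (auto simp: permutes_not_in)
      then show "of_int (sign p) * ((\<Prod>i\<in>I. (- x) * G i (p i)) * (\<Prod>i\<in>S - I. ?d i (p i)))
         = of_int (sign p) * ((- x) ^ card I * (\<Prod>i\<in>I. G i (p i)))"
        by (simp only: prod.distrib prod_constant mult_1_right)
    qed
    also have "\<dots> = (- x) ^ card I * minor G I"
      by (simp add: minor_def sum_distrib_left mult_ac)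
    finally show "(\<Sum>p | p permutes S. of_int (sign p) * ((\<Prod>i\<in>I. (- x) * G i (p i)) * (\<Prod>i\<in>S - I. ?d i (p i))))
       = (- x) ^ card I * minor G I" .
  qed
  finally show ?thesis .
qed

lemma minor_scale: "finite I \<Longrightarrow> minor (\<lambda>i j. c * M i j) I = c ^ card I * minor M I"
  by (simp add: minor_def prod.distrib sum_distrib_left mult_ac)

text \<open>Principal minor at an n-tuple of indices, repetitions allowed. Tuples form a product
  set, over which sums of products factor; the n-element subsets do not.\<close>

definition tuple_det :: "nat \<Rightarrow> ('i \<Rightarrow> 'i \<Rightarrow> 'a::comm_ring_1) \<Rightarrow> (nat \<Rightarrow> 'i) \<Rightarrow> 'a" where
  "tuple_det n M t = minor (\<lambda>i j. M (t i) (t j)) {..<n}"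

text \<open>Tuples with a repetition contribute 0, and every n-element subset is the range of
  exactly n! injective tuples, all with the same determinant.\<close>

lemma minor_has_sum:
  fixes M :: "'i \<Rightarrow> 'i \<Rightarrow> complex"
  assumes "(tuple_det n M has_sum s) ({..<n} \<rightarrow>\<^sub>E L)"
  shows "(minor M has_sum (s / fact n)) {I. I \<subseteq> L \<and> finite I \<and> card I = n}"
proof -
  let ?I = "{I. I \<subseteq> L \<and> finite I \<and> card I = n}"
  define J where "J I = {t \<in> {..<n} \<rightarrow>\<^sub>E I. inj_on t {..<n}}" for I :: "'i set"
  have im: "t ` {..<n} = I" if "I \<in> ?I" "t \<in> J I" for t I
    using that card_image[of t "{..<n}"] by (intro card_subset_eq) (auto simp: J_def)
  have hs: "((\<lambda>t. tuple_det n M t) has_sum s) {t \<in> {..<n} \<rightarrow>\<^sub>E L. inj_on t {..<n}}"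
  proof (rule has_sum_cong_neutral[THEN iffD1, OF _ _ _ assms])
    fix t assume "t \<in> ({..<n} \<rightarrow>\<^sub>E L) - {t \<in> {..<n} \<rightarrow>\<^sub>E L. inj_on t {..<n}}"
    then obtain i j where "i < n" "j < n" "i \<noteq> j" "t i = t j" by (auto simp: inj_on_def)
    then show "tuple_det n M t = 0"
      unfolding tuple_det_def by (intro minor_rows_eq[of _ i j]) auto
  qed auto
  have bj: "bij_betw snd (Sigma ?I J) {t \<in> {..<n} \<rightarrow>\<^sub>E L. inj_on t {..<n}}"
  proof (rule bij_betw_byWitness[where f' = "\<lambda>t. (t ` {..<n}, t)"])
    show "\<forall>x\<in>Sigma ?I J. (snd x ` {..<n}, snd x) = x" using im by auto
    show "snd ` Sigma ?I J \<subseteq> {t \<in> {..<n} \<rightarrow>\<^sub>E L. inj_on t {..<n}}"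
      by (auto simp: J_def PiE_iff)
    show "(\<lambda>t. (t ` {..<n}, t)) ` {t \<in> {..<n} \<rightarrow>\<^sub>E L. inj_on t {..<n}} \<subseteq> Sigma ?I J"
      by (auto simp: J_def PiE_iff card_image)
  qed simp
  have "((\<lambda>z. tuple_det n M (snd z)) has_sum s) (Sigma ?I J)"
    by (rule has_sum_reindex_bij_betw[OF bj, THEN iffD2, OF hs])
  moreover have "((\<lambda>t. tuple_det n M (snd (I, t))) has_sum (fact n * minor M I)) (J I)" if I: "I \<in> ?I" for I
  proof -
    have fin: "finite (J I)" unfolding J_def 
      by (rule finite_subset[of _ "{..<n} \<rightarrow>\<^sub>E I"]) (use I in \<open>auto intro!: finite_PiE\<close>)
    have "card (J I) = fact n"
    proof -
      obtain h where h: "bij_betw h {..<n} I" using I ex_bij_betw_nat_finite[of I] by (auto simp: atLeast0LessThan)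
      \<comment> \<open>With one enumeration h of I fixed, the injective tuples in I are h composed
        with a permutation of the positions.\<close>
      have "bij_betw (\<lambda>p. restrict (h \<circ> p) {..<n}) {p. p permutes {..<n}} (J I)"
      proof (rule bij_betw_byWitness[where f' = "\<lambda>t x. if x < n then inv_into {..<n} h (t x) else x"])
        show "\<forall>p\<in>{p. p permutes {..<n}}. (\<lambda>x. if x < n then inv_into {..<n} h (restrict (h \<circ> p) {..<n} x) else x) = p"
        proof safe
          fix p :: "nat \<Rightarrow> nat" assume p: "p permutes {..<n}"
          show "(\<lambda>x. if x < n then inv_into {..<n} h (restrict (h \<circ> p) {..<n} x) else x) = p"
          proof
            fix x
            show "(if x < n then inv_into {..<n} h (restrict (h \<circ> p) {..<n} x) else x) = p x"
              using permutes_in_image[OF p, of x] permutes_not_in[OF p, of x] bij_betw_inv_into_left[OF h, of "p x"]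
              by auto
          qed
        qed
        show "\<forall>t\<in>J I. restrict (h \<circ> (\<lambda>x. if x < n then inv_into {..<n} h (t x) else x)) {..<n} = t"
          using bij_betw_inv_into_right[OF h] by (auto simp: J_def fun_eq_iff restrict_def PiE_iff extensional_def)
        show "(\<lambda>p. restrict (h \<circ> p) {..<n}) ` {p. p permutes {..<n}} \<subseteq> J I"
        proof safe
          fix p :: "nat \<Rightarrow> nat" assume p: "p permutes {..<n}"
          have hI: "\<And>x. x < n \<Longrightarrow> h x \<in> I" using h by (auto simp: bij_betw_def)
          have "inj_on (h \<circ> p) {..<n}"
            using h p by (intro comp_inj_on) (auto simp: bij_betw_def permutes_inj_on permutes_image)
          then show "restrict (h \<circ> p) {..<n} \<in> J I"
            using hI permutes_in_image[OF p] by (auto simp: J_def inj_on_def)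
        qed
        show "(\<lambda>t x. if x < n then inv_into {..<n} h (t x) else x) ` J I \<subseteq> {p. p permutes {..<n}}"
        proof safe
          fix t assume t: "t \<in> J I"
          have "inj_on (inv_into {..<n} h \<circ> t) {..<n}"
          proof (rule comp_inj_on)
            show "inj_on t {..<n}" using t by (simp add: J_def)
            show "inj_on (inv_into {..<n} h) (t ` {..<n})"
              unfolding im[OF I t] using bij_betw_inv_into[OF h] by (simp add: bij_betw_def)
          qed
          moreover have "(inv_into {..<n} h \<circ> t) ` {..<n} = {..<n}"
            unfolding image_comp[symmetric] im[OF I t] using bij_betw_inv_into[OF h] by (simp add: bij_betw_def)
          ultimately have "bij_betw (\<lambda>x. if x < n then inv_into {..<n} h (t x) else x) {..<n} {..<n}"
            by (simp add: bij_betw_def inj_on_def image_def)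
          then show "(\<lambda>x. if x < n then inv_into {..<n} h (t x) else x) permutes {..<n}"
            by (intro bij_imp_permutes) auto
        qed
      qed
      then have "card (J I) = card {p. p permutes {..<n}}" by (simp add: bij_betw_same_card)
      then show ?thesis using card_permutations[of "{..<n}" n] by simp
    qed
    moreover have "tuple_det n M (snd (I, t)) = minor M I" if "t \<in> J I" for t
      using minor_reindex[of t "{..<n}" M] im[OF I that] that by (simp add: tuple_det_def J_def)
    ultimately have "(\<Sum>t\<in>J I. tuple_det n M (snd (I, t))) = fact n * minor M I" by simp
    then show ?thesis using fin by (metis has_sum_finite)
  qed
  ultimately have "((\<lambda>I. fact n * minor M I) has_sum s) ?I"
    by (rule has_sum_SigmaD)
  from has_sum_divide_const[OF this, of "fact n"] show ?thesis by simp
qed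

section \<open>Nuclear representations\<close>

text \<open>The series for A f is only tested against g, which suits operators acting on
  representatives. The index type is free, so that finitely many terms can be adjoined through a sum
  type.\<close>

definition nuclear_rep ::
  "ereal \<Rightarrow> ereal \<Rightarrow> ((real \<Rightarrow> complex^'m) \<Rightarrow> (real \<Rightarrow> complex^'m)) \<Rightarrow>
     ('k \<Rightarrow> real \<Rightarrow> complex^'m) \<Rightarrow> ('k \<Rightarrow> real \<Rightarrow> complex^'m) \<Rightarrow> bool" where
  "nuclear_rep a b A w z \<longleftrightarrow>
     (\<forall>k. w k \<in> L2 a b \<and> z k \<in> L2 a b) \<and>
     (\<lambda>k. norm_L2 a b (w k) * norm_L2 a b (z k)) summable_on UNIV \<and>
     (\<forall>f\<in>L2 a b. A f \<in> L2 a b \<and>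
        (\<forall>g\<in>L2 a b. ((\<lambda>k. inner_L2 a b (w k) f * inner_L2 a b g (z k)) has_sum inner_L2 a b g (A f)) UNIV))"

text \<open>The form S may be degenerate: a remainder u with S u u = 0 gets the factor 1 / sqrt 0 =
  0, so the corresponding vector is the zero function and drops out of all later sums.\<close>

fun gram_schmidt ::
  "((real \<Rightarrow> complex^'m) \<Rightarrow> (real \<Rightarrow> complex^'m) \<Rightarrow> complex) \<Rightarrow> (nat \<Rightarrow> real \<Rightarrow> complex^'m) \<Rightarrow>
     nat \<Rightarrow> real \<Rightarrow> complex^'m" where
  "gram_schmidt S e k =
     (let u = (\<lambda>x. e k x - (\<Sum>j<k. S (gram_schmidt S e j) (e k) *s gram_schmidt S e j x))
      in (\<lambda>x. complex_of_real (1 / sqrt (Re (S u u))) *s u x))"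

declare gram_schmidt.simps [simp del]

text \<open>Semidefinite only, since the form of the absolute value of an operator is degenerate as
  soon as the operator has a kernel.\<close>

locale positive_form =
  fixes a b :: ereal and S :: "(real \<Rightarrow> complex^'m) \<Rightarrow> (real \<Rightarrow> complex^'m) \<Rightarrow> complex"
  assumes S_add: "f \<in> L2 a b \<Longrightarrow> g \<in> L2 a b \<Longrightarrow> h \<in> L2 a b \<Longrightarrow> S f (\<lambda>x. g x + h x) = S f g + S f h"
    and S_smult: "f \<in> L2 a b \<Longrightarrow> g \<in> L2 a b \<Longrightarrow> S f (\<lambda>x. c *s g x) = c * S f g"
    and S_herm: "f \<in> L2 a b \<Longrightarrow> g \<in> L2 a b \<Longrightarrow> S f g = cnj (S g f)"
    and S_pos: "f \<in> L2 a b \<Longrightarrow> 0 \<le> Re (S f f)"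
begin

lemma S_zero [simp]: "f \<in> L2 a b \<Longrightarrow> S f (\<lambda>x. 0) = 0"
  using S_smult[of f "\<lambda>x. 0" 0] by simp

lemma S_zero_left [simp]: "f \<in> L2 a b \<Longrightarrow> S (\<lambda>x. 0) f = 0"
  using S_herm[of "\<lambda>x. 0" f] by simp

lemma S_diff: "f \<in> L2 a b \<Longrightarrow> g \<in> L2 a b \<Longrightarrow> h \<in> L2 a b \<Longrightarrow> S f (\<lambda>x. g x - h x) = S f g - S f h"
  using S_add[of f g "\<lambda>x. (-1) *s h x"] S_smult[of f h "-1"] L2_smult[of h a b "-1"] by simp

lemma S_diff_left: "f \<in> L2 a b \<Longrightarrow> g \<in> L2 a b \<Longrightarrow> h \<in> L2 a b \<Longrightarrow> S (\<lambda>x. g x - h x) f = S g f - S h f"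
  using arg_cong[OF S_diff[of f g h], of cnj] by (simp add: L2_diff flip: S_herm)

lemma S_smult_left: "f \<in> L2 a b \<Longrightarrow> g \<in> L2 a b \<Longrightarrow> S (\<lambda>x. c *s g x) f = cnj c * S g f"
  using arg_cong[OF S_smult[of f g c], of cnj] by (simp add: L2_smult flip: S_herm)

lemma S_sum: "f \<in> L2 a b \<Longrightarrow> (\<And>k. k \<in> F \<Longrightarrow> g k \<in> L2 a b) \<Longrightarrow> S f (\<lambda>x. \<Sum>k\<in>F. g k x) = (\<Sum>k\<in>F. S f (g k))"
  by (induction F rule: infinite_finite_induct) (auto simp: S_add L2_sum)

lemma S_sum_left: "f \<in> L2 a b \<Longrightarrow> (\<And>k. k \<in> F \<Longrightarrow> g k \<in> L2 a b) \<Longrightarrow> S (\<lambda>x. \<Sum>k\<in>F. g k x) f = (\<Sum>k\<in>F. S (g k) f)"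
  using arg_cong[where f = cnj, OF S_sum[of f F g]] by (simp add: L2_sum flip: S_herm)

lemma S_self_real: "f \<in> L2 a b \<Longrightarrow> S f f = of_real (Re (S f f))"
  using S_herm[of f f] by (metis Reals_cnj_iff of_real_Re)

context
  fixes e :: "nat \<Rightarrow> real \<Rightarrow> complex^'m"
  assumes e: "\<And>k. e k \<in> L2 a b"
begin

abbreviation "y \<equiv> gram_schmidt S e"
abbreviation "u k \<equiv> (\<lambda>x. e k x - (\<Sum>j<k. S (y j) (e k) *s y j x))"

lemma y_eq: "y k = (\<lambda>x. complex_of_real (1 / sqrt (Re (S (u k) (u k)))) *s u k x)"
  by (subst gram_schmidt.simps) (simp add: Let_def)

lemma y_L2: "y k \<in> L2 a b"
proof (induction k rule: less_induct)
  case (less k)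
  then show ?case by (subst y_eq) (intro L2_smult L2_diff L2_sum e, auto)
qed

lemma u_L2: "u k \<in> L2 a b"
  by (intro L2_smult L2_diff L2_sum e y_L2)

lemma y_normal: "y k = (\<lambda>x. 0) \<or> S (y k) (y k) = 1"
proof (cases "Re (S (u k) (u k)) = 0")
  case True
  then show ?thesis by (subst y_eq) simp
next
  case False
  define N where "N = Re (S (u k) (u k))"
  have N: "N > 0" using False S_pos[OF u_L2[of k]] by (simp add: N_def)
  define U where "U = u k"
  have U: "U \<in> L2 a b" unfolding U_def by (rule u_L2)
  have "S U U = of_real N" using S_self_real[OF U] by (simp add: N_def U_def)
  moreover have "y k = (\<lambda>x. complex_of_real (1 / sqrt N) *s U x)"
    by (subst y_eq) (simp only: N_def U_def)
  ultimately have "S (y k) (y k) = of_real (1 / sqrt N) * (of_real (1 / sqrt N) * of_real N)"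
    by (simp only: S_smult[OF L2_smult[OF U] U] S_smult_left[OF U U] complex_cnj_complex_of_real)
  also have "\<dots> = of_real ((1 / sqrt N) * ((1 / sqrt N) * N))" by (simp only: of_real_mult)
  also have "(1 / sqrt N) * ((1 / sqrt N) * N) = 1" using N by (simp add: field_simps)
  finally show ?thesis by simp
qed

lemma S_y_u:
  assumes "\<And>i j. i < j \<Longrightarrow> j < k \<Longrightarrow> S (y i) (y j) = 0" "j < k"
  shows "S (y j) (u k) = 0"
proof -
  have "S (y j) (u k) = S (y j) (e k) - (\<Sum>i<k. S (y i) (e k) * S (y j) (y i))"
    by (subst S_diff) (auto intro!: L2_sum L2_smult y_L2 e simp: S_sum S_smult y_L2 L2_smult)
  also have "(\<Sum>i<k. S (y i) (e k) * S (y j) (y i)) = (\<Sum>i<k. if i = j then S (y j) (e k) * S (y j) (y j) else 0)"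
  proof (intro sum.cong refl)
    fix i assume i: "i \<in> {..<k}"
    show "S (y i) (e k) * S (y j) (y i) = (if i = j then S (y j) (e k) * S (y j) (y j) else 0)"
      using assms(1)[of i j] assms(1)[of j i] assms(2) i S_herm[OF y_L2[of j] y_L2[of i]]
      by (cases i j rule: linorder_cases) auto
  qed
  also have "\<dots> = S (y j) (e k) * S (y j) (y j)" using assms(2) by simp
  also have "S (y j) (e k) - S (y j) (e k) * S (y j) (y j) = 0"
    using y_normal[of j] by (auto simp: e)
  finally show ?thesis .
qed

lemma y_orth_less: "i < k \<Longrightarrow> S (y i) (y k) = 0"
proof (induction k arbitrary: i rule: less_induct)
  case (less k)
  have "S (y i) (u k) = 0" by (rule S_y_u) (use less in auto)
  then show ?case by (subst y_eq[of k]) (simp only: S_smult[OF y_L2 u_L2] mult_zero_right)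
qed

lemma y_orth: "i \<noteq> k \<Longrightarrow> S (y i) (y k) = 0"
  using y_orth_less[of i k] y_orth_less[of k i] S_herm[OF y_L2[of i] y_L2[of k]]
  by (cases i k rule: linorder_cases) auto

text \<open>Pythagoras for S. Zero members of the family contribute nothing, so positivity of S
  yields Bessel's inequality although the family need not be normalised throughout.\<close>

lemma y_form_Bessel:
  assumes f: "f \<in> L2 a b" and F: "finite F"
  shows "S (\<lambda>x. f x - (\<Sum>j\<in>F. S (y j) f *s y j x)) (\<lambda>x. f x - (\<Sum>j\<in>F. S (y j) f *s y j x))
    = of_real (Re (S f f) - (\<Sum>j\<in>F. (cmod (S (y j) f))\<^sup>2))"
proof -
  let ?p = "\<lambda>x. \<Sum>j\<in>F. S (y j) f *s y j x"
  let ?c = "\<Sum>j\<in>F. complex_of_real ((cmod (S (y j) f))\<^sup>2)"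
  have p: "?p \<in> L2 a b" by (intro L2_sum L2_smult y_L2)
  have yp: "S (y i) ?p = S (y i) f" if "i \<in> F" for i
  proof -
    have "S (y i) ?p = (\<Sum>j\<in>F. S (y j) f * S (y i) (y j))"
      by (simp add: S_sum S_smult L2_smult y_L2)
    also have "\<dots> = (\<Sum>j\<in>F. if j = i then S (y i) f * S (y i) (y i) else 0)"
      by (intro sum.cong refl) (auto simp: y_orth)
    also have "\<dots> = S (y i) f" using F that y_normal[of i] f by auto
    finally show ?thesis .
  qed
  have ps: "S ?p h = (\<Sum>j\<in>F. cnj (S (y j) f) * S (y j) h)" if "h \<in> L2 a b" for h
    using that by (simp add: S_sum_left S_smult_left L2_smult y_L2)
  have c: "S ?p f = ?c"
    unfolding ps[OF f] by (intro sum.cong refl) (simp add: complex_norm_square mult.commute del: of_real_power)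
  have pp: "S ?p ?p = ?c"
    unfolding ps[OF p] using yp
    by (intro sum.cong refl) (simp add: complex_norm_square mult.commute del: of_real_power)
  have "S f ?p = cnj ?c" using S_herm[OF f p] c by simp
  then have "S f ?p = ?c" by simp
  then show ?thesis
    using c pp S_self_real[OF f] f p by (simp add: S_diff S_diff_left L2_diff)
qed

lemma y_Bessel: "f \<in> L2 a b \<Longrightarrow> finite F \<Longrightarrow> (\<Sum>j\<in>F. (cmod (S (y j) f))\<^sup>2) \<le> Re (S f f)"
  using y_form_Bessel[of f F] S_pos[of "\<lambda>x. f x - (\<Sum>j\<in>F. S (y j) f *s y j x)"]
  by (simp add: L2_diff L2_sum L2_smult y_L2)

text \<open>Up to a null vector of S, \<open>e k\<close> is exhausted by \<open>y 0\<close>, ...,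
  \<open>y k\<close>: if N is the form of the remainder \<open>u k\<close>, the last coefficient has
  modulus sqrt N, also when N = 0.\<close>

lemma remainder_zero:
  "S (\<lambda>x. e k x - (\<Sum>j\<le>k. S (y j) (e k) *s y j x)) (\<lambda>x. e k x - (\<Sum>j\<le>k. S (y j) (e k) *s y j x)) = 0"
proof -
  let ?r = "\<lambda>x. e k x - (\<Sum>j\<le>k. S (y j) (e k) *s y j x)"
  define N where "N = Re (S (u k) (u k))"
  have N: "N \<ge> 0" "S (u k) (u k) = of_real N" using S_pos[OF u_L2[of k]] S_self_real[OF u_L2[of k]] by (simp_all add: N_def)
  have "(\<Sum>j<k. (cmod (S (y j) (e k)))\<^sup>2) + N = Re (S (e k) (e k))"
    using y_form_Bessel[OF e, of "{..<k}" k] by (simp add: N_def)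
  moreover have "(cmod (S (y k) (e k)))\<^sup>2 = N"
  proof -
    have "S (y k) (u k) = S (y k) (e k) - (\<Sum>j<k. S (y j) (e k) * S (y k) (y j))"
      by (subst S_diff) (auto intro!: L2_sum L2_smult y_L2 e simp: S_sum S_smult y_L2 L2_smult)
    also have "(\<Sum>j<k. S (y j) (e k) * S (y k) (y j)) = 0"
      by (intro sum.neutral) (auto simp: y_orth)
    finally have "S (y k) (e k) = S (y k) (u k)" by simp
    also have "\<dots> = of_real (1 / sqrt N) * of_real N"
      by (simp only: y_eq[of k] S_smult_left[OF u_L2 u_L2] complex_cnj_complex_of_real N(2) Re_complex_of_real)
    also have "\<dots> = of_real (1 / sqrt N * N)" by (simp only: of_real_mult)
    also have "1 / sqrt N * N = sqrt N" using N by (simp add: real_div_sqrt)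
    finally show ?thesis using N by (simp add: norm_of_real)
  qed
  ultimately have "(\<Sum>j\<le>k. (cmod (S (y j) (e k)))\<^sup>2) = Re (S (e k) (e k))"
    by (simp flip: lessThan_Suc_atMost)
  then show ?thesis using y_form_Bessel[OF e, of "{..k}" k] by simp
qed

end

end

section \<open>Linearity of bounded operators, tested against scalar products\<close>

lemma bounded_op_inner_add:
  assumes "bounded_op a b A" "f \<in> L2 a b" "g \<in> L2 a b" "h \<in> L2 a b"
  shows "inner_L2 a b f (A (\<lambda>x. g x + h x)) = inner_L2 a b f (A g) + inner_L2 a b f (A h)"
proof -
  have "inner_L2 a b f (A (\<lambda>x. g x + h x)) = inner_L2 a b f (\<lambda>x. A g x + A h x)"
    by (rule inner_L2_cong) (use assms in \<open>auto simp: bounded_op_def intro!: L2_add\<close>)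
  then show ?thesis using assms by (simp add: inner_L2_add_right bounded_op_def)
qed

lemma bounded_op_inner_smult:
  assumes "bounded_op a b A" "f \<in> L2 a b" "g \<in> L2 a b"
  shows "inner_L2 a b f (A (\<lambda>x. c *s g x)) = c * inner_L2 a b f (A g)"
proof -
  have "inner_L2 a b f (A (\<lambda>x. c *s g x)) = inner_L2 a b f (\<lambda>x. c *s A g x)"
    by (rule inner_L2_cong) (use assms in \<open>auto simp: bounded_op_def intro!: L2_smult\<close>)
  then show ?thesis by (simp add: inner_L2_smult_right)
qed

lemma bounded_op_inner_zero:
  assumes "bounded_op a b A" "f \<in> L2 a b"
  shows "inner_L2 a b f (A (\<lambda>x. 0)) = 0"
  using bounded_op_inner_smult[OF assms L2_zero, of 0] by simp

lemma bounded_op_inner_diff: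
  assumes "bounded_op a b A" "f \<in> L2 a b" "g \<in> L2 a b" "h \<in> L2 a b"
  shows "inner_L2 a b f (A (\<lambda>x. g x - h x)) = inner_L2 a b f (A g) - inner_L2 a b f (A h)"
  using bounded_op_inner_add[OF assms(1-3) L2_smult[OF assms(4), of "-1"]]
    bounded_op_inner_smult[OF assms(1,2,4), of "-1"] by simp

lemma bounded_op_inner_sum:
  assumes "bounded_op a b A" "f \<in> L2 a b" "\<And>k. k \<in> F \<Longrightarrow> g k \<in> L2 a b"
  shows "inner_L2 a b f (A (\<lambda>x. \<Sum>k\<in>F. c k *s g k x)) = (\<Sum>k\<in>F. c k * inner_L2 a b f (A (g k)))"
  using assms(3)
  by (induction F rule: infinite_finite_induct)
    (simp_all add: bounded_op_inner_zero[OF assms(1,2)] bounded_op_inner_add[OF assms(1,2)]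
      bounded_op_inner_smult[OF assms(1,2)] L2_sum L2_smult)

text \<open>Boundedness turns norm convergence of the basis expansion of f into weak convergence of
  its image.\<close>

lemma bounded_op_expand:
  assumes A: "bounded_op a b A" and onb: "onb_L2 a b B" and f: "f \<in> L2 a b" and g: "g \<in> L2 a b"
  shows "((\<lambda>e. inner_L2 a b e f * inner_L2 a b g (A e)) has_sum inner_L2 a b g (A f)) B"
proof -
  note on = onb_orthonormal[OF onb]
  obtain C where C: "\<And>h. h \<in> L2 a b \<Longrightarrow> norm_L2 a b (A h) \<le> C * norm_L2 a b h"
    using A unfolding bounded_op_def by blast
  have AL2: "h \<in> L2 a b \<Longrightarrow> A h \<in> L2 a b" for h using A by (auto simp: bounded_op_def)
  have "((\<lambda>F. (norm_L2 a b f)\<^sup>2 - (\<Sum>e\<in>F. (cmod (inner_L2 a b e f))\<^sup>2)) \<longlongrightarrow> (norm_L2 a b f)\<^sup>2 - (norm_L2 a b f)\<^sup>2)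
      (finite_subsets_at_top B)"
    using Parseval_norm[OF onb f] unfolding has_sum_def by (intro tendsto_diff tendsto_const)
  note lim = tendsto_mult[OF tendsto_const[of "norm_L2 a b g * C"] tendsto_real_sqrt[OF this]]
  show ?thesis
    unfolding has_sum_def
  proof (rule Lim_null[THEN iffD2], rule tendsto_0_le[where K = 1])
  show "((\<lambda>F. norm_L2 a b g * C * sqrt ((norm_L2 a b f)\<^sup>2 - (\<Sum>e\<in>F. (cmod (inner_L2 a b e f))\<^sup>2))) \<longlongrightarrow> 0)
      (finite_subsets_at_top B)" using lim by simp
  show "\<forall>\<^sub>F F in finite_subsets_at_top B.
      norm ((\<Sum>e\<in>F. inner_L2 a b e f * inner_L2 a b g (A e)) - inner_L2 a b g (A f))
      \<le> norm (norm_L2 a b g * C * sqrt ((norm_L2 a b f)\<^sup>2 - (\<Sum>e\<in>F. (cmod (inner_L2 a b e f))\<^sup>2))) * 1"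
  proof (rule eventually_finite_subsets_at_top_weakI)
    fix F assume F: "finite F" "F \<subseteq> B"
    let ?p = "proj_L2 a b F f"
    let ?r = "\<lambda>x. f x - ?p x"
    have p: "?p \<in> L2 a b" by (rule proj_L2_L2[OF on F(2)])
    have r: "?r \<in> L2 a b" by (rule L2_diff[OF f p])
    have "inner_L2 a b g (A ?p) = (\<Sum>e\<in>F. inner_L2 a b e f * inner_L2 a b g (A e))"
      unfolding proj_L2_def
      by (rule bounded_op_inner_sum[OF A g]) (use on F in \<open>auto simp: orthonormal_L2_def\<close>)
    then have "(\<Sum>e\<in>F. inner_L2 a b e f * inner_L2 a b g (A e)) - inner_L2 a b g (A f) = - inner_L2 a b g (A ?r)"
      by (simp add: bounded_op_inner_diff[OF A g f p])
    then have "cmod ((\<Sum>e\<in>F. inner_L2 a b e f * inner_L2 a b g (A e)) - inner_L2 a b g (A f))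
        \<le> norm_L2 a b g * norm_L2 a b (A ?r)"
      using inner_L2_Cauchy_Schwarz[OF g AL2[OF r]] by simp
    also have "\<dots> \<le> norm_L2 a b g * (C * norm_L2 a b ?r)"
      by (intro mult_left_mono C r) simp
    also have "norm_L2 a b ?r = sqrt ((norm_L2 a b f)\<^sup>2 - (\<Sum>e\<in>F. (cmod (inner_L2 a b e f))\<^sup>2))"
      using norm_L2_diff_proj[OF on F f] by (metis norm_L2_nonneg real_sqrt_unique)
    finally show "norm ((\<Sum>e\<in>F. inner_L2 a b e f * inner_L2 a b g (A e)) - inner_L2 a b g (A f))
      \<le> norm (norm_L2 a b g * C * sqrt ((norm_L2 a b f)\<^sup>2 - (\<Sum>e\<in>F. (cmod (inner_L2 a b e f))\<^sup>2))) * 1"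
      by (simp add: mult.assoc)
  qed
  qed
qed

text \<open>
  No square root of \<open>\<bar>A\<bar>\<close> is needed: Gram-Schmidt with respect to the form \<open>\<langle>\<cdot>, \<bar>A\<bar> \<cdot>\<rangle>\<close> turns the
  orthonormal basis into vectors \<open>y\<^sub>k\<close> with \<open>\<bar>A\<bar> = \<Sum>\<^sub>k \<langle>\<bar>A\<bar> y\<^sub>k, \<cdot>\<rangle> \<bar>A\<bar> y\<^sub>k\<close> (a Cholesky factorization), and
  \<open>A = \<Sum>\<^sub>k \<langle>\<bar>A\<bar> y\<^sub>k, \<cdot>\<rangle> A y\<^sub>k\<close> since \<open>A\<close> and \<open>\<bar>A\<bar>\<close> produce the same norms.
\<close>

theorem trace_class_nuclear_rep:
  assumes tc: "trace_class a b A"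
  shows "\<exists>w z :: nat \<Rightarrow> real \<Rightarrow> complex^'m. nuclear_rep a b A w z"
proof -
  obtain P B where A: "bounded_op a b A" and PA: "is_abs_op a b A P" and onb: "onb_L2 a b B"
    and trs: "(\<lambda>e. Re (inner_L2 a b e (P e))) summable_on B"
    using tc by (auto simp: trace_class_def)
  note on = onb_orthonormal[OF onb]
  have P: "bounded_op a b P" using PA by (simp add: is_abs_op_def)
  have PL2: "f \<in> L2 a b \<Longrightarrow> P f \<in> L2 a b" for f using P by (auto simp: bounded_op_def)
  have AL2: "f \<in> L2 a b \<Longrightarrow> A f \<in> L2 a b" for f using A by (auto simp: bounded_op_def)
  have BL2: "e \<in> B \<Longrightarrow> e \<in> L2 a b" for e using onb by (auto simp: onb_L2_def)
  have ImP: "Im (inner_L2 a b f (P f)) = 0" and ReP: "0 \<le> Re (inner_L2 a b f (P f))" if "f \<in> L2 a b" for f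
    using PA that by (auto simp: is_abs_op_def)
  define S where "S f g = inner_L2 a b f (P g)" for f g
  have S_add: "S f (\<lambda>x. g x + h x) = S f g + S f h" if "f \<in> L2 a b" "g \<in> L2 a b" "h \<in> L2 a b" for f g h
    unfolding S_def by (rule bounded_op_inner_add[OF P that])
  have S_smult: "S f (\<lambda>x. c *s g x) = c * S f g" if "f \<in> L2 a b" "g \<in> L2 a b" for f g c
    unfolding S_def by (rule bounded_op_inner_smult[OF P that])
  \<comment> \<open>Symmetry follows from the real diagonal by polarisation, with c = 1 and c the
    imaginary unit.\<close>
  have S_herm: "S f g = cnj (S g f)" if f: "f \<in> L2 a b" and g: "g \<in> L2 a b" for f g
  proof -
    have exp: "S (\<lambda>x. f x + c *s g x) (\<lambda>x. f x + c *s g x) = S f f + c * S f g + cnj c * S g f + cnj c * c * S g g" for c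
    proof -
      have cg: "(\<lambda>x. c *s g x) \<in> L2 a b" by (rule L2_smult[OF g])
      have "S (\<lambda>x. f x + c *s g x) h = S f h + cnj c * S g h" if "h \<in> L2 a b" for h
        unfolding S_def using inner_L2_add_left[OF PL2[OF that] f cg] by (simp add: inner_L2_smult_left)
      then show ?thesis using f g cg by (simp add: S_add S_smult L2_add algebra_simps)
    qed
    have Im0: "Im (S h h) = 0" if "h \<in> L2 a b" for h using ImP[OF that] by (simp add: S_def)
    have "Im (S f g + S g f) = 0"
      using exp[of 1] Im0[OF L2_add[OF f L2_smult[OF g, of 1]]] Im0[OF f] Im0[OF g] by simp
    moreover have "Re (S f g) - Re (S g f) = 0"
      using arg_cong[OF exp[of \<i>], of Im] Im0[OF L2_add[OF f L2_smult[OF g, of \<i>]]] Im0[OF f] Im0[OF g] by simp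
    ultimately show ?thesis by (simp add: complex_eq_iff)
  qed
  interpret positive_form a b S
  proof
    show "0 \<le> Re (S f f)" if "f \<in> L2 a b" for f using ReP[OF that] by (simp add: S_def)
  qed (fact S_add S_smult S_herm)+
  have normA: "norm_L2 a b (A f) = norm_L2 a b (P f)" if f: "f \<in> L2 a b" for f
  proof -
    have "inner_L2 a b (A f) (A f) = inner_L2 a b f (P (P f))"
      using PA f by (auto simp: is_abs_op_def)
    also have "\<dots> = cnj (inner_L2 a b (P f) (P f))" using S_herm[OF f PL2[OF f]] by (simp add: S_def)
    also have "\<dots> = inner_L2 a b (P f) (P f)" by (metis inner_L2_commute)
    finally have "(norm_L2 a b (A f))\<^sup>2 = (norm_L2 a b (P f))\<^sup>2" by (simp only: inner_L2_self of_real_eq_iff)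
    then show ?thesis by simp
  qed
  \<comment> \<open>A null vector of the form is annihilated by P: otherwise moving f by -t times P
    f would make the form negative for small t > 0.\<close>
  have P0: "norm_L2 a b (P f) = 0" if f: "f \<in> L2 a b" and 0: "S f f = 0" for f
  proof (rule ccontr)
    assume "norm_L2 a b (P f) \<noteq> 0"
    then have q: "(norm_L2 a b (P f))\<^sup>2 > 0" by simp
    define q where "q = (norm_L2 a b (P f))\<^sup>2"
    define c where "c = Re (S (P f) (P f))"
    have c: "c \<ge> 0" using S_pos[OF PL2[OF f]] by (simp add: c_def)
    \<comment> \<open>The summand 1 keeps the denominator positive when c = 0. With this t one has t
      c \<le> q, against the 2 q \<le> t c forced by positivity.\<close>
    define t where "t = q / (c + 1)"
    have t: "t > 0" using q c by (simp add: t_def q_def)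
    have "S (P f) f = of_real q" by (simp add: S_def inner_L2_self q_def)
    moreover from this have "S f (P f) = of_real q" using S_herm[OF f PL2[OF f]] by simp
    ultimately have "Re (S (\<lambda>x. f x - of_real t *s P f x) (\<lambda>x. f x - of_real t *s P f x)) = - 2 * t * q + t * t * c"
      using 0 f PL2[OF f]
      by (simp add: S_diff S_diff_left S_smult S_smult_left L2_diff L2_smult c_def algebra_simps)
    then have "0 \<le> - 2 * t * q + t * t * c"
      using S_pos[OF L2_diff[OF f L2_smult[OF PL2[OF f], of "of_real t"]]] by simp
    then have "0 \<le> t * (t * c - 2 * q)" by (simp add: algebra_simps)
    then have "2 * q \<le> t * c" using t by (simp add: zero_le_mult_iff)
    also have "t * c \<le> q" using c q by (simp add: t_def field_simps q_def)
    finally show False using q by (simp add: q_def)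
  qed
  have S0: "S f g = 0" if "f \<in> L2 a b" "g \<in> L2 a b" "norm_L2 a b (P g) = 0" for f g
    using inner_L2_Cauchy_Schwarz[OF that(1) PL2[OF that(2)]] that(3) by (simp add: S_def)
  have A0: "inner_L2 a b f (A g) = 0" if "f \<in> L2 a b" "g \<in> L2 a b" "norm_L2 a b (P g) = 0" for f g
    using inner_L2_Cauchy_Schwarz[OF that(1) AL2[OF that(2)]] that(3) normA[OF that(2)] by simp
  \<comment> \<open>Only countably many terms of a summable family are nonzero. The zero function is
    inserted so that the set is nonempty and \<open>from_nat_into\<close> enumerates it; repetitions
    are harmless, as Gram-Schmidt sends a repeated vector to 0.\<close>
  define B' where "B' = insert (\<lambda>x. 0) {e\<in>B. Re (inner_L2 a b e (P e)) \<noteq> 0}"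
  have "countable B'" using summable_countable_real[OF trs] by (simp add: B'_def)
  then have B': "range (from_nat_into B') = B'" by (intro range_from_nat_into) (auto simp: B'_def)
  define e where "e = from_nat_into B'"
  have eL2: "e k \<in> L2 a b" for k
  proof -
    have "e k \<in> B'" using B' by (auto simp: e_def)
    then show ?thesis using BL2 by (auto simp: B'_def)
  qed
  define y where "y = gram_schmidt S e"
  define w where "w k = P (y k)" for k
  define z where "z k = A (y k)" for k
  have yL2: "y k \<in> L2 a b" for k unfolding y_def by (rule y_L2[OF eL2])
  have wL2: "w k \<in> L2 a b" and zL2: "z k \<in> L2 a b" for k using yL2 PL2 AL2 by (auto simp: w_def z_def)
  have wS: "inner_L2 a b (w k) f = S (y k) f" if "f \<in> L2 a b" for f k
    using S_herm[OF yL2[of k] that] inner_L2_commute[of a b "w k" f] by (simp add: S_def w_def)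
  have norm_z: "norm_L2 a b (z k) = norm_L2 a b (w k)" for k
    using normA[OF yL2] by (simp add: w_def z_def)
  define \<tau> where "\<tau> = infsum (\<lambda>e. Re (inner_L2 a b e (P e))) B"
  \<comment> \<open>Parseval for each \<open>w k\<close>, then Bessel for S at each basis vector:
    the squared norms of the \<open>w k\<close> sum to at most the trace of P.\<close>
  have ws: "(\<Sum>k\<in>F. (norm_L2 a b (w k))\<^sup>2) \<le> \<tau>" if F: "finite F" for F
  proof (rule has_sum_mono)
    have "((\<lambda>e. \<Sum>k\<in>F. (cmod (inner_L2 a b e (w k)))\<^sup>2) has_sum (\<Sum>k\<in>F. (norm_L2 a b (w k))\<^sup>2)) B"
      using F by (induction F) (auto intro!: has_sum_add Parseval_norm[OF onb wL2])
    then show "((\<lambda>e. \<Sum>k\<in>F. (cmod (S (y k) e))\<^sup>2) has_sum (\<Sum>k\<in>F. (norm_L2 a b (w k))\<^sup>2)) B"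
    proof (rule has_sum_cong[THEN iffD1, rotated])
      fix e assume "e \<in> B"
      then have "cmod (inner_L2 a b e (w k)) = cmod (S (y k) e)" for k
        using wS[OF BL2, of e k] by (metis complex_mod_cnj inner_L2_commute)
      then show "(\<Sum>k\<in>F. (cmod (inner_L2 a b e (w k)))\<^sup>2) = (\<Sum>k\<in>F. (cmod (S (y k) e))\<^sup>2)" by simp
    qed
    show "((\<lambda>e. Re (inner_L2 a b e (P e))) has_sum \<tau>) B" using trs by (simp add: \<tau>_def)
    show "(\<Sum>k\<in>F. (cmod (S (y k) x))\<^sup>2) \<le> Re (inner_L2 a b x (P x))" if "x \<in> B" for x
      using y_Bessel[OF eL2 BL2[OF that] F] by (simp add: y_def S_def)
  qed
  have wsum: "(\<lambda>k. (norm_L2 a b (w k))\<^sup>2) summable_on UNIV"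
    by (rule nonneg_bdd_above_summable_on) (use ws in \<open>auto intro!: bdd_aboveI2\<close>)
  \<comment> \<open>On a basis vector the series is a finite sum: by \<open>remainder_zero\<close>
    the vector is a combination of \<open>y 0\<close>, ..., \<open>y k\<close> up to a vector
    annihilated by P, hence by A. Vectors outside the enumeration are annihilated
    altogether.\<close>
  have basis: "((\<lambda>k. inner_L2 a b (w k) v * inner_L2 a b g (z k)) has_sum inner_L2 a b g (A v)) UNIV"
    if v: "v \<in> B" and g: "g \<in> L2 a b" for v g
  proof (cases "Re (inner_L2 a b v (P v)) = 0")
    case True
    then have "S v v = 0" using ImP[OF BL2[OF v]] by (simp add: S_def complex_eq_iff)
    then have Pv: "norm_L2 a b (P v) = 0" by (rule P0[OF BL2[OF v]])
    show ?thesis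
      using v by (simp add: wS BL2 S0[OF yL2 BL2[OF v] Pv] A0[OF g BL2[OF v] Pv])
  next
    case False
    then have "v \<in> range e" using v B' by (simp add: B'_def e_def)
    then obtain k where k: "v = e k" by auto
    let ?r = "\<lambda>x. e k x - (\<Sum>j\<le>k. S (y j) (e k) *s y j x)"
    have p: "(\<lambda>x. \<Sum>j\<le>k. S (y j) (e k) *s y j x) \<in> L2 a b" by (intro L2_sum L2_smult yL2)
    have r: "?r \<in> L2 a b" by (intro L2_diff eL2 p)
    have Pr: "norm_L2 a b (P ?r) = 0" by (rule P0[OF r]) (unfold y_def, rule remainder_zero[OF eL2])
    have "S (y i) (e k) = 0" if i: "i \<notin> {..k}" for i
    proof -
      have "0 = S (y i) ?r" by (rule S0[OF yL2 r Pr, symmetric])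
      also have "\<dots> = S (y i) (e k) - (\<Sum>j\<le>k. S (y j) (e k) * S (y i) (y j))"
        using p by (simp add: S_diff yL2 eL2 S_sum S_smult L2_smult)
      also have "(\<Sum>j\<le>k. S (y j) (e k) * S (y i) (y j)) = 0"
        by (intro sum.neutral) (use i y_orth[OF eL2, of i] in \<open>auto simp: y_def\<close>)
      finally show ?thesis by simp
    qed
    moreover have "inner_L2 a b g (A (e k)) = (\<Sum>j\<le>k. S (y j) (e k) * inner_L2 a b g (A (y j)))"
      using A0[OF g r Pr] bounded_op_inner_diff[OF A g eL2 p] bounded_op_inner_sum[OF A g, of "{..k}" y "\<lambda>j. S (y j) (e k)"] yL2
      by simp
    ultimately show ?thesis
      unfolding k by (intro has_sum_finite_neutralI[where B = "{..k}"]) (auto simp: wS eL2 z_def)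
  qed
  \<comment> \<open>f is expanded in the basis and \<open>basis\<close> is applied to each term.
    After summation over v the double series is dominated by a constant times the squared norm of
    \<open>w k\<close>, so the order of summation may be exchanged.\<close>
  have main: "((\<lambda>k. inner_L2 a b (w k) f * inner_L2 a b g (z k)) has_sum inner_L2 a b g (A f)) UNIV"
    if f: "f \<in> L2 a b" and g: "g \<in> L2 a b" for f g
  proof -
    let ?h = "\<lambda>k v. inner_L2 a b (w k) v * inner_L2 a b v f * inner_L2 a b g (z k)"
    have zg: "cmod (inner_L2 a b g (z k)) \<le> norm_L2 a b g * norm_L2 a b (w k)" for k
      using inner_L2_Cauchy_Schwarz[OF g zL2[of k]] by (simp add: norm_z)
    have "(\<lambda>x. norm (case x of (k, v) \<Rightarrow> ?h k v)) summable_on UNIV \<times> B"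
    proof (rule Infinite_Sum.abs_summable_on_Sigma_iff[THEN iffD2], intro conjI ballI)
      show "(\<lambda>v. norm (case (k, v) of (k, v) \<Rightarrow> ?h k v)) summable_on B" for k
        using summable_on_cmult_left[OF Bessel_product_summable(1)[OF on wL2[of k] f], of "cmod (inner_L2 a b g (z k))"]
        by (simp add: norm_mult)
      have bound: "infsum (\<lambda>v. cmod (?h k v)) B \<le> (norm_L2 a b f * norm_L2 a b g) * (norm_L2 a b (w k))\<^sup>2" for k
      proof -
        have "infsum (\<lambda>v. cmod (?h k v)) B
            = infsum (\<lambda>v. cmod (inner_L2 a b (w k) v) * cmod (inner_L2 a b v f)) B * cmod (inner_L2 a b g (z k))"
          by (simp add: norm_mult infsum_cmult_left')
        also have "\<dots> \<le> (norm_L2 a b (w k) * norm_L2 a b f) * (norm_L2 a b g * norm_L2 a b (w k))"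
          by (intro mult_mono zg Bessel_product_summable(2)[OF on wL2 f]) auto
        finally show ?thesis by (simp add: power2_eq_square mult_ac)
      qed
      show "(\<lambda>k. norm (infsum (\<lambda>v. norm (case (k, v) of (k, v) \<Rightarrow> ?h k v)) B)) summable_on UNIV"
        by (rule Infinite_Sum.abs_summable_on_comparison_test[where g = "\<lambda>k. (norm_L2 a b f * norm_L2 a b g) * (norm_L2 a b (w k))\<^sup>2"])
          (use bound summable_on_cmult_right[OF wsum] in \<open>auto simp: infsum_nonneg\<close>)
    qed
    then have sm: "(\<lambda>(k, v). ?h k v) summable_on UNIV \<times> B" by (rule abs_summable_summable)
    have "((\<lambda>v. inner_L2 a b v f * inner_L2 a b g (A v)) has_sum inner_L2 a b g (A f)) B"
      by (rule bounded_op_expand[OF A onb f g])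
    then have "inner_L2 a b g (A f) = (\<Sum>\<^sub>\<infinity>v\<in>B. inner_L2 a b v f * inner_L2 a b g (A v))"
      by (simp add: infsumI)
    also have "\<dots> = (\<Sum>\<^sub>\<infinity>v\<in>B. \<Sum>\<^sub>\<infinity>k. ?h k v)"
    proof (rule infsum_cong)
      fix v assume v: "v \<in> B"
      from has_sum_cmult_right[OF basis[OF v g], of "inner_L2 a b v f"]
      show "inner_L2 a b v f * inner_L2 a b g (A v) = (\<Sum>\<^sub>\<infinity>k. ?h k v)"
        by (intro infsumI[symmetric]) (simp add: mult_ac)
    qed
    also have "\<dots> = (\<Sum>\<^sub>\<infinity>k. \<Sum>\<^sub>\<infinity>v\<in>B. ?h k v)"
      using infsum_swap_banach[OF sm] by simp
    also have "\<dots> = (\<Sum>\<^sub>\<infinity>k. inner_L2 a b (w k) f * inner_L2 a b g (z k))"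
      by (intro infsum_cong) (simp add: infsum_cmult_left' infsumI[OF Parseval[OF onb wL2 f]])
    finally have eq: "inner_L2 a b g (A f) = (\<Sum>\<^sub>\<infinity>k. inner_L2 a b (w k) f * inner_L2 a b g (z k))" .
    have "(\<lambda>k. inner_L2 a b (w k) f * inner_L2 a b g (z k)) summable_on UNIV"
    proof (rule abs_summable_summable, rule Infinite_Sum.abs_summable_on_comparison_test[where g = "\<lambda>k. (norm_L2 a b f * norm_L2 a b g) * (norm_L2 a b (w k))\<^sup>2"])
      show "(\<lambda>k. norm ((norm_L2 a b f * norm_L2 a b g) * (norm_L2 a b (w k))\<^sup>2)) summable_on UNIV"
        using summable_on_cmult_right[OF wsum] by auto
      fix k
      have "cmod (inner_L2 a b (w k) f) * cmod (inner_L2 a b g (z k)) \<le> (norm_L2 a b (w k) * norm_L2 a b f) * (norm_L2 a b g * norm_L2 a b (w k))"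
        by (intro mult_mono zg inner_L2_Cauchy_Schwarz[OF wL2 f]) auto
      then show "norm (inner_L2 a b (w k) f * inner_L2 a b g (z k)) \<le> norm ((norm_L2 a b f * norm_L2 a b g) * (norm_L2 a b (w k))\<^sup>2)"
        by (simp add: norm_mult power2_eq_square mult_ac)
    qed
    then show ?thesis unfolding eq by simp
  qed
  have "nuclear_rep a b A w z"
    unfolding nuclear_rep_def using wL2 zL2 AL2 main wsum by (simp add: norm_z power2_eq_square)
  then show ?thesis by blast
qed

section \<open>Traces of exterior powers\<close>

text \<open>Any finite set of tuples lies in a finite box, over which the sum of products is a
  product of finite sums.\<close>

lemma prod_PiE_summable:
  fixes f :: "'a \<Rightarrow> 'b \<Rightarrow> real"
  assumes fin: "finite A" and pos: "\<And>x y. x \<in> A \<Longrightarrow> y \<in> B x \<Longrightarrow> 0 \<le> f x y"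
    and summ: "\<And>x. x \<in> A \<Longrightarrow> f x summable_on B x"
  shows "(\<lambda>g. \<Prod>x\<in>A. f x (g x)) summable_on PiE A B"
proof (rule nonneg_bdd_above_summable_on)
  show "0 \<le> (\<Prod>x\<in>A. f x (g x))" if "g \<in> PiE A B" for g
    using that pos by (intro prod_nonneg) auto
  have "(\<Sum>g\<in>F. \<Prod>x\<in>A. f x (g x)) \<le> (\<Prod>x\<in>A. infsum (f x) (B x))" if F: "F \<subseteq> PiE A B" "finite F" for F
  proof -
    define C where "C x = (\<lambda>g. g x) ` F" for x
    have C: "finite (C x)" "x \<in> A \<Longrightarrow> C x \<subseteq> B x" for x using F by (auto simp: C_def)
    have "(\<Sum>g\<in>F. \<Prod>x\<in>A. f x (g x)) \<le> (\<Sum>g\<in>PiE A C. \<Prod>x\<in>A. f x (g x))"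
    proof (rule sum_mono2)
      show "finite (PiE A C)" using fin C by (intro finite_PiE) auto
      show "F \<subseteq> PiE A C"
      proof
        fix g assume g: "g \<in> F"
        then have "g \<in> extensional A" using F(1) by (auto simp: PiE_iff)
        then show "g \<in> PiE A C" using g by (simp add: C_def PiE_iff)
      qed
      show "0 \<le> (\<Prod>x\<in>A. f x (g x))" if "g \<in> PiE A C - F" for g
        using that by (intro prod_nonneg) (auto intro!: pos C(2)[THEN subsetD] simp: PiE_iff)
    qed
    also have "\<dots> = (\<Prod>x\<in>A. \<Sum>y\<in>C x. f x y)"
      using fin C by (intro prod_sum_PiE[symmetric]) auto
    also have "\<dots> \<le> (\<Prod>x\<in>A. infsum (f x) (B x))"
      by (intro prod_mono conjI sum_nonneg finite_sum_le_infsum summ C pos) (use C(2) in auto)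
    finally show ?thesis .
  qed
  then show "bdd_above (sum (\<lambda>g. \<Prod>x\<in>A. f x (g x)) ` {F. F \<subseteq> PiE A B \<and> finite F})"
    by (auto intro!: bdd_aboveI2)
qed

lemma nuclear_rep_L2:
  assumes "nuclear_rep a b A w z"
  shows "w k \<in> L2 a b" "z k \<in> L2 a b" "f \<in> L2 a b \<Longrightarrow> A f \<in> L2 a b"
  using assms by (auto simp: nuclear_rep_def)

lemma nuclear_rep_summable:
  "nuclear_rep a b A w z \<Longrightarrow> (\<lambda>k. norm_L2 a b (w k) * norm_L2 a b (z k)) summable_on UNIV"
  by (simp add: nuclear_rep_def)

lemma nuclear_rep_has_sum:
  "nuclear_rep a b A w z \<Longrightarrow> f \<in> L2 a b \<Longrightarrow> g \<in> L2 a b \<Longrightarrow>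
    ((\<lambda>k. inner_L2 a b (w k) f * inner_L2 a b g (z k)) has_sum inner_L2 a b g (A f)) UNIV"
  by (simp add: nuclear_rep_def)

lemma nuclear_rep_abs_summable:
  assumes nr: "nuclear_rep a b A w z" and f: "f \<in> L2 a b" and g: "g \<in> L2 a b"
  shows "(\<lambda>k. norm (inner_L2 a b (w k) f * inner_L2 a b g (z k))) summable_on UNIV"
proof (rule Infinite_Sum.abs_summable_on_comparison_test)
  show "(\<lambda>k. norm (norm_L2 a b f * norm_L2 a b g * (norm_L2 a b (w k) * norm_L2 a b (z k)))) summable_on UNIV"
    using summable_on_cmult_right[OF nuclear_rep_summable[OF nr]] by auto
  fix k
  have "cmod (inner_L2 a b (w k) f) * cmod (inner_L2 a b g (z k))
      \<le> (norm_L2 a b (w k) * norm_L2 a b f) * (norm_L2 a b g * norm_L2 a b (z k))"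
    by (intro mult_mono inner_L2_Cauchy_Schwarz nuclear_rep_L2[OF nr] f g) auto
  then show "norm (inner_L2 a b (w k) f * inner_L2 a b g (z k))
      \<le> norm (norm_L2 a b f * norm_L2 a b g * (norm_L2 a b (w k) * norm_L2 a b (z k)))"
    by (simp add: norm_mult mult_ac)
qed

text \<open>The heart of Cauchy-Binet. Inserting both the nuclear series of A and the basis
  expansion gives one absolutely summable family \<open>h s t\<close>: summing over the nuclear
  indices s first produces matrix elements of A, summing over the basis tuples t first produces Gram
  entries by Parseval.\<close>

lemma nuclear_tuple_product:
  fixes w z :: "'k \<Rightarrow> real \<Rightarrow> complex^'m" and n :: nat
  assumes nr: "nuclear_rep a b A w z" and p: "p permutes {..<n}"
  shows "(\<lambda>s. \<Prod>i<n. inner_L2 a b (w (s i)) (z (s (p i)))) summable_on ({..<n} \<rightarrow>\<^sub>E UNIV)"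
    and "onb_L2 a b B \<Longrightarrow> ((\<lambda>t. \<Prod>i<n. inner_L2 a b (t i) (A (t (p i)))) has_sum
      infsum (\<lambda>s. \<Prod>i<n. inner_L2 a b (w (s i)) (z (s (p i)))) ({..<n} \<rightarrow>\<^sub>E UNIV)) ({..<n} \<rightarrow>\<^sub>E B)"
proof -
  note wL2 = nuclear_rep_L2(1)[OF nr] and zL2 = nuclear_rep_L2(2)[OF nr]
  let ?N = "{..<n}"
  let ?U = "?N \<rightarrow>\<^sub>E (UNIV :: 'k set)"
  \<comment> \<open>A majorant independent of p, since a permutation only reorders its
    factors.\<close>
  define W where "W s = (\<Prod>i<n. norm_L2 a b (w (s i)) * norm_L2 a b (z (s i)))" for s
  have W: "W summable_on ?U"
    unfolding W_def[abs_def] by (intro prod_PiE_summable nuclear_rep_summable[OF nr]) auto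
  have W0: "norm (W s) = W s" for s unfolding W_def real_norm_def by (intro abs_of_nonneg prod_nonneg) auto
  have perm: "(\<Prod>i<n. g i) = (\<Prod>i<n. g (p i))" for g :: "nat \<Rightarrow> 'c::comm_monoid_mult"
    using prod.permute[OF p, of g] by (simp add: o_def)
  have pn: "p i < n \<longleftrightarrow> i < n" for i using permutes_in_image[OF p, of i] by simp
  show "(\<lambda>s. \<Prod>i<n. inner_L2 a b (w (s i)) (z (s (p i)))) summable_on ?U"
  proof (rule abs_summable_summable, rule Infinite_Sum.abs_summable_on_comparison_test[where g = W])
    show "(\<lambda>s. norm (W s)) summable_on ?U" using W by (simp only: W0)
    fix s
    have "norm (\<Prod>i<n. inner_L2 a b (w (s i)) (z (s (p i)))) \<le> (\<Prod>i<n. norm_L2 a b (w (s i)) * norm_L2 a b (z (s (p i))))"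
      unfolding prod_norm[symmetric] by (intro prod_mono conjI inner_L2_Cauchy_Schwarz wL2 zL2) auto
    also have "\<dots> = W s" unfolding W_def prod.distrib using perm[of "\<lambda>i. norm_L2 a b (z (s i))"] by simp
    finally show "norm (\<Prod>i<n. inner_L2 a b (w (s i)) (z (s (p i)))) \<le> norm (W s)" by simp
  qed
  assume onb: "onb_L2 a b B"
  note on = onb_orthonormal[OF onb]
  have BL2: "e \<in> B \<Longrightarrow> e \<in> L2 a b" for e using onb by (auto simp: onb_L2_def)
  let ?T = "?N \<rightarrow>\<^sub>E B"
  \<comment> \<open>The inverse permutation regroups the product so that each \<open>t i\<close>
    occurs in one factor only, and the sum over t becomes a product of Parseval sums;
    \<open>h_alt\<close> does the same for s.\<close>
  define q where "q = inv p"
  have qp: "q (p i) = i" "p (q i) = i" for i using permutes_inverses[OF p] by (auto simp: q_def)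
  define h where "h s t = (\<Prod>i<n. inner_L2 a b (w (s (q i))) (t i) * inner_L2 a b (t i) (z (s i)))" for s t
  have h_alt: "h s t = (\<Prod>i<n. inner_L2 a b (w (s i)) (t (p i)) * inner_L2 a b (t i) (z (s i)))" for s t
    unfolding h_def prod.distrib using perm[of "\<lambda>i. inner_L2 a b (w (s (q i))) (t i)"] by (simp add: qp)
  have abs_t: "(\<lambda>t. norm (h s t)) summable_on ?T" for s
    unfolding h_def prod_norm[symmetric] norm_mult
    by (intro prod_PiE_summable Bessel_product_summable(1)[OF on] wL2 zL2) auto
  have bound: "infsum (\<lambda>t. norm (h s t)) ?T \<le> W s" for s
  proof -
    have "infsum (\<lambda>t. norm (h s t)) ?T
        = (\<Prod>i<n. infsum (\<lambda>v. cmod (inner_L2 a b (w (s (q i))) v) * cmod (inner_L2 a b v (z (s i)))) B)"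
      unfolding h_def prod_norm[symmetric] norm_mult
      by (intro infsum_prod_PiE prod_PiE_summable Bessel_product_summable(1)[OF on] wL2 zL2) auto
    also have "\<dots> \<le> (\<Prod>i<n. norm_L2 a b (w (s (q i))) * norm_L2 a b (z (s i)))"
      by (intro prod_mono conjI Bessel_product_summable(2)[OF on] wL2 zL2 infsum_nonneg) auto
    also have "\<dots> = W s"
      unfolding W_def prod.distrib using perm[of "\<lambda>i. norm_L2 a b (w (s (q i)))"] by (simp add: qp)
    finally show ?thesis .
  qed
  have "(\<lambda>x. norm (case x of (s, t) \<Rightarrow> h s t)) summable_on ?U \<times> ?T"
  proof (rule Infinite_Sum.abs_summable_on_Sigma_iff[THEN iffD2], intro conjI ballI)
    show "(\<lambda>t. norm (case (s, t) of (s, t) \<Rightarrow> h s t)) summable_on ?T" for s using abs_t[of s] by simp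
    show "(\<lambda>s. norm (infsum (\<lambda>t. norm (case (s, t) of (s, t) \<Rightarrow> h s t)) ?T)) summable_on ?U"
    proof (rule Infinite_Sum.abs_summable_on_comparison_test[where g = W])
      show "(\<lambda>s. norm (W s)) summable_on ?U" using W by (simp only: W0)
      show "norm (infsum (\<lambda>t. norm (case (s, t) of (s, t) \<Rightarrow> h s t)) ?T) \<le> norm (W s)" for s
        using bound[of s] by (simp add: infsum_nonneg)
    qed
  qed
  then have sm: "(\<lambda>(s, t). h s t) summable_on ?U \<times> ?T" by (rule abs_summable_summable)
  then have sm': "(\<lambda>(t, s). h s t) summable_on ?T \<times> ?U"
    using summable_on_swap[of "\<lambda>(s, t). h s t" ?U ?T] by (simp add: case_prod_unfold)
  have inner_s: "infsum (\<lambda>s. h s t) ?U = (\<Prod>i<n. inner_L2 a b (t i) (A (t (p i))))" if t: "t \<in> ?T" for t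
  proof -
    have tB: "t i \<in> L2 a b" if "i < n" for i using t that by (auto intro!: BL2)
    have "infsum (\<lambda>s. h s t) ?U = (\<Prod>i<n. infsum (\<lambda>k. inner_L2 a b (w k) (t (p i)) * inner_L2 a b (t i) (z k)) UNIV)"
      unfolding h_alt
      by (rule infsum_prod_PiE_abs) (auto intro!: nuclear_rep_abs_summable[OF nr] tB simp: pn)
    also have "\<dots> = (\<Prod>i<n. inner_L2 a b (t i) (A (t (p i))))"
      by (intro prod.cong refl infsumI nuclear_rep_has_sum[OF nr] tB) (auto simp: pn)
    finally show ?thesis .
  qed
  have inner_t: "infsum (\<lambda>t. h s t) ?T = (\<Prod>i<n. inner_L2 a b (w (s i)) (z (s (p i))))" for s
  proof -
    have "infsum (\<lambda>t. h s t) ?T = (\<Prod>i<n. infsum (\<lambda>v. inner_L2 a b (w (s (q i))) v * inner_L2 a b v (z (s i))) B)"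
      unfolding h_def
      by (rule infsum_prod_PiE_abs) (auto simp: norm_mult intro!: Bessel_product_summable(1)[OF on] wL2 zL2)
    also have "\<dots> = (\<Prod>i<n. inner_L2 a b (w (s (q i))) (z (s i)))"
      by (intro prod.cong refl infsumI Parseval[OF onb] wL2 zL2)
    also have "\<dots> = (\<Prod>i<n. inner_L2 a b (w (s i)) (z (s (p i))))"
      using perm[of "\<lambda>i. inner_L2 a b (w (s (q i))) (z (s i))"] by (simp add: qp)
    finally show ?thesis .
  qed
  have "(\<lambda>t. infsum (\<lambda>s. h s t) ?U) summable_on ?T"
    by (rule summable_on_Sigma_banach[OF sm'])
  then have "((\<lambda>t. infsum (\<lambda>s. h s t) ?U) has_sum infsum (\<lambda>t. infsum (\<lambda>s. h s t) ?U) ?T) ?T" by simp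
  also have "infsum (\<lambda>t. infsum (\<lambda>s. h s t) ?U) ?T = infsum (\<lambda>s. infsum (\<lambda>t. h s t) ?T) ?U"
    by (rule infsum_swap_banach[OF sm, symmetric])
  also have "\<dots> = infsum (\<lambda>s. \<Prod>i<n. inner_L2 a b (w (s i)) (z (s (p i)))) ?U"
    by (simp add: inner_t)
  finally show "((\<lambda>t. \<Prod>i<n. inner_L2 a b (t i) (A (t (p i)))) has_sum
      infsum (\<lambda>s. \<Prod>i<n. inner_L2 a b (w (s i)) (z (s (p i)))) ?U) ?T"
    by (rule has_sum_cong[THEN iffD1, rotated]) (rule inner_s)
qed

lemma has_sum_finite_sum:
  fixes f :: "'p \<Rightarrow> 'a \<Rightarrow> complex"
  assumes "\<And>p. p \<in> P \<Longrightarrow> (f p has_sum s p) A"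
  shows "((\<lambda>x. \<Sum>p\<in>P. f p x) has_sum (\<Sum>p\<in>P. s p)) A"
  using assms by (induction P rule: infinite_finite_induct) (auto intro: has_sum_add)

definition gram :: "ereal \<Rightarrow> ereal \<Rightarrow> ('k \<Rightarrow> real \<Rightarrow> complex^'m) \<Rightarrow> ('k \<Rightarrow> real \<Rightarrow> complex^'m) \<Rightarrow> 'k \<Rightarrow> 'k \<Rightarrow> complex" where
  "gram a b w z k l = inner_L2 a b (w k) (z l)"

text \<open>The trace of the n-th exterior power, read off a representation instead of an operator.
  The sum over tuples counts every n-element subset n! times.\<close>

definition ext_trace :: "ereal \<Rightarrow> ereal \<Rightarrow> ('k \<Rightarrow> real \<Rightarrow> complex^'m) \<Rightarrow> ('k \<Rightarrow> real \<Rightarrow> complex^'m) \<Rightarrow> nat \<Rightarrow> complex" where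
  "ext_trace a b w z n = infsum (tuple_det n (gram a b w z)) ({..<n} \<rightarrow>\<^sub>E UNIV) / fact n"

lemma tuple_det_expand:
  "tuple_det n M t = (\<Sum>p | p permutes {..<n}. of_int (sign p) * (\<Prod>i<n. M (t i) (t (p i))))"
  by (simp add: tuple_det_def minor_def)

lemma nuclear_tuple_det:
  fixes w z :: "'k \<Rightarrow> real \<Rightarrow> complex^'m"
  assumes nr: "nuclear_rep a b A w z"
  shows "(tuple_det n (gram a b w z) has_sum (fact n * ext_trace a b w z n)) ({..<n} \<rightarrow>\<^sub>E UNIV)"
    and "onb_L2 a b B \<Longrightarrow> (tuple_det n (\<lambda>e e'. inner_L2 a b e (A e')) has_sum (fact n * ext_trace a b w z n)) ({..<n} \<rightarrow>\<^sub>E B)"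
proof -
  let ?U = "{..<n} \<rightarrow>\<^sub>E (UNIV :: 'k set)"
  define s where "s = (\<Sum>p | p permutes {..<n}. of_int (sign p) * infsum (\<lambda>s. \<Prod>i<n. inner_L2 a b (w (s i)) (z (s (p i)))) ?U)"
  have 1: "(tuple_det n (gram a b w z) has_sum s) ?U"
    unfolding tuple_det_expand[abs_def] gram_def s_def
    by (intro has_sum_finite_sum has_sum_cmult_right has_sum_infsum nuclear_tuple_product(1)[OF nr]) auto
  then have s: "s = fact n * ext_trace a b w z n" by (simp add: ext_trace_def infsumI)
  then show "(tuple_det n (gram a b w z) has_sum (fact n * ext_trace a b w z n)) ?U" using 1 by simp
  assume onb: "onb_L2 a b B"
  have "(tuple_det n (\<lambda>e e'. inner_L2 a b e (A e')) has_sum s) ({..<n} \<rightarrow>\<^sub>E B)"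
    unfolding tuple_det_expand[abs_def] s_def
    by (intro has_sum_finite_sum has_sum_cmult_right nuclear_tuple_product(2)[OF nr _ onb]) auto
  then show "(tuple_det n (\<lambda>e e'. inner_L2 a b e (A e')) has_sum (fact n * ext_trace a b w z n)) ({..<n} \<rightarrow>\<^sub>E B)"
    using s by simp
qed

lemma nuclear_minors:
  assumes nr: "nuclear_rep a b A w z"
  shows "(minor (gram a b w z) has_sum ext_trace a b w z n) {I. finite I \<and> card I = n}"
    and "onb_L2 a b B \<Longrightarrow> (minor_op a b A has_sum ext_trace a b w z n) {I. I \<subseteq> B \<and> finite I \<and> card I = n}"
  using minor_has_sum[OF nuclear_tuple_det(1)[OF nr, of n]]
    minor_has_sum[OF nuclear_tuple_det(2)[OF nr, of B n]]
  by (simp_all add: minor_op_eq_minor[abs_def])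

lemma exists_onb: "\<exists>B :: (real \<Rightarrow> complex^'m) set. onb_L2 a b B"
  using exists_localized_onb[of "\<lambda>_. 0" a b] by auto

text \<open>Resolves the definite description: the value is common to all orthonormal bases by
  \<open>nuclear_minors\<close>, and it is unique because some basis exists.\<close>

lemma op_trace_ext_nuclear:
  fixes A :: "(real \<Rightarrow> complex^'m) \<Rightarrow> real \<Rightarrow> complex^'m"
  assumes nr: "nuclear_rep a b A w z"
  shows "op_trace_ext a b n A = ext_trace a b w z n"
  unfolding op_trace_ext_def
proof (rule the_equality)
  show "\<forall>B. onb_L2 a b B \<longrightarrow> (minor_op a b A has_sum ext_trace a b w z n) {I. I \<subseteq> B \<and> finite I \<and> card I = n}"
    using nuclear_minors(2)[OF nr] by blast
  fix t
  assume t: "\<forall>B. onb_L2 a b B \<longrightarrow> (minor_op a b A has_sum t) {I. I \<subseteq> B \<and> finite I \<and> card I = n}"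
  obtain B :: "(real \<Rightarrow> complex^'m) set" where B: "onb_L2 a b B" using exists_onb by blast
  show "t = ext_trace a b w z n" using t nuclear_minors(2)[OF nr B, of n] B has_sum_unique by blast
qed

text \<open>Identifies the trace with the case n = 1 of the exterior traces, from which it inherits
  basis independence.\<close>

lemma has_sum_minor_singletons:
  "(minor M has_sum t) {I. I \<subseteq> B \<and> finite I \<and> card I = 1} \<longleftrightarrow> ((\<lambda>e. M e e) has_sum t) B"
proof -
  have "bij_betw (\<lambda>e. {e}) B {I. I \<subseteq> B \<and> finite I \<and> card I = 1}"
    by (rule bij_betwI[where g = the_elem]) (auto simp: card_1_singleton_iff)
  from has_sum_reindex_bij_betw[OF this, of "minor M" t]
  have "(minor M has_sum t) {I. I \<subseteq> B \<and> finite I \<and> card I = 1} \<longleftrightarrow> ((\<lambda>e. minor M {e}) has_sum t) B" by simp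
  also have "(\<lambda>e. minor M {e}) = (\<lambda>e. M e e)" by (simp add: minor_def sign_id)
  finally show ?thesis .
qed

lemma op_trace_nuclear:
  fixes A :: "(real \<Rightarrow> complex^'m) \<Rightarrow> real \<Rightarrow> complex^'m"
  assumes nr: "nuclear_rep a b A w z"
  shows "op_trace a b A = ext_trace a b w z 1"
    and "((\<lambda>k. inner_L2 a b (w k) (z k)) has_sum ext_trace a b w z 1) UNIV"
proof -
  have *: "((\<lambda>e. inner_L2 a b e (A e)) has_sum ext_trace a b w z 1) B" if "onb_L2 a b B" for B
    using nuclear_minors(2)[OF nr that, of 1]
    unfolding minor_op_eq_minor[abs_def] has_sum_minor_singletons .
  show "op_trace a b A = ext_trace a b w z 1"
    unfolding op_trace_def
  proof (rule the_equality)
    fix t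
    assume t: "\<forall>B. onb_L2 a b B \<longrightarrow> ((\<lambda>e. inner_L2 a b e (A e)) has_sum t) B"
    obtain B :: "(real \<Rightarrow> complex^'m) set" where B: "onb_L2 a b B" using exists_onb by blast
    show "t = ext_trace a b w z 1" using t *[OF B] B has_sum_unique by blast
  qed (use * in blast)
  have "(minor (gram a b w z) has_sum ext_trace a b w z 1) {I. I \<subseteq> UNIV \<and> finite I \<and> card I = 1}"
    using nuclear_minors(1)[OF nr, of 1] by simp
  then show "((\<lambda>k. inner_L2 a b (w k) (z k)) has_sum ext_trace a b w z 1) UNIV"
    unfolding has_sum_minor_singletons by (simp add: gram_def)
qed

text \<open>Lebesgue's theorem for the counting measure, transported to unordered sums.\<close>

lemma infsum_dominated_convergence:
  fixes f :: "nat \<Rightarrow> 'a \<Rightarrow> complex"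
  assumes g: "g summable_on A" and bound: "\<And>m x. x \<in> A \<Longrightarrow> norm (f m x) \<le> g x"
    and lim: "\<And>x. x \<in> A \<Longrightarrow> (\<lambda>m. f m x) \<longlonglongrightarrow> F x"
  shows "(\<lambda>m. infsum (f m) A) \<longlonglongrightarrow> infsum F A"
proof -
  have g0: "0 \<le> g x" if "x \<in> A" for x using bound[OF that, of 0] norm_ge_zero order_trans by blast
  have gi: "integrable (count_space A) g"
  proof -
    have "(\<lambda>x. norm (g x)) summable_on A" using g g0 by (subst summable_on_cong[of A _ g]) auto
    then show ?thesis unfolding abs_summable_on_def[symmetric] abs_summable_equivalent[symmetric] .
  qed
  have Fb: "norm (F x) \<le> g x" if "x \<in> A" for x
    by (rule LIMSEQ_le_const2[OF tendsto_norm[OF lim[OF that]]]) (use bound[OF that] in blast)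
  have eq: "infsum h A = (LINT x|count_space A. h x)" if "\<And>x. x \<in> A \<Longrightarrow> norm (h x) \<le> g x" for h :: "'a \<Rightarrow> complex"
  proof -
    have "integrable (count_space A) h"
      by (rule Bochner_Integration.integrable_bound[OF gi]) (use that g0 in \<open>auto simp: AE_count_space\<close>)
    then show ?thesis using infsetsum_infsum[of h A] by (simp add: infsetsum_def abs_summable_on_def)
  qed
  have "(\<lambda>m. LINT x|count_space A. f m x) \<longlonglongrightarrow> (LINT x|count_space A. F x)"
    by (rule integral_dominated_convergence[where w = g])
      (use gi bound lim in \<open>auto simp: AE_count_space\<close>)
  then show ?thesis by (simp add: eq[OF bound] eq[OF Fb])
qed

text \<open>Weak convergence of the vectors is enough: each tuple contributes a finite expression in
  Gram entries, and the norm bound by z supplies a majorant independent of m.\<close>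

lemma ext_trace_limit:
  fixes w z :: "'k \<Rightarrow> real \<Rightarrow> complex^'m"
  assumes nr: "nuclear_rep a b A w z"
    and zm: "\<And>m k. zm m k \<in> L2 a b" "\<And>m k. norm_L2 a b (zm m k) \<le> norm_L2 a b (z k)"
    and lim: "\<And>k l. (\<lambda>m. inner_L2 a b (w k) (zm m l)) \<longlonglongrightarrow> inner_L2 a b (w k) (z l)"
  shows "(\<lambda>m. ext_trace a b w (zm m) n) \<longlonglongrightarrow> ext_trace a b w z n"
  unfolding ext_trace_def
proof (intro tendsto_divide tendsto_const)
  note wL2 = nuclear_rep_L2(1)[OF nr] and zL2 = nuclear_rep_L2(2)[OF nr]
  let ?P = "{p. p permutes {..<n}}"
  let ?W = "\<lambda>s. \<Prod>i<n. norm_L2 a b (w (s i)) * norm_L2 a b (z (s i))"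
  show "(\<lambda>m. infsum (tuple_det n (gram a b w (zm m))) ({..<n} \<rightarrow>\<^sub>E UNIV))
      \<longlonglongrightarrow> infsum (tuple_det n (gram a b w z)) ({..<n} \<rightarrow>\<^sub>E UNIV)"
  proof (rule infsum_dominated_convergence)
    show "(\<lambda>s. \<Sum>p\<in>?P. ?W s) summable_on ({..<n} \<rightarrow>\<^sub>E UNIV)"
      unfolding sum_constant
      by (intro summable_on_cmult_right prod_PiE_summable nuclear_rep_summable[OF nr]) auto
    fix m and s :: "nat \<Rightarrow> 'k"
    show "norm (tuple_det n (gram a b w (zm m)) s) \<le> (\<Sum>p\<in>?P. ?W s)"
      unfolding tuple_det_expand
    proof (rule sum_norm_le)
      fix p assume "p \<in> ?P"
      then have p: "p permutes {..<n}" by simp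
      have "norm (of_int (sign p) * (\<Prod>i<n. gram a b w (zm m) (s i) (s (p i)))) = (\<Prod>i<n. cmod (inner_L2 a b (w (s i)) (zm m (s (p i)))))"
        by (simp add: norm_mult prod_norm gram_def sign_def)
      also have "\<dots> \<le> (\<Prod>i<n. norm_L2 a b (w (s i)) * norm_L2 a b (z (s (p i))))"
      proof (intro prod_mono conjI)
        fix i
        have "cmod (inner_L2 a b (w (s i)) (zm m (s (p i)))) \<le> norm_L2 a b (w (s i)) * norm_L2 a b (zm m (s (p i)))"
          by (rule inner_L2_Cauchy_Schwarz[OF wL2 zm(1)])
        also have "\<dots> \<le> norm_L2 a b (w (s i)) * norm_L2 a b (z (s (p i)))"
          by (intro mult_left_mono zm(2)) simp
        finally show "cmod (inner_L2 a b (w (s i)) (zm m (s (p i)))) \<le> norm_L2 a b (w (s i)) * norm_L2 a b (z (s (p i)))" .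
      qed simp
      also have "\<dots> = ?W s"
        unfolding prod.distrib using prod.permute[OF p, of "\<lambda>i. norm_L2 a b (z (s i))"] by (simp add: o_def)
      finally show "norm (of_int (sign p) * (\<Prod>i<n. gram a b w (zm m) (s i) (s (p i)))) \<le> ?W s" .
    qed
  next
    fix s :: "nat \<Rightarrow> 'k"
    show "(\<lambda>m. tuple_det n (gram a b w (zm m)) s) \<longlonglongrightarrow> tuple_det n (gram a b w z) s"
      unfolding tuple_det_expand gram_def by (intro tendsto_intros lim)
  qed
qed simp

section \<open>Translations and causal operators\<close>

text \<open>Values of f outside the interval carry no meaning, hence the condition on x - h. With it
  the translation is a contraction whose adjoint is the translation by -h.\<close>

definition shift :: "ereal \<Rightarrow> ereal \<Rightarrow> real \<Rightarrow> (real \<Rightarrow> 'c::euclidean_space) \<Rightarrow> real \<Rightarrow> 'c" where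
  "shift a b h f = (\<lambda>x. if x \<in> einterval a b \<and> x - h \<in> einterval a b then f (x - h) else 0)"

section \<open>Translations of Lebesgue measure cut off to an interval\<close>

lemma einterval_lebesgue [simp]: "einterval a b \<in> sets lebesgue"
  using borel_einterval[of a b] by (intro sets_completionI_sets) simp

lemma integrable_lebesgue_ab:
  fixes f :: "real \<Rightarrow> 'c::euclidean_space"
  shows
  "integrable (lebesgue_ab a b) f \<longleftrightarrow> integrable lebesgue (\<lambda>x. indicator (einterval a b) x *\<^sub>R f x)"
  using integrable_restrict_space[of "einterval a b" lebesgue f] by simp

lemma integral_lebesgue_ab:
  fixes f :: "real \<Rightarrow> 'c::euclidean_space"
  shows
  "(LINT x|lebesgue_ab a b. f x) = (LINT x|lebesgue. indicator (einterval a b) x *\<^sub>R f x)"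
  using integral_restrict_space[of "einterval a b" lebesgue f] by simp

lemma measurable_lebesgue_ab:
  fixes f :: "real \<Rightarrow> 'c::euclidean_space"
  shows
  "f \<in> borel_measurable (lebesgue_ab a b) \<longleftrightarrow> (\<lambda>x. indicator (einterval a b) x *\<^sub>R f x) \<in> borel_measurable lebesgue"
  using borel_measurable_restrict_space_iff[of "einterval a b" lebesgue f] by simp

lemma integrable_lebesgue_shift:
  fixes F :: "real \<Rightarrow> 'c::euclidean_space"
  shows "integrable lebesgue F \<Longrightarrow> integrable lebesgue (\<lambda>x. F (x - h))"
  using lebesgue_integrable_real_affine[of F 1 "- h"] by simp

lemma integral_lebesgue_shift:
  fixes F :: "real \<Rightarrow> 'c::euclidean_space"
  shows "(LINT x|lebesgue. F (x - h)) = (LINT x|lebesgue. F x)"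
  using lebesgue_integral_real_affine[of 1 F "- h"] by simp

lemma measurable_lebesgue_shift: "(\<lambda>x::real. x - h) \<in> lebesgue \<rightarrow>\<^sub>M lebesgue"
  using lebesgue_affine_measurable[of "\<lambda>x::real. 1" "- h"] by simp

lemma shift_L2:
  assumes f: "f \<in> L2 a b"
  shows "shift a b h f \<in> L2 a b" and "norm_L2 a b (shift a b h f) \<le> norm_L2 a b f"
proof -
  let ?I = "\<lambda>x. indicator (einterval a b) x :: real"
  let ?F = "\<lambda>x. ?I x *\<^sub>R f x" and ?G = "\<lambda>x. ?I x *\<^sub>R (norm (f x))\<^sup>2"
  have F: "?F \<in> borel_measurable lebesgue" using L2_measurable[OF f] by (simp add: measurable_lebesgue_ab)
  have "(\<lambda>x. ?I x *\<^sub>R ?F (x - h)) \<in> borel_measurable lebesgue"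
    by (rule borel_measurable_scaleR[OF borel_measurable_indicator measurable_compose[OF measurable_lebesgue_shift F]]) simp
  also have "(\<lambda>x. ?I x *\<^sub>R ?F (x - h)) = (\<lambda>x. ?I x *\<^sub>R shift a b h f x)"
    by (auto simp: shift_def indicator_def fun_eq_iff)
  finally have m: "shift a b h f \<in> borel_measurable (lebesgue_ab a b)" by (simp add: measurable_lebesgue_ab)
  have G: "integrable lebesgue ?G" using L2_integrable_norm2[OF f] by (simp add: integrable_lebesgue_ab)
  have Gh: "integrable lebesgue (\<lambda>x. ?G (x - h))" by (rule integrable_lebesgue_shift[OF G])
  have le: "?I x *\<^sub>R (norm (shift a b h f x))\<^sup>2 \<le> ?G (x - h)" for x
    by (auto simp: shift_def indicator_def)
  have i: "integrable lebesgue (\<lambda>x. ?I x *\<^sub>R (norm (shift a b h f x))\<^sup>2)"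
  proof (rule Bochner_Integration.integrable_bound[OF Gh])
    have "(\<lambda>x. (norm (shift a b h f x))\<^sup>2) \<in> borel_measurable (lebesgue_ab a b)" using m by measurable
    then show "(\<lambda>x. ?I x *\<^sub>R (norm (shift a b h f x))\<^sup>2) \<in> borel_measurable lebesgue"
      by (simp add: measurable_lebesgue_ab)
    show "AE x in lebesgue. norm (?I x *\<^sub>R (norm (shift a b h f x))\<^sup>2) \<le> norm (?G (x - h))"
      by (rule AE_I2) (auto simp: shift_def indicator_def)
  qed
  then show s: "shift a b h f \<in> L2 a b" using m by (simp add: L2_def integrable_lebesgue_ab)
  have "(norm_L2 a b (shift a b h f))\<^sup>2 \<le> (norm_L2 a b f)\<^sup>2"
  proof -
    have "(norm_L2 a b (shift a b h f))\<^sup>2 = (LINT x|lebesgue. ?I x *\<^sub>R (norm (shift a b h f x))\<^sup>2)"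
      unfolding norm_L2_power2 integral_lebesgue_ab ..
    also have "\<dots> \<le> (LINT x|lebesgue. ?G (x - h))"
      by (rule integral_mono[OF i Gh le])
    also have "\<dots> = (LINT x|lebesgue. ?G x)" by (rule integral_lebesgue_shift)
    also have "\<dots> = (norm_L2 a b f)\<^sup>2" unfolding norm_L2_power2 integral_lebesgue_ab ..
    finally show ?thesis .
  qed
  then show "norm_L2 a b (shift a b h f) \<le> norm_L2 a b f" by (rule power2_le_imp_le) simp
qed

text \<open>Substitute x + h for x; the cut-off condition is symmetric in the two points.\<close>

lemma inner_shift: "inner_L2 a b g (shift a b h f) = inner_L2 a b (shift a b (- h) g) f"
proof -
  let ?E = "einterval a b"
  let ?F = "\<lambda>x. if x \<in> ?E \<and> x - h \<in> ?E then hdot (g x) (f (x - h)) else 0"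
  have "inner_L2 a b g (shift a b h f) = (LINT x|lebesgue. ?F x)"
    unfolding inner_L2_hdot integral_lebesgue_ab
    by (intro Bochner_Integration.integral_cong refl) (auto simp: shift_def indicator_def hdot_def)
  also have "\<dots> = (LINT x|lebesgue. ?F (x - (- h)))" by (rule integral_lebesgue_shift[symmetric])
  also have "\<dots> = inner_L2 a b (shift a b (- h) g) f"
    unfolding inner_L2_hdot integral_lebesgue_ab
    by (intro Bochner_Integration.integral_cong refl) (auto simp: shift_def indicator_def hdot_def)
  finally show ?thesis .
qed

text \<open>Strong continuity of the translations at h = 0 in sequential form. It is established for
  larger and larger classes of functions: indicators of open sets, of measurable sets, simple
  functions, all of \<open>L2\<close>.\<close>

definition shift_continuous :: "ereal \<Rightarrow> ereal \<Rightarrow> (real \<Rightarrow> complex^'m) \<Rightarrow> bool" where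
  "shift_continuous a b f \<longleftrightarrow> (\<forall>h. h \<longlonglongrightarrow> 0 \<longrightarrow> (\<lambda>n::nat. norm_L2 a b (\<lambda>x. shift a b (h n) f x - f x)) \<longlonglongrightarrow> 0)"

lemma shift_diff: "shift a b h (\<lambda>x. f x - g x) = (\<lambda>x. shift a b h f x - shift a b h g x)"
  by (auto simp: shift_def)

lemma shift_continuous_add:
  fixes f g :: "real \<Rightarrow> complex^'m"
  assumes "shift_continuous a b f" "shift_continuous a b g" "f \<in> L2 a b" "g \<in> L2 a b"
  shows "shift_continuous a b (\<lambda>x. f x + g x)"
  unfolding shift_continuous_def
proof (intro allI impI)
  fix h :: "nat \<Rightarrow> real" assume h: "h \<longlonglongrightarrow> 0"
  have "(\<lambda>n. norm_L2 a b (\<lambda>x. shift a b (h n) f x - f x) + norm_L2 a b (\<lambda>x. shift a b (h n) g x - g x)) \<longlonglongrightarrow> 0 + 0"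
    using assms h by (intro tendsto_add) (auto simp: shift_continuous_def)
  then have "(\<lambda>n. norm_L2 a b (\<lambda>x. shift a b (h n) f x - f x) + norm_L2 a b (\<lambda>x. shift a b (h n) g x - g x)) \<longlonglongrightarrow> 0" by simp
  then show "(\<lambda>n. norm_L2 a b (\<lambda>x. shift a b (h n) (\<lambda>x. f x + g x) x - (f x + g x))) \<longlonglongrightarrow> 0"
  proof (rule Lim_null_comparison[rotated], intro always_eventually allI)
    fix n
    have eq: "(\<lambda>x. shift a b (h n) (\<lambda>x. f x + g x) x - (f x + g x)) = (\<lambda>x. (shift a b (h n) f x - f x) + (shift a b (h n) g x - g x))"
      by (auto simp: shift_def)
    show "norm (norm_L2 a b (\<lambda>x. shift a b (h n) (\<lambda>x. f x + g x) x - (f x + g x)))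
        \<le> norm_L2 a b (\<lambda>x. shift a b (h n) f x - f x) + norm_L2 a b (\<lambda>x. shift a b (h n) g x - g x)"
      unfolding eq real_norm_def abs_of_nonneg[OF norm_L2_nonneg]
      by (intro norm_L2_add_le L2_diff shift_L2 assms)
  qed
qed

lemma shift_continuous_zero: "shift_continuous a b (\<lambda>x. 0)"
  by (simp add: shift_continuous_def shift_def)

lemma shift_continuous_sum:
  fixes f :: "'k \<Rightarrow> real \<Rightarrow> complex^'m"
  assumes "\<And>k. k \<in> F \<Longrightarrow> shift_continuous a b (f k)" "\<And>k. k \<in> F \<Longrightarrow> f k \<in> L2 a b"
  shows "shift_continuous a b (\<lambda>x. \<Sum>k\<in>F. f k x)"
  using assms by (induction F rule: infinite_finite_induct)
    (auto intro!: shift_continuous_zero shift_continuous_add L2_sum)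

text \<open>Translations are contractions, so approximation in norm is uniform in h; three errors of
  size r / 4 stay below r.\<close>

lemma shift_continuous_approx:
  fixes f :: "real \<Rightarrow> complex^'m"
  assumes f: "f \<in> L2 a b"
    and ap: "\<And>\<epsilon>. \<epsilon> > 0 \<Longrightarrow> \<exists>g\<in>L2 a b. shift_continuous a b g \<and> norm_L2 a b (\<lambda>x. f x - g x) \<le> \<epsilon>"
  shows "shift_continuous a b f"
  unfolding shift_continuous_def
proof (intro allI impI)
  fix h :: "nat \<Rightarrow> real" assume h: "h \<longlonglongrightarrow> 0"
  show "(\<lambda>n. norm_L2 a b (\<lambda>x. shift a b (h n) f x - f x)) \<longlonglongrightarrow> 0"
  proof (rule LIMSEQ_I)
    fix r :: real assume r: "0 < r"
    obtain g where g: "g \<in> L2 a b" "shift_continuous a b g" "norm_L2 a b (\<lambda>x. f x - g x) \<le> r / 4"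
      using ap[of "r / 4"] r by auto
    have "(\<lambda>n. norm_L2 a b (\<lambda>x. shift a b (h n) g x - g x)) \<longlonglongrightarrow> 0"
      using g(2) h by (auto simp: shift_continuous_def)
    then obtain N where N: "\<And>n. n \<ge> N \<Longrightarrow> norm_L2 a b (\<lambda>x. shift a b (h n) g x - g x) < r / 4"
      using r LIMSEQ_D[of _ 0 "r/4"] by fastforce
    have "norm (norm_L2 a b (\<lambda>x. shift a b (h n) f x - f x) - 0) < r" if n: "n \<ge> N" for n
    proof -
      note L = f g(1) shift_L2(1)[OF f, of "h n"] shift_L2(1)[OF g(1), of "h n"]
      have "norm_L2 a b (\<lambda>x. shift a b (h n) f x - f x)
          \<le> norm_L2 a b (\<lambda>x. shift a b (h n) f x - shift a b (h n) g x) + norm_L2 a b (\<lambda>x. shift a b (h n) g x - f x)"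
        using L by (intro norm_L2_diff_triangle)
      also have "norm_L2 a b (\<lambda>x. shift a b (h n) g x - f x)
          \<le> norm_L2 a b (\<lambda>x. shift a b (h n) g x - g x) + norm_L2 a b (\<lambda>x. g x - f x)"
        using L by (intro norm_L2_diff_triangle)
      also have "norm_L2 a b (\<lambda>x. shift a b (h n) f x - shift a b (h n) g x) \<le> norm_L2 a b (\<lambda>x. f x - g x)"
        using shift_L2(2)[OF L2_diff[OF f g(1)], of "h n"] by (simp add: shift_diff)
      finally show ?thesis using N[OF n] g(3) r norm_L2_minus[of a b g f] by simp
    qed
    then show "\<exists>N. \<forall>n\<ge>N. norm (norm_L2 a b (\<lambda>x. shift a b (h n) f x - f x) - 0) < r" by blast
  qed
qed

text \<open>Reduces norm continuity to the convergence of one scalar product, because the translate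
  has norm at most that of f.\<close>

lemma norm_shift_diff_le:
  fixes f :: "real \<Rightarrow> complex^'m"
  assumes f: "f \<in> L2 a b"
  shows "(norm_L2 a b (\<lambda>x. shift a b h f x - f x))\<^sup>2 \<le> 2 * ((norm_L2 a b f)\<^sup>2 - Re (inner_L2 a b f (shift a b h f)))"
proof -
  let ?s = "shift a b h f"
  have s: "?s \<in> L2 a b" by (rule shift_L2[OF f])
  have "complex_of_real ((norm_L2 a b (\<lambda>x. ?s x - f x))\<^sup>2) = inner_L2 a b (\<lambda>x. ?s x - f x) (\<lambda>x. ?s x - f x)"
    by (simp add: inner_L2_self)
  also have "\<dots> = inner_L2 a b ?s ?s - inner_L2 a b f ?s - cnj (inner_L2 a b f ?s) + inner_L2 a b f f"
    using s f inner_L2_commute[of a b ?s f] by (simp add: inner_L2_diff_left inner_L2_diff_right L2_diff)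
  finally have "(norm_L2 a b (\<lambda>x. ?s x - f x))\<^sup>2 = (norm_L2 a b ?s)\<^sup>2 - 2 * Re (inner_L2 a b f ?s) + (norm_L2 a b f)\<^sup>2"
    unfolding inner_L2_self by (simp add: complex_eq_iff del: of_real_power)
  moreover have "(norm_L2 a b ?s)\<^sup>2 \<le> (norm_L2 a b f)\<^sup>2" using shift_L2(2)[OF f] by (intro power_mono) auto
  ultimately show ?thesis by simp
qed

lemma L2_if:
  fixes c :: "complex^'m"
  assumes U: "U \<in> sets lebesgue" "U \<subseteq> einterval a b" "emeasure lebesgue U < \<infinity>"
  shows "(\<lambda>x. if x \<in> U then c else 0) \<in> L2 a b"
    and "(norm_L2 a b (\<lambda>x. if x \<in> U then c else 0))\<^sup>2 = (norm c)\<^sup>2 * measure lebesgue U"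
proof -
  have eq: "(\<lambda>x. indicator (einterval a b) x *\<^sub>R (if x \<in> U then c else 0)) = (\<lambda>x. indicator U x *\<^sub>R c)"
    and eq2: "(\<lambda>x. indicator (einterval a b) x *\<^sub>R (norm (if x \<in> U then c else 0))\<^sup>2) = (\<lambda>x. (norm c)\<^sup>2 * indicator U x)"
    using U(2) by (auto simp: indicator_def fun_eq_iff)
  have i: "integrable lebesgue (\<lambda>x. (norm c)\<^sup>2 * indicator U x)"
    using U by (intro integrable_mult_right integrable_real_indicator) auto
  show "(\<lambda>x. if x \<in> U then c else 0) \<in> L2 a b"
    unfolding L2_def mem_Collect_eq measurable_lebesgue_ab integrable_lebesgue_ab eq eq2
    using U(1) i by auto
  show "(norm_L2 a b (\<lambda>x. if x \<in> U then c else 0))\<^sup>2 = (norm c)\<^sup>2 * measure lebesgue U"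
    unfolding norm_L2_power2 integral_lebesgue_ab eq2 using U by simp
qed

text \<open>A point of an open set stays in it under small translations, so the product of the two
  indicators converges pointwise to the indicator of U. For a general measurable set this pointwise
  convergence may fail.\<close>

lemma shift_continuous_open:
  fixes c :: "complex^'m"
  assumes U: "open U" "U \<subseteq> einterval a b" "emeasure lebesgue U < \<infinity>"
  shows "shift_continuous a b (\<lambda>x. if x \<in> U then c else 0)"
  unfolding shift_continuous_def
proof (intro allI impI)
  fix h :: "nat \<Rightarrow> real" assume h: "h \<longlonglongrightarrow> 0"
  have Ul: "U \<in> sets lebesgue" using U(1) by auto
  let ?u = "\<lambda>x. if x \<in> U then c else 0"
  let ?p = "\<lambda>n x. indicator U x * indicator U (x - h n) :: real"
  note u = L2_if[OF Ul U(2,3), of c]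
  have inner: "Re (inner_L2 a b ?u (shift a b (h n) ?u)) = (norm c)\<^sup>2 * (LINT x|lebesgue. ?p n x)" for n
  proof -
    have "inner_L2 a b ?u (shift a b (h n) ?u) = (LINT x|lebesgue. complex_of_real ((norm c)\<^sup>2 * ?p n x))"
      unfolding inner_L2_hdot integral_lebesgue_ab
      using U(2) by (intro Bochner_Integration.integral_cong refl)
        (auto simp: shift_def indicator_def hdot_self hdot_def[of 0] hdot_def[of _ 0])
    also have "\<dots> = of_real (LINT x|lebesgue. (norm c)\<^sup>2 * ?p n x)" by (rule integral_complex_of_real)
    finally show ?thesis by simp
  qed
  have mU: "(indicator U :: real \<Rightarrow> real) \<in> borel_measurable lebesgue" using Ul by simp
  have iU: "integrable lebesgue (indicator U :: real \<Rightarrow> real)"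
    using Ul U(3) by (intro integrable_real_indicator) auto
  have "(\<lambda>n. LINT x|lebesgue. ?p n x) \<longlonglongrightarrow> (LINT x|lebesgue. indicator U x)"
  proof (rule integral_dominated_convergence[where w = "indicator U"])
    show "(\<lambda>x. ?p n x) \<in> borel_measurable lebesgue" for n
      by (intro borel_measurable_times mU measurable_compose[OF measurable_lebesgue_shift mU])
    show "AE x in lebesgue. (\<lambda>n. ?p n x) \<longlonglongrightarrow> indicator U x"
    proof (rule AE_I2)
      fix x :: real
      show "(\<lambda>n. ?p n x) \<longlonglongrightarrow> indicator U x"
      proof (cases "x \<in> U")
        case True
        have "(\<lambda>n. x - h n) \<longlonglongrightarrow> x - 0" by (intro tendsto_diff tendsto_const h)
        then have "eventually (\<lambda>n. x - h n \<in> U) sequentially"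
          using True U(1) by (intro topological_tendstoD) auto
        then have "eventually (\<lambda>n. ?p n x = indicator U x) sequentially"
          by eventually_elim (use True in simp)
        then show ?thesis by (rule tendsto_eventually)
      qed simp
    qed
    show "AE x in lebesgue. norm (?p n x) \<le> indicator U x" for n
      by (rule AE_I2) (auto simp: indicator_def)
  qed (use mU iU in auto)
  then have "(\<lambda>n. LINT x|lebesgue. ?p n x) \<longlonglongrightarrow> measure lebesgue U" using Ul by simp
  then have "(\<lambda>n. 2 * ((norm c)\<^sup>2 * measure lebesgue U - (norm c)\<^sup>2 * (LINT x|lebesgue. ?p n x)))
      \<longlonglongrightarrow> 2 * ((norm c)\<^sup>2 * measure lebesgue U - (norm c)\<^sup>2 * measure lebesgue U)"
    by (intro tendsto_intros)
  then have "(\<lambda>n. 2 * ((norm c)\<^sup>2 * measure lebesgue U - (norm c)\<^sup>2 * (LINT x|lebesgue. ?p n x))) \<longlonglongrightarrow> 0" by simp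
  then have "(\<lambda>n. (norm_L2 a b (\<lambda>x. shift a b (h n) ?u x - ?u x))\<^sup>2) \<longlonglongrightarrow> 0"
  proof (rule Lim_null_comparison[rotated], intro always_eventually allI)
    show "norm ((norm_L2 a b (\<lambda>x. shift a b (h n) ?u x - ?u x))\<^sup>2)
        \<le> 2 * ((norm c)\<^sup>2 * measure lebesgue U - (norm c)\<^sup>2 * (LINT x|lebesgue. ?p n x))" for n
      using norm_shift_diff_le[OF u(1), of "h n"] unfolding inner u(2) by simp
  qed
  from tendsto_real_sqrt[OF this]
  show "(\<lambda>n. norm_L2 a b (\<lambda>x. shift a b (h n) ?u x - ?u x)) \<longlonglongrightarrow> 0" by simp
qed

text \<open>Outer regularity of Lebesgue measure approximates S by open sets in norm.\<close>

lemma shift_continuous_measurable: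
  fixes c :: "complex^'m"
  assumes S: "S \<in> sets lebesgue" "S \<subseteq> einterval a b" "emeasure lebesgue S < \<infinity>"
  shows "shift_continuous a b (\<lambda>x. if x \<in> S then c else 0)"
proof (rule shift_continuous_approx)
  show "(\<lambda>x. if x \<in> S then c else 0) \<in> L2 a b" by (rule L2_if[OF S])
  fix \<epsilon> :: real assume "\<epsilon> > 0"
  \<comment> \<open>Chosen so that e times the squared norm of c is at most \<epsilon> squared,
    including the case c = 0.\<close>
  define e where "e = \<epsilon>\<^sup>2 / ((norm c)\<^sup>2 + 1)"
  have c1: "(norm c)\<^sup>2 + 1 > 0" by (simp add: add_nonneg_pos)
  have e: "e > 0" using \<open>\<epsilon> > 0\<close> c1 by (simp add: e_def)
  obtain T where T: "open T" "S \<subseteq> T" "T - S \<in> lmeasurable" "emeasure lebesgue (T - S) < ennreal e"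
    using sets_lebesgue_outer_open[OF S(1) e] by blast
  define U where "U = T \<inter> einterval a b"
  have U: "open U" "U \<subseteq> einterval a b" using T(1) by (auto simp: U_def)
  have Ul: "U \<in> sets lebesgue" using U(1) by auto
  have US: "U - S \<in> sets lebesgue" "U - S \<subseteq> einterval a b" using Ul S U by auto
  have mle: "emeasure lebesgue (U - S) \<le> emeasure lebesgue (T - S)"
    using T(3) by (intro emeasure_mono) (auto simp: U_def)
  then have mfin: "emeasure lebesgue (U - S) < ennreal e" using T(4) by simp
  then have fin: "emeasure lebesgue (U - S) < \<infinity>" using ennreal_less_top[of e] by (auto intro: less_trans)
  have "emeasure lebesgue U \<le> emeasure lebesgue S + emeasure lebesgue (U - S)"
  proof -
    have "emeasure lebesgue U \<le> emeasure lebesgue (S \<union> (U - S))"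
      by (intro emeasure_mono sets.Un[OF S(1) US(1)]) auto
    also have "\<dots> \<le> emeasure lebesgue S + emeasure lebesgue (U - S)"
      using S(1) US(1) by (rule emeasure_subadditive)
    finally show ?thesis .
  qed
  also have "\<dots> < \<infinity>" using S(3) fin by (auto simp: ennreal_add_less_top)
  finally have Ufin: "emeasure lebesgue U < \<infinity>" .
  have "measure lebesgue (U - S) \<le> e"
    using mfin fin e by (simp add: measure_def enn2real_leI less_imp_le)
  have diff: "(\<lambda>x. (if x \<in> S then c else 0) - (if x \<in> U then c else 0)) = (\<lambda>x. - (if x \<in> U - S then c else 0))"
    using T(2) S(2) by (auto simp: U_def fun_eq_iff)
  have "(norm_L2 a b (\<lambda>x. (if x \<in> S then c else 0) - (if x \<in> U then c else 0)))\<^sup>2 = (norm c)\<^sup>2 * measure lebesgue (U - S)"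
    unfolding diff using L2_if(2)[OF US fin, of c] by (simp add: norm_L2_def)
  also have "\<dots> \<le> (norm c)\<^sup>2 * e"
    by (rule mult_left_mono[OF \<open>measure lebesgue (U - S) \<le> e\<close>]) simp
  also have "\<dots> \<le> \<epsilon>\<^sup>2" using c1 by (simp add: e_def field_simps)
  finally have "norm_L2 a b (\<lambda>x. (if x \<in> S then c else 0) - (if x \<in> U then c else 0)) \<le> \<epsilon>"
    using \<open>\<epsilon> > 0\<close> by - (rule power2_le_imp_le, auto)
  then show "\<exists>g\<in>L2 a b. shift_continuous a b g \<and> norm_L2 a b (\<lambda>x. (if x \<in> S then c else 0) - g x) \<le> \<epsilon>"
    using shift_continuous_open[OF U Ufin, of c] L2_if(1)[OF Ul U(2) Ufin, of c] by blast
qed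

lemma shift_continuous_L2:
  fixes f :: "real \<Rightarrow> complex^'m"
  assumes f: "f \<in> L2 a b"
  shows "shift_continuous a b f"
proof (rule shift_continuous_approx[OF f])
  let ?M = "lebesgue_ab a b"
  obtain F where F: "\<And>i. simple_function ?M (F i)" "\<And>x. x \<in> space ?M \<Longrightarrow> (\<lambda>i. F i x) \<longlonglongrightarrow> f x"
    "\<And>i x. x \<in> space ?M \<Longrightarrow> dist (F i x) 0 \<le> 2 * dist (f x) 0"
    using borel_measurable_implies_sequence_metric[OF L2_measurable[OF f], of 0] by blast
  have sp: "space ?M = einterval a b" by simp
  have Fm [measurable]: "F i \<in> borel_measurable ?M" for i by (rule borel_measurable_simple_function[OF F(1)])
  have [measurable]: "f \<in> borel_measurable ?M" by (rule L2_measurable[OF f])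
  have Fb: "norm (F i x) \<le> 2 * norm (f x)" if "x \<in> einterval a b" for i x using F(3)[of x i] that by simp
  have FL2: "F i \<in> L2 a b" for i
    by (rule L2_bound[OF Fm f, where C = 2]) (rule AE_I2, use Fb in simp)
  have lim: "(\<lambda>i. norm_L2 a b (\<lambda>x. f x - F i x)) \<longlonglongrightarrow> 0"
  proof -
    have "(\<lambda>i. LINT x|?M. (norm (f x - F i x))\<^sup>2) \<longlonglongrightarrow> (LINT x|?M. 0)"
    \<comment> \<open>The simple functions are bounded by twice the norm of f, so the difference is
      bounded by three times it; 9 is the square.\<close>
    proof (rule integral_dominated_convergence[where w = "\<lambda>x. 9 * (norm (f x))\<^sup>2"])
      show "AE x in ?M. (\<lambda>i. (norm (f x - F i x))\<^sup>2) \<longlonglongrightarrow> 0"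
      proof (rule AE_I2)
        fix x assume "x \<in> space ?M"
        from tendsto_power[OF tendsto_norm[OF tendsto_diff[OF tendsto_const F(2)[OF this]]], of "f x" 2]
        show "(\<lambda>i. (norm (f x - F i x))\<^sup>2) \<longlonglongrightarrow> 0" by simp
      qed
      show "AE x in ?M. norm ((norm (f x - F i x))\<^sup>2) \<le> 9 * (norm (f x))\<^sup>2" for i
      proof (rule AE_I2)
        fix x assume "x \<in> space ?M"
        then have "norm (f x - F i x) \<le> 3 * norm (f x)"
          using norm_triangle_ineq4[of "f x" "F i x"] Fb[of x i] by simp
        then have "(norm (f x - F i x))\<^sup>2 \<le> (3 * norm (f x))\<^sup>2" by (intro power_mono) auto
        then show "norm ((norm (f x - F i x))\<^sup>2) \<le> 9 * (norm (f x))\<^sup>2" by (simp add: power_mult_distrib)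
      qed
      show "integrable ?M (\<lambda>x. 9 * (norm (f x))\<^sup>2)" using L2_integrable_norm2[OF f] by simp
    qed measurable
    from tendsto_real_sqrt[OF this] show ?thesis by (simp add: norm_L2_def)
  qed
  have sc: "shift_continuous a b (F i)" for i
  proof -
    \<comment> \<open>The value 0 is left out, as its level set may have infinite measure.\<close>
    define R where "R = F i ` einterval a b - {0}"
    define Sy where "Sy y = {x \<in> einterval a b. F i x = y}" for y
    have R: "finite R" using simple_functionD(1)[OF F(1)[of i]] by (simp add: R_def)
    have Sy: "Sy y \<in> sets lebesgue" "Sy y \<subseteq> einterval a b" for y
    proof -
      have "F i -` {y} \<inter> space ?M \<in> sets ?M" by (rule measurable_sets[OF Fm]) simp
      also have "F i -` {y} \<inter> space ?M = Sy y" by (auto simp: Sy_def)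
      finally show "Sy y \<in> sets lebesgue" by (simp add: sets_restrict_space_iff)
    qed (auto simp: Sy_def)
    have fin: "emeasure lebesgue (Sy y) < \<infinity>" if "y \<in> R" for y
    proof -
      have y: "y \<noteq> 0" using that by (simp add: R_def)
      have i: "integrable lebesgue (\<lambda>x. indicator (einterval a b) x *\<^sub>R (norm (F i x))\<^sup>2)"
        using L2_integrable_norm2[OF FL2[of i]] by (simp add: integrable_lebesgue_ab)
      have "integrable lebesgue (\<lambda>x. (norm y)\<^sup>2 * indicator (Sy y) x)"
      proof (rule Bochner_Integration.integrable_bound[OF i])
        show "(\<lambda>x. (norm y)\<^sup>2 * indicator (Sy y) x) \<in> borel_measurable lebesgue"
          using Sy(1) by (intro borel_measurable_times borel_measurable_const borel_measurable_indicator)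
      qed (auto simp: Sy_def indicator_def intro!: AE_I2)
      then have "integrable lebesgue (\<lambda>x. inverse ((norm y)\<^sup>2) * ((norm y)\<^sup>2 * indicator (Sy y) x))"
        by (rule integrable_mult_right)
      then have "integrable lebesgue (indicator (Sy y) :: real \<Rightarrow> real)" using y by simp
      then have "emeasure lebesgue (Sy y \<inter> space lebesgue) < \<infinity>"
        unfolding integrable_indicator_iff by blast
      then show ?thesis by (simp only: space_completion space_lborel space_borel Int_UNIV_right)
    qed
    let ?G = "\<lambda>x. \<Sum>y\<in>R. if x \<in> Sy y then y else 0"
    have G: "shift_continuous a b ?G"
      by (intro shift_continuous_sum shift_continuous_measurable L2_if(1) Sy fin)
    have eq: "?G x = F i x" if x: "x \<in> einterval a b" for x
    proof -
      have "?G x = (\<Sum>y\<in>R. if y = F i x then y else 0)"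
        using x by (intro sum.cong refl) (auto simp: Sy_def)
      also have "\<dots> = F i x" using R x by (auto simp: R_def)
      finally show ?thesis .
    qed
    have "norm_L2 a b (\<lambda>x. shift a b h ?G x - ?G x) = norm_L2 a b (\<lambda>x. shift a b h (F i) x - F i x)" for h
      unfolding norm_L2_def
      by (intro arg_cong[where f = sqrt] Bochner_Integration.integral_cong refl) (simp add: shift_def eq)
    then show ?thesis using G by (simp only: shift_continuous_def)
  qed
  fix \<epsilon> :: real assume "\<epsilon> > 0"
  then obtain N where "\<And>n. n \<ge> N \<Longrightarrow> norm (norm_L2 a b (\<lambda>x. f x - F n x) - 0) < \<epsilon>"
    using LIMSEQ_D[OF lim] by blast
  then have "norm_L2 a b (\<lambda>x. f x - F N x) \<le> \<epsilon>" by (simp add: less_imp_le)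
  then show "\<exists>g\<in>L2 a b. shift_continuous a b g \<and> norm_L2 a b (\<lambda>x. f x - g x) \<le> \<epsilon>"
    using FL2 sc by blast
qed

lemma inner_shift_tendsto:
  fixes f g :: "real \<Rightarrow> complex^'m"
  assumes f: "f \<in> L2 a b" and g: "g \<in> L2 a b" and h: "h \<longlonglongrightarrow> 0"
  shows "(\<lambda>n::nat. inner_L2 a b g (shift a b (h n) f)) \<longlonglongrightarrow> inner_L2 a b g f"
proof (rule Lim_null[THEN iffD2], rule tendsto_0_le[where K = "norm_L2 a b g"])
  show "(\<lambda>n. norm_L2 a b (\<lambda>x. shift a b (h n) f x - f x)) \<longlonglongrightarrow> 0"
    using shift_continuous_L2[OF f] h by (simp add: shift_continuous_def)
  show "\<forall>\<^sub>F n in sequentially. norm (inner_L2 a b g (shift a b (h n) f) - inner_L2 a b g f)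
      \<le> norm (norm_L2 a b (\<lambda>x. shift a b (h n) f x - f x)) * norm_L2 a b g"
    using inner_L2_Cauchy_Schwarz[OF g L2_diff[OF shift_L2(1)[OF f] f]]
    by (intro always_eventually allI) (simp add: inner_L2_diff_right g f shift_L2(1) mult.commute)
qed

text \<open>The sign \<sigma> selects the side on which functions vanish: 1 the left one, as for
  \<open>op_Ha\<close>, and -1 the right one, as for \<open>op_Hb\<close>.\<close>

definition causal :: "ereal \<Rightarrow> ereal \<Rightarrow> real \<Rightarrow> ((real \<Rightarrow> complex^'m) \<Rightarrow> (real \<Rightarrow> complex^'m)) \<Rightarrow> bool" where
  "causal a b \<sigma> A \<longleftrightarrow> (\<forall>c. \<forall>f\<in>L2 a b. (AE x in lebesgue_ab a b. \<sigma> * x < c \<longrightarrow> f x = 0) \<longrightarrow>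
     (AE x in lebesgue_ab a b. \<sigma> * x < c \<longrightarrow> A f x = 0))"

lemma nuclear_rep_shift:
  fixes A :: "(real \<Rightarrow> complex^'m) \<Rightarrow> (real \<Rightarrow> complex^'m)"
  assumes nr: "nuclear_rep a b A w z"
  shows "nuclear_rep a b (\<lambda>f. shift a b h (A f)) w (\<lambda>k. shift a b h (z k))"
  unfolding nuclear_rep_def
proof (intro conjI allI ballI)
  show "(\<lambda>k. norm_L2 a b (w k) * norm_L2 a b (shift a b h (z k))) summable_on UNIV"
    by (rule summable_on_comparison_test[OF nuclear_rep_summable[OF nr]])
      (auto intro!: mult_left_mono shift_L2 nuclear_rep_L2[OF nr])
  fix f g :: "real \<Rightarrow> complex^'m" assume f: "f \<in> L2 a b" and g: "g \<in> L2 a b"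
  show "((\<lambda>k. inner_L2 a b (w k) f * inner_L2 a b g (shift a b h (z k))) has_sum inner_L2 a b g (shift a b h (A f))) UNIV"
    unfolding inner_shift by (rule nuclear_rep_has_sum[OF nr f shift_L2(1)[OF g]])
qed (auto intro!: shift_L2 nuclear_rep_L2[OF nr])

text \<open>
  A causal operator followed by a translation in its direction is strictly triangular in any orthonormal
  basis whose elements live on the cells of a grid of the same mesh, so all its principal minors vanish.
  Letting the translation tend to the identity takes the place of Lidskii's theorem.
\<close>

theorem ext_trace_causal:
  fixes A :: "(real \<Rightarrow> complex^'m) \<Rightarrow> (real \<Rightarrow> complex^'m)"
  assumes nr: "nuclear_rep a b A w z" and causal: "causal a b \<sigma> A" and \<sigma>: "\<sigma> = 1 \<or> \<sigma> = -1" and n: "n > 0"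
  shows "ext_trace a b w z n = 0"
proof -
  note wL2 = nuclear_rep_L2(1)[OF nr] and zL2 = nuclear_rep_L2(2)[OF nr] and AL2 = nuclear_rep_L2(3)[OF nr]
  have zero: "ext_trace a b w (\<lambda>k. shift a b (\<sigma> * h) (z k)) n = 0" if h: "h > 0" for h
  proof -
    \<comment> \<open>The number of the grid cell of width h, counted in the direction of
      causality.\<close>
    define \<pi> where "\<pi> x = \<lfloor>\<sigma> * x / h\<rfloor>" for x
    have "{x. \<pi> x = i} \<in> sets lebesgue" for i
    proof -
      have "(\<lambda>x. \<sigma> * x / h) \<in> borel_measurable borel" by measurable
      then have "{x \<in> space borel. \<lfloor>\<sigma> * x / h\<rfloor> = i} \<in> sets borel" by measurable
      then show ?thesis by (intro sets_completionI_sets) (simp add: \<pi>_def)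
    qed
    then obtain B :: "(real \<Rightarrow> complex^'m) set" where B: "onb_L2 a b B"
      and "\<forall>e\<in>B. \<exists>i. \<forall>x. \<pi> x \<noteq> i \<longrightarrow> e x = 0"
      using exists_localized_onb[of \<pi> a b] by blast
    then obtain cell where cell: "\<And>e x. e \<in> B \<Longrightarrow> \<pi> x \<noteq> cell e \<Longrightarrow> e x = 0" by metis
    have BL2: "e \<in> B \<Longrightarrow> e \<in> L2 a b" for e using B by (auto simp: onb_L2_def)
    \<comment> \<open>e' starts at c or later, hence so does its image, and the translation carries
      it to c + h, past the whole cell of e. Equal cells are included, which is the strictness of
      the triangular form.\<close>
    have tri: "inner_L2 a b e (shift a b (\<sigma> * h) (A e')) = 0" if e: "e \<in> B" "e' \<in> B" and le: "cell e \<le> cell e'" for e e'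
    proof -
      define c where "c = of_int (cell e') * h"
      have "AE x in lebesgue_ab a b. \<sigma> * x < c \<longrightarrow> e' x = 0"
      proof (rule AE_I2, intro impI)
        fix x assume "\<sigma> * x < c"
        then have "\<sigma> * x / h < of_int (cell e')" using h by (simp add: c_def field_simps)
        then have "\<pi> x < cell e'" unfolding \<pi>_def by (simp add: floor_less_iff)
        then show "e' x = 0" using cell[OF e(2)] by auto
      qed
      then have A0: "AE x in lebesgue_ab a b. \<sigma> * x < c \<longrightarrow> A e' x = 0"
        using causal BL2[OF e(2)] unfolding causal_def by blast
      have "AE x in lebesgue_ab a b. hdot (shift a b (- (\<sigma> * h)) e x) (A e' x) = 0"
        using A0
      proof (rule AE_mp, intro AE_I2 impI)
        fix x assume x: "x \<in> space (lebesgue_ab a b)" and 0: "\<sigma> * x < c \<longrightarrow> A e' x = 0"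
        show "hdot (shift a b (- (\<sigma> * h)) e x) (A e' x) = 0"
        proof (cases "\<sigma> * x < c")
          case True
          then show ?thesis using 0 by (simp add: hdot_def)
        next
          case False
          have "\<sigma> * (x + \<sigma> * h) = \<sigma> * x + h" using \<sigma> by (auto simp: algebra_simps)
          moreover have "(of_int (cell e') + 1) * h = c + h" by (simp add: c_def algebra_simps)
          ultimately have "\<sigma> * (x + \<sigma> * h) \<ge> (of_int (cell e') + 1) * h" using False by linarith
          then have "\<sigma> * (x + \<sigma> * h) / h \<ge> of_int (cell e' + 1)" using h by (simp add: field_simps)
          then have "\<pi> (x + \<sigma> * h) \<ge> cell e' + 1" unfolding \<pi>_def by (simp only: le_floor_iff)
          then have "e (x + \<sigma> * h) = 0" using cell[OF e(1)] le by force
          then show ?thesis by (simp add: shift_def hdot_def)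
        qed
      qed
      then show ?thesis unfolding inner_shift unfolding inner_L2_hdot by (rule integral_eq_zero_AE)
    qed
    let ?A = "\<lambda>f. shift a b (\<sigma> * h) (A f)"
    have "minor_op a b ?A I = 0" if I: "I \<subseteq> B" "finite I" "card I = n" for I
      unfolding minor_op_def
    proof (rule sum.neutral, intro ballI)
      fix p assume "p \<in> {p. p permutes I}"
      then have p: "p permutes I" by simp
      have "I \<noteq> {}" using I n by auto
      \<comment> \<open>A basis vector in the lowest cell has a vanishing row in the principal
        submatrix on I.\<close>
      define m where "m = Min (cell ` I)"
      have "m \<in> cell ` I" unfolding m_def using I \<open>I \<noteq> {}\<close> by (intro Min_in) auto
      then obtain e where e: "e \<in> I" "cell e = m" by auto
      have "p e \<in> I" using p e(1) by (simp add: permutes_in_image)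
      then have "m \<le> cell (p e)" unfolding m_def using I by (intro Min_le) auto
      then have "inner_L2 a b e (?A (p e)) = 0" using tri[of e "p e"] e \<open>p e \<in> I\<close> I by auto
      then have "(\<Prod>e\<in>I. inner_L2 a b e (?A (p e))) = 0" using e(1) I by (intro prod_zero) auto
      then show "of_int (sign p) * (\<Prod>e\<in>I. inner_L2 a b e (?A (p e))) = 0" by simp
    qed
    then have "(minor_op a b ?A has_sum 0) {I. I \<subseteq> B \<and> finite I \<and> card I = n}"
      by (intro has_sum_0) auto
    then show ?thesis
      using nuclear_minors(2)[OF nuclear_rep_shift[OF nr] B] has_sum_unique by blast
  qed
  have h: "(\<lambda>m. \<sigma> * (1 / real (Suc m))) \<longlonglongrightarrow> 0"
    using tendsto_mult[OF tendsto_const[of \<sigma>] LIMSEQ_inverse_real_of_nat] unfolding inverse_eq_divide mult_zero_right .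
  have "(\<lambda>m. ext_trace a b w (\<lambda>k. shift a b (\<sigma> * (1 / real (Suc m))) (z k)) n) \<longlonglongrightarrow> ext_trace a b w z n"
    by (rule ext_trace_limit[OF nr]) (rule shift_L2[OF zL2] inner_shift_tendsto[OF zL2 wL2 h])+
  moreover have "ext_trace a b w (\<lambda>k. shift a b (\<sigma> * (1 / real (Suc m))) (z k)) n = 0" for m
    by (rule zero) simp
  ultimately have "(\<lambda>m::nat. 0) \<longlonglongrightarrow> ext_trace a b w z n" by (simp only:)
  then show ?thesis using LIMSEQ_unique tendsto_const by blast
qed

section \<open>Finite rank perturbations of nuclear operators\<close>

lemma minor_fps_const:
  fixes G :: "'i \<Rightarrow> 'i \<Rightarrow> 'a::comm_ring_1"
  shows "minor (\<lambda>i j. fps_const (G i j)) I = fps_const (minor G I)"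
proof -
  have p: "(\<Prod>i\<in>I. fps_const (f i)) = fps_const (\<Prod>i\<in>I. f i)" for f :: "'i \<Rightarrow> 'a"
    by (induction I rule: infinite_finite_induct) auto
  have s: "(\<Sum>i\<in>J. fps_const (f i)) = fps_const (\<Sum>i\<in>J. f i)" for f :: "'p \<Rightarrow> 'a" and J
    by (induction J rule: infinite_finite_induct) auto
  have c: "(of_int m * fps_const x :: 'a fps) = fps_const (of_int m * x)" for m and x :: 'a
    by (metis fps_const_mult fps_of_int)
  show ?thesis unfolding minor_def p c s ..
qed

lemma fps_nth_X_power_const:
  "fps_nth ((- fps_X) ^ k * fps_const (c :: 'a::comm_ring_1)) n = (if n = k then (-1) ^ n * c else 0)"
proof -
  have "(- fps_X) ^ k * fps_const c = fps_const ((-1) ^ k * c) * fps_X ^ k"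
    unfolding uminus_power_if by (simp add: mult.commute flip: fps_const_neg)
  then show ?thesis by (simp only: fps_mult_left_const_nth fps_X_power_nth) simp
qed

text \<open>Comparison of coefficients in \<open>minor_Id_minus\<close>, which holds over any
  commutative ring and thus over power series.\<close>

lemma fps_nth_minor_Id_minus:
  fixes G :: "'i \<Rightarrow> 'i \<Rightarrow> 'a::comm_ring_1"
  assumes "finite S"
  shows "fps_nth (minor (\<lambda>i j. (if i = j then 1 else 0) - fps_X * fps_const (G i j)) S) n
    = (-1) ^ n * (\<Sum>I | I \<subseteq> S \<and> card I = n. minor G I)"
proof -
  have "fps_nth (minor (\<lambda>i j. (if i = j then 1 else 0) - fps_X * fps_const (G i j)) S) n
      = (\<Sum>I\<in>Pow S. if n = card I then (-1) ^ n * minor G I else 0)"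
    unfolding minor_Id_minus[OF assms] minor_fps_const fps_sum_nth fps_nth_X_power_const ..
  also have "\<dots> = (\<Sum>I | I \<subseteq> S \<and> card I = n. (-1) ^ n * minor G I)"
    by (rule sum.mono_neutral_cong_right) (use assms in auto)
  finally show ?thesis by (simp add: sum_distrib_left)
qed

text \<open>Coefficientwise convergence. It respects sums and products whatever the radii of
  convergence, so determinants of power series pass to the limit.\<close>

definition fps_tendsto :: "('x \<Rightarrow> complex fps) \<Rightarrow> complex fps \<Rightarrow> 'x filter \<Rightarrow> bool" where
  "fps_tendsto f g \<F> \<longleftrightarrow> (\<forall>n. ((\<lambda>x. fps_nth (f x) n) \<longlongrightarrow> fps_nth g n) \<F>)"

lemma fps_tendsto_const: "fps_tendsto (\<lambda>_. c) c \<F>"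
  by (simp add: fps_tendsto_def)

lemma fps_tendsto_add: "fps_tendsto f f' \<F> \<Longrightarrow> fps_tendsto g g' \<F> \<Longrightarrow> fps_tendsto (\<lambda>x. f x + g x) (f' + g') \<F>"
  by (auto simp: fps_tendsto_def intro!: tendsto_add)

lemma fps_tendsto_diff: "fps_tendsto f f' \<F> \<Longrightarrow> fps_tendsto g g' \<F> \<Longrightarrow> fps_tendsto (\<lambda>x. f x - g x) (f' - g') \<F>"
  by (auto simp: fps_tendsto_def intro!: tendsto_diff)

lemma fps_tendsto_mult: "fps_tendsto f f' \<F> \<Longrightarrow> fps_tendsto g g' \<F> \<Longrightarrow> fps_tendsto (\<lambda>x. f x * g x) (f' * g') \<F>"
  by (auto simp: fps_tendsto_def fps_mult_nth intro!: tendsto_sum tendsto_mult)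

lemma fps_tendsto_sum: "(\<And>i. i \<in> I \<Longrightarrow> fps_tendsto (f i) (f' i) \<F>) \<Longrightarrow> fps_tendsto (\<lambda>x. \<Sum>i\<in>I. f i x) (\<Sum>i\<in>I. f' i) \<F>"
  by (induction I rule: infinite_finite_induct) (auto intro: fps_tendsto_const fps_tendsto_add)

lemma fps_tendsto_prod: "(\<And>i. i \<in> I \<Longrightarrow> fps_tendsto (f i) (f' i) \<F>) \<Longrightarrow> fps_tendsto (\<lambda>x. \<Prod>i\<in>I. f i x) (\<Prod>i\<in>I. f' i) \<F>"
  by (induction I rule: infinite_finite_induct) (auto intro: fps_tendsto_const fps_tendsto_mult)

lemma fps_tendsto_minor:
  assumes "\<And>i j. fps_tendsto (\<lambda>x. M x i j) (N i j) \<F>"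
  shows "fps_tendsto (\<lambda>x. minor (M x) I) (minor N I) \<F>"
  unfolding minor_def by (intro fps_tendsto_sum fps_tendsto_mult fps_tendsto_const fps_tendsto_prod assms)

lemma fps_tendsto_unique:
  "fps_tendsto f g \<F> \<Longrightarrow> fps_tendsto f h \<F> \<Longrightarrow> \<F> \<noteq> bot \<Longrightarrow> g = h"
  by (auto simp: fps_tendsto_def fps_eq_iff intro: tendsto_unique)

text \<open>Every finite family of n-element index sets is eventually contained in a section, so the
  summed minors of the sections converge to the full sum. The map g allows for sections enlarged by
  a fixed finite set.\<close>

lemma tendsto_sum_minors:
  fixes G :: "'i \<Rightarrow> 'i \<Rightarrow> complex" and g :: "'k set \<Rightarrow> 'i set"
  assumes sum: "(minor G has_sum c) {I. finite I \<and> card I = n}"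
    and fin: "\<And>F. finite F \<Longrightarrow> finite (g F)" and mono: "\<And>F F'. F \<subseteq> F' \<Longrightarrow> g F \<subseteq> g F'"
    and cover: "\<And>i. \<exists>F. finite F \<and> i \<in> g F"
  shows "((\<lambda>F. \<Sum>I | I \<subseteq> g F \<and> card I = n. minor G I) \<longlongrightarrow> c) (finite_subsets_at_top UNIV)"
proof -
  have "filterlim (\<lambda>F. {I. I \<subseteq> g F \<and> card I = n}) (finite_subsets_at_top {I. finite I \<and> card I = n}) (finite_subsets_at_top UNIV)"
    unfolding filterlim_finite_subsets_at_top
  proof (intro allI impI)
    fix X :: "'i set set" assume X: "finite X \<and> X \<subseteq> {I. finite I \<and> card I = n}"
    obtain h where h: "\<And>i. finite (h i) \<and> i \<in> g (h i)" using cover by metis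
    define F0 where "F0 = (\<Union>i\<in>\<Union>X. h i)"
    have F0: "finite F0" unfolding F0_def using X h by (intro finite_UN_I) auto
    have X0: "\<Union>X \<subseteq> g F0"
    proof
      fix i assume i: "i \<in> \<Union>X"
      then have "h i \<subseteq> F0" by (auto simp: F0_def)
      then show "i \<in> g F0" using h mono by blast
    qed
    show "\<forall>\<^sub>F F in finite_subsets_at_top UNIV. finite {I. I \<subseteq> g F \<and> card I = n} \<and>
        X \<subseteq> {I. I \<subseteq> g F \<and> card I = n} \<and> {I. I \<subseteq> g F \<and> card I = n} \<subseteq> {I. finite I \<and> card I = n}"
      unfolding eventually_finite_subsets_at_top
    proof (intro exI[of _ F0] conjI allI impI F0)
      fix F assume F: "finite F \<and> F0 \<subseteq> F \<and> F \<subseteq> UNIV"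
      have gF: "finite (g F)" "\<Union>X \<subseteq> g F" using fin F X0 mono[of F0 F] by auto
      show "finite {I. I \<subseteq> g F \<and> card I = n}" by (rule finite_subset[of _ "Pow (g F)"]) (use gF in auto)
      show "X \<subseteq> {I. I \<subseteq> g F \<and> card I = n}" using gF(2) X by auto
      show "{I. I \<subseteq> g F \<and> card I = n} \<subseteq> {I. finite I \<and> card I = n}"
        using gF(1) finite_subset by auto
    qed simp
  qed
  from filterlim_compose[OF sum[unfolded has_sum_def] this] show ?thesis .
qed

definition truncated_op ::
  "ereal \<Rightarrow> ereal \<Rightarrow> ('k \<Rightarrow> real \<Rightarrow> complex^'m) \<Rightarrow> ('k \<Rightarrow> real \<Rightarrow> complex^'m) \<Rightarrow> 'k set \<Rightarrow>
     (real \<Rightarrow> complex^'m) \<Rightarrow> (real \<Rightarrow> complex^'m)" where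
  "truncated_op a b w z F f = (\<lambda>x. \<Sum>k\<in>F. inner_L2 a b (w k) f *s z k x)"

lemma truncated_op_L2: "(\<And>k. z k \<in> L2 a b) \<Longrightarrow> truncated_op a b w z F f \<in> L2 a b"
  unfolding truncated_op_def by (intro L2_sum L2_smult)

lemma inner_truncated_op:
  assumes "\<And>k. z k \<in> L2 a b" "v \<in> L2 a b"
  shows "inner_L2 a b v (truncated_op a b w z F f) = (\<Sum>k\<in>F. inner_L2 a b v (z k) * inner_L2 a b (w k) f)"
  unfolding truncated_op_def
  by (subst inner_L2_sum_right) (auto intro!: L2_smult assms simp: inner_L2_smult_right mult.commute)

text \<open>Strong convergence of the sections and their uniform bound C pass to powers by
  induction: the difference of the powers l + 1 is split by applying the truncated operator to the
  l-th iterate of A.\<close>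

lemma truncated_op_iterate_tendsto:
  fixes A :: "(real \<Rightarrow> complex^'m) \<Rightarrow> (real \<Rightarrow> complex^'m)" and w z :: "'k \<Rightarrow> real \<Rightarrow> complex^'m"
  assumes nr: "nuclear_rep a b A w z" and s: "s \<in> L2 a b"
  shows "((\<lambda>F. norm_L2 a b (\<lambda>x. (truncated_op a b w z F ^^ l) s x - (A ^^ l) s x)) \<longlongrightarrow> 0) (finite_subsets_at_top UNIV)"
proof (induction l)
  case (Suc l)
  note wL2 = nuclear_rep_L2(1)[OF nr] and zL2 = nuclear_rep_L2(2)[OF nr] and AL2 = nuclear_rep_L2(3)[OF nr]
  let ?T = "truncated_op a b w z"
  let ?N = "\<lambda>k. norm_L2 a b (w k) * norm_L2 a b (z k)"
  define C where "C = infsum ?N UNIV"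
  have N: "(?N has_sum C) UNIV" using nuclear_rep_summable[OF nr] by (simp add: C_def)
  have TL2: "?T F f \<in> L2 a b" for F f by (rule truncated_op_L2[OF zL2])
  have TlL2: "(?T F ^^ j) s \<in> L2 a b" for F j by (cases j) (auto simp: s TL2)
  define v where "v = (A ^^ l) s"
  have v: "v \<in> L2 a b" unfolding v_def by (induction l) (auto simp: s AL2)
  have Tbound: "norm_L2 a b (?T F f) \<le> C * norm_L2 a b f" if F: "finite F" and f: "f \<in> L2 a b" for F f
  proof -
    have "norm_L2 a b (?T F f) \<le> (\<Sum>k\<in>F. norm_L2 a b (\<lambda>x. inner_L2 a b (w k) f *s z k x))"
      unfolding truncated_op_def by (intro norm_L2_sum_le L2_smult zL2)
    also have "\<dots> \<le> (\<Sum>k\<in>F. ?N k * norm_L2 a b f)"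
    proof (rule sum_mono)
      fix k
      have "cmod (inner_L2 a b (w k) f) * norm_L2 a b (z k) \<le> (norm_L2 a b (w k) * norm_L2 a b f) * norm_L2 a b (z k)"
        by (intro mult_right_mono inner_L2_Cauchy_Schwarz wL2 f) simp
      then show "norm_L2 a b (\<lambda>x. inner_L2 a b (w k) f *s z k x) \<le> ?N k * norm_L2 a b f"
        by (simp add: norm_L2_smult mult_ac)
    qed
    also have "\<dots> = (\<Sum>k\<in>F. ?N k) * norm_L2 a b f" by (simp add: sum_distrib_right)
    also have "\<dots> \<le> C * norm_L2 a b f"
      unfolding C_def by (intro mult_right_mono finite_sum_le_infsum nuclear_rep_summable[OF nr] F) auto
    finally show ?thesis .
  qed
  have Tdiff: "(\<lambda>x. ?T F f x - ?T F g x) = ?T F (\<lambda>x. f x - g x)" if "f \<in> L2 a b" "g \<in> L2 a b" for F f g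
    unfolding truncated_op_def
    by (simp add: inner_L2_diff_right wL2 that sum_subtractf vector_sub_rdistrib)
  \<comment> \<open>The error d is tested against itself: its squared norm is a tail of the nuclear
    series, bounded by the tail of the sum of norms.\<close>
  have Aclose: "norm_L2 a b (\<lambda>x. ?T F v x - A v x) \<le> (C - sum ?N F) * norm_L2 a b v" if F: "finite F" for F
  proof -
    define d where "d = (\<lambda>x. ?T F v x - A v x)"
    have d: "d \<in> L2 a b" unfolding d_def by (intro L2_diff TL2 AL2 v)
    let ?h = "\<lambda>k. inner_L2 a b (w k) v * inner_L2 a b d (z k)"
    have hs: "(?h has_sum (inner_L2 a b d (A v) - sum ?h F)) (UNIV - F)"
      using has_sum_Diff[OF nuclear_rep_has_sum[OF nr v d] has_sum_finite[OF F]] by simp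
    have ns: "((\<lambda>k. norm_L2 a b v * norm_L2 a b d * ?N k) has_sum (norm_L2 a b v * norm_L2 a b d * (C - sum ?N F))) (UNIV - F)"
      using has_sum_cmult_right[OF has_sum_Diff[OF N has_sum_finite[OF F]]] by simp
    have hb: "norm (?h k) \<le> norm_L2 a b v * norm_L2 a b d * ?N k" for k
    proof -
      have "cmod (inner_L2 a b (w k) v) * cmod (inner_L2 a b d (z k)) \<le> (norm_L2 a b (w k) * norm_L2 a b v) * (norm_L2 a b d * norm_L2 a b (z k))"
        by (intro mult_mono inner_L2_Cauchy_Schwarz wL2 zL2 v d) auto
      then show ?thesis by (simp add: norm_mult mult_ac)
    qed
    have "inner_L2 a b d (\<lambda>x. ?T F v x - A v x) = - (inner_L2 a b d (A v) - sum ?h F)"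
      unfolding inner_L2_diff_right[OF d TL2 AL2[OF v]] inner_truncated_op[OF zL2 d] by (simp add: mult.commute)
    then have "inner_L2 a b d d = - (inner_L2 a b d (A v) - sum ?h F)" by (simp only: d_def[symmetric])
    then have "cmod (inner_L2 a b d d) = cmod (inner_L2 a b d (A v) - sum ?h F)" by (simp only: norm_minus_cancel)
    also have "\<dots> \<le> norm_L2 a b v * norm_L2 a b d * (C - sum ?N F)"
      using norm_infsum_le[OF hs ns hb] .
    finally have "norm_L2 a b d * norm_L2 a b d \<le> norm_L2 a b d * ((C - sum ?N F) * norm_L2 a b v)"
      unfolding inner_L2_self by (simp add: power2_eq_square mult_ac norm_mult)
    moreover have "sum ?N F \<le> C" unfolding C_def
      by (intro finite_sum_le_infsum nuclear_rep_summable[OF nr] F) auto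
    ultimately show ?thesis unfolding d_def[symmetric]
      by (cases "norm_L2 a b d = 0") (auto simp: mult_le_cancel_left less_le)
  qed
  have lim: "((\<lambda>F. C * norm_L2 a b (\<lambda>x. (?T F ^^ l) s x - v x) + (C - sum ?N F) * norm_L2 a b v) \<longlongrightarrow> C * 0 + (C - C) * norm_L2 a b v)
      (finite_subsets_at_top UNIV)"
    using N Suc.IH unfolding has_sum_def v_def by (intro tendsto_intros)
  show ?case
  proof (rule Lim_null_comparison)
    show "((\<lambda>F. C * norm_L2 a b (\<lambda>x. (?T F ^^ l) s x - v x) + (C - sum ?N F) * norm_L2 a b v) \<longlongrightarrow> 0) (finite_subsets_at_top UNIV)"
      using lim by simp
    show "\<forall>\<^sub>F F in finite_subsets_at_top UNIV. norm (norm_L2 a b (\<lambda>x. (?T F ^^ Suc l) s x - (A ^^ Suc l) s x))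
        \<le> C * norm_L2 a b (\<lambda>x. (?T F ^^ l) s x - v x) + (C - sum ?N F) * norm_L2 a b v"
    proof (rule eventually_finite_subsets_at_top_weakI)
      fix F :: "'k set" assume F: "finite F"
      have "norm_L2 a b (\<lambda>x. ?T F ((?T F ^^ l) s) x - A v x)
          \<le> norm_L2 a b (\<lambda>x. ?T F ((?T F ^^ l) s) x - ?T F v x) + norm_L2 a b (\<lambda>x. ?T F v x - A v x)"
        by (intro norm_L2_diff_triangle TL2 AL2 v)
      also have "norm_L2 a b (\<lambda>x. ?T F ((?T F ^^ l) s) x - ?T F v x) \<le> C * norm_L2 a b (\<lambda>x. (?T F ^^ l) s x - v x)"
        unfolding Tdiff[OF TlL2 v] by (intro Tbound[OF F] L2_diff TlL2 v)
      finally show "norm (norm_L2 a b (\<lambda>x. (?T F ^^ Suc l) s x - (A ^^ Suc l) s x))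
          \<le> C * norm_L2 a b (\<lambda>x. (?T F ^^ l) s x - v x) + (C - sum ?N F) * norm_L2 a b v"
        using Aclose[OF F] by (simp add: v_def)
    qed
  qed
qed simp

text \<open>Block elimination by right multiplication with the unit triangular matrix E that has Y
  as its off-diagonal block. The hypothesis says M11 Y = - M12, so the product is block lower
  triangular; Y takes the place of an explicit inverse of M11.\<close>

lemma minor_sum_type:
  fixes M :: "('k + 'r) \<Rightarrow> ('k + 'r) \<Rightarrow> complex fps" and Y :: "'k \<Rightarrow> 'r \<Rightarrow> complex fps"
  assumes F: "finite F" and R: "finite R"
    and elim: "\<And>k r. k \<in> F \<Longrightarrow> r \<in> R \<Longrightarrow> M (Inl k) (Inr r) + (\<Sum>l\<in>F. M (Inl k) (Inl l) * Y l r) = 0"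
  shows "minor M (Inl ` F \<union> Inr ` R) = minor (\<lambda>k l. M (Inl k) (Inl l)) F *
    minor (\<lambda>i r. M (Inr i) (Inr r) + (\<Sum>l\<in>F. M (Inr i) (Inl l) * Y l r)) R"
proof -
  let ?S = "Inl ` F :: ('k + 'r) set" and ?T = "Inr ` R :: ('k + 'r) set"
  define E :: "('k + 'r) \<Rightarrow> ('k + 'r) \<Rightarrow> complex fps" where
    "E i j = (case (i, j) of (Inl k, Inr r) \<Rightarrow> Y k r | _ \<Rightarrow> if i = j then 1 else 0)" for i j
  have fin: "finite ?S" "finite ?T" "?S \<inter> ?T = {}" using F R by auto
  have "minor E (?T \<union> ?S) = minor E ?T * minor E ?S"
    by (rule minor_block) (use fin in \<open>auto simp: E_def\<close>)
  also have "minor E ?T = minor (\<lambda>i j. if i = j then 1 else 0) ?T"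
    by (rule minor_cong) (auto simp: E_def)
  also have "minor E ?S = minor (\<lambda>i j. if i = j then 1 else 0) ?S"
    by (rule minor_cong) (auto simp: E_def)
  finally have E1: "minor E (?S \<union> ?T) = 1" using fin by (simp add: minor_Id Un_commute)
  define N where "N i j = (\<Sum>k\<in>?S \<union> ?T. M i k * E k j)" for i j
  have split: "N i j = (\<Sum>k\<in>F. M i (Inl k) * E (Inl k) j) + (\<Sum>r\<in>R. M i (Inr r) * E (Inr r) j)" for i j
    unfolding N_def using fin by (simp add: sum.union_disjoint sum.reindex)
  have NInl: "N i (Inl l) = M i (Inl l)" if "l \<in> F" for i l
  proof -
    have "(\<Sum>k\<in>F. M i (Inl k) * E (Inl k) (Inl l)) = (\<Sum>k\<in>F. if k = l then M i (Inl l) else 0)"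
      by (intro sum.cong) (auto simp: E_def)
    also have "\<dots> = M i (Inl l)" using F that by simp
    finally show ?thesis unfolding split by (simp add: E_def)
  qed
  have NInr: "N i (Inr r) = M i (Inr r) + (\<Sum>l\<in>F. M i (Inl l) * Y l r)" if "r \<in> R" for i r
  proof -
    have "(\<Sum>k\<in>R. M i (Inr k) * E (Inr k) (Inr r)) = (\<Sum>k\<in>R. if k = r then M i (Inr r) else 0)"
      by (intro sum.cong) (auto simp: E_def)
    also have "\<dots> = M i (Inr r)" using R that by simp
    finally show ?thesis unfolding split by (simp add: E_def)
  qed
  have "minor M (?S \<union> ?T) = minor M (?S \<union> ?T) * minor E (?S \<union> ?T)" by (simp add: E1)
  also have "\<dots> = minor N (?S \<union> ?T)"
    unfolding N_def by (rule minor_mult[symmetric]) (use fin in \<open>auto simp: fps_eq_iff numeral_fps_const intro!: exI[of _ 0]\<close>)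
  also have "\<dots> = minor N ?S * minor N ?T"
    by (rule minor_block) (use fin NInr elim in auto)
  also have "minor N ?S = minor (\<lambda>k l. M (Inl k) (Inl l)) F"
    unfolding minor_reindex[OF inj_Inl F] by (rule minor_cong) (simp add: NInl)
  also have "minor N ?T = minor (\<lambda>i r. M (Inr i) (Inr r) + (\<Sum>l\<in>F. M (Inr i) (Inl l) * Y l r)) R"
    unfolding minor_reindex[OF inj_Inr R] by (rule minor_cong) (simp add: NInr)
  finally show ?thesis .
qed

text \<open>The left side is the scalar product of v with (1 - X T)^-1 s, written as a Neumann
  series; the identity is the resolvent equation, that is, a shift of the index by one.\<close>

lemma truncated_op_generating:
  assumes zL2: "\<And>k. z k \<in> L2 a b" and v: "v \<in> L2 a b"
  shows "Abs_fps (\<lambda>l. inner_L2 a b v ((truncated_op a b w z F ^^ l) s)) = fps_const (inner_L2 a b v s)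
    + fps_X * (\<Sum>k\<in>F. fps_const (inner_L2 a b v (z k)) * Abs_fps (\<lambda>l. inner_L2 a b (w k) ((truncated_op a b w z F ^^ l) s)))"
proof (rule fps_ext)
  fix n
  show "fps_nth (Abs_fps (\<lambda>l. inner_L2 a b v ((truncated_op a b w z F ^^ l) s))) n = fps_nth (fps_const (inner_L2 a b v s)
    + fps_X * (\<Sum>k\<in>F. fps_const (inner_L2 a b v (z k)) * Abs_fps (\<lambda>l. inner_L2 a b (w k) ((truncated_op a b w z F ^^ l) s)))) n"
    by (cases n) (simp_all add: fps_sum_nth inner_truncated_op[OF zL2 v])
qed

text \<open>
  The Schur complement formula for \<open>K = A + \<Sum>\<^sub>i \<langle>t\<^sub>i, \<cdot>\<rangle> s\<^sub>i\<close>, as an identity of formal power series in the spectral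
  parameter: \<open>det (I - X K) = det (I - X A) det\<^sub>r (1 - X T (I - X A)\<^sup>-\<^sup>1 S)\<close>. It is obtained from the
  finite sections of the Gram matrices.
\<close>

theorem ext_trace_finite_rank:
  fixes A :: "(real \<Rightarrow> complex^'m) \<Rightarrow> (real \<Rightarrow> complex^'m)" and s t :: "'r::finite \<Rightarrow> real \<Rightarrow> complex^'m"
    and w z :: "'k \<Rightarrow> real \<Rightarrow> complex^'m"
  assumes nr: "nuclear_rep a b A w z" and nrK: "nuclear_rep a b K (case_sum w t) (case_sum z s)"
  shows "Abs_fps (\<lambda>n. (-1) ^ n * ext_trace a b (case_sum w t) (case_sum z s) n)
    = Abs_fps (\<lambda>n. (-1) ^ n * ext_trace a b w z n)
      * minor (\<lambda>i j. (if i = j then 1 else 0) - fps_X * Abs_fps (\<lambda>l. inner_L2 a b (t i) ((A ^^ l) (s j)))) UNIV"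
proof -
  note wL2 = nuclear_rep_L2(1)[OF nr] and zL2 = nuclear_rep_L2(2)[OF nr] and AL2 = nuclear_rep_L2(3)[OF nr]
  have tL2: "t i \<in> L2 a b" and sL2: "s i \<in> L2 a b" for i
    using nuclear_rep_L2(1,2)[OF nrK, of "Inr i"] by auto
  define G where "G = gram a b (case_sum w t) (case_sum z s)"
  let ?T = "truncated_op a b w z"
  let ?g = "\<lambda>F :: 'k set. Inl ` F \<union> Inr ` (UNIV :: 'r set)"
  \<comment> \<open>Minus the inverse of the upper left block times the upper right block, written
    as a Neumann series of the truncated operator.\<close>
  define Y where "Y F k r = fps_X * Abs_fps (\<lambda>l. inner_L2 a b (w k) ((?T F ^^ l) (s r)))" for F k r
  define M where "M i j = (if i = j then 1 else 0) - fps_X * fps_const (G i j)" for i j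
  define P where "P F = minor (\<lambda>k l. (if k = l then 1 else 0) - fps_X * fps_const (gram a b w z k l)) F" for F
  define Q where "Q F = minor (\<lambda>i j. (if i = j then 1 else 0) - fps_X * Abs_fps (\<lambda>l. inner_L2 a b (t i) ((?T F ^^ l) (s j)))) (UNIV :: 'r set)" for F
  have finsec: "minor M (?g F) = P F * Q F" if F: "finite F" for F
  proof -
    have Ysum: "(\<Sum>l\<in>F. fps_X * fps_const (inner_L2 a b v (z l)) * Y F l r)
        = fps_X * (Abs_fps (\<lambda>l. inner_L2 a b v ((?T F ^^ l) (s r))) - fps_const (inner_L2 a b v (s r)))"
      if v: "v \<in> L2 a b" for v r
      unfolding truncated_op_generating[OF zL2 v] Y_def by (simp add: sum_distrib_left mult_ac)
    have "minor M (?g F) = minor (\<lambda>k l. M (Inl k) (Inl l)) F *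
        minor (\<lambda>i r. M (Inr i) (Inr r) + (\<Sum>l\<in>F. M (Inr i) (Inl l) * Y F l r)) UNIV"
    proof (rule minor_sum_type[OF F finite])
      fix k :: 'k and r :: 'r assume k: "k \<in> F"
      have "(\<Sum>l\<in>F. M (Inl k) (Inl l) * Y F l r)
          = (\<Sum>l\<in>F. (if k = l then Y F l r else 0) - fps_X * fps_const (inner_L2 a b (w k) (z l)) * Y F l r)"
        by (intro sum.cong refl) (simp add: M_def G_def gram_def algebra_simps)
      also have "\<dots> = Y F k r - fps_X * (Abs_fps (\<lambda>l. inner_L2 a b (w k) ((?T F ^^ l) (s r))) - fps_const (inner_L2 a b (w k) (s r)))"
        using F k by (simp add: sum_subtractf Ysum[OF wL2])
      finally show "M (Inl k) (Inr r) + (\<Sum>l\<in>F. M (Inl k) (Inl l) * Y F l r) = 0"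
        by (simp add: M_def G_def gram_def Y_def algebra_simps)
    qed
    also have "minor (\<lambda>k l. M (Inl k) (Inl l)) F = P F"
      unfolding P_def by (rule minor_cong) (simp add: M_def G_def gram_def)
    also have "minor (\<lambda>i r. M (Inr i) (Inr r) + (\<Sum>l\<in>F. M (Inr i) (Inl l) * Y F l r)) UNIV = Q F"
      unfolding Q_def
    proof (rule minor_cong)
      fix i r
      have "(\<Sum>l\<in>F. M (Inr i) (Inl l) * Y F l r) = - (\<Sum>l\<in>F. fps_X * fps_const (inner_L2 a b (t i) (z l)) * Y F l r)"
        by (simp add: M_def G_def gram_def sum_negf)
      then show "M (Inr i) (Inr r) + (\<Sum>l\<in>F. M (Inr i) (Inl l) * Y F l r)
          = (if i = r then 1 else 0) - fps_X * Abs_fps (\<lambda>l. inner_L2 a b (t i) ((?T F ^^ l) (s r)))"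
        unfolding Ysum[OF tL2] by (simp add: M_def G_def gram_def algebra_simps)
    qed
    finally show ?thesis .
  qed
  have limK: "fps_tendsto (\<lambda>F. minor M (?g F)) (Abs_fps (\<lambda>n. (-1) ^ n * ext_trace a b (case_sum w t) (case_sum z s) n)) (finite_subsets_at_top UNIV)"
    unfolding fps_tendsto_def
  proof
    fix n
    have "((\<lambda>F. (-1) ^ n * (\<Sum>I | I \<subseteq> ?g F \<and> card I = n. minor G I)) \<longlongrightarrow> (-1) ^ n * ext_trace a b (case_sum w t) (case_sum z s) n) (finite_subsets_at_top UNIV)"
    proof (intro tendsto_mult tendsto_const tendsto_sum_minors)
      show "(minor G has_sum ext_trace a b (case_sum w t) (case_sum z s) n) {I. finite I \<and> card I = n}"
        unfolding G_def by (rule nuclear_minors(1)[OF nrK])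
      show "\<exists>F. finite F \<and> i \<in> ?g F" for i :: "'k + 'r"
        by (cases i) (auto intro: exI[of _ "{_}"])
    qed auto
    moreover have "\<forall>\<^sub>F F in finite_subsets_at_top UNIV. (-1) ^ n * (\<Sum>I | I \<subseteq> ?g F \<and> card I = n. minor G I) = fps_nth (minor M (?g F)) n"
      unfolding M_def[abs_def]
      by (rule eventually_finite_subsets_at_top_weakI, rule fps_nth_minor_Id_minus[symmetric]) auto
    ultimately have "((\<lambda>F. fps_nth (minor M (?g F)) n) \<longlongrightarrow> (-1) ^ n * ext_trace a b (case_sum w t) (case_sum z s) n) (finite_subsets_at_top UNIV)"
      by (rule Lim_transform_eventually)
    then show "((\<lambda>F. fps_nth (minor M (?g F)) n) \<longlongrightarrow> fps_nth (Abs_fps (\<lambda>n. (-1) ^ n * ext_trace a b (case_sum w t) (case_sum z s) n)) n) (finite_subsets_at_top UNIV)"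
      by simp
  qed
  have limP: "fps_tendsto P (Abs_fps (\<lambda>n. (-1) ^ n * ext_trace a b w z n)) (finite_subsets_at_top UNIV)"
    unfolding fps_tendsto_def
  proof
    fix n
    have "((\<lambda>F. (-1) ^ n * (\<Sum>I | I \<subseteq> F \<and> card I = n. minor (gram a b w z) I)) \<longlongrightarrow> (-1) ^ n * ext_trace a b w z n) (finite_subsets_at_top UNIV)"
      by (intro tendsto_mult tendsto_const tendsto_sum_minors nuclear_minors(1)[OF nr]) (auto intro: exI[of _ "{_}"])
    moreover have "\<forall>\<^sub>F F in finite_subsets_at_top UNIV. (-1) ^ n * (\<Sum>I | I \<subseteq> F \<and> card I = n. minor (gram a b w z) I) = fps_nth (P F) n"
      unfolding P_def
      by (rule eventually_finite_subsets_at_top_weakI, rule fps_nth_minor_Id_minus[symmetric])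
    ultimately have "((\<lambda>F. fps_nth (P F) n) \<longlongrightarrow> (-1) ^ n * ext_trace a b w z n) (finite_subsets_at_top UNIV)"
      by (rule Lim_transform_eventually)
    then show "((\<lambda>F. fps_nth (P F) n) \<longlongrightarrow> fps_nth (Abs_fps (\<lambda>n. (-1) ^ n * ext_trace a b w z n)) n) (finite_subsets_at_top UNIV)"
      by simp
  qed
  have limQ: "fps_tendsto Q (minor (\<lambda>i j. (if i = j then 1 else 0) - fps_X * Abs_fps (\<lambda>l. inner_L2 a b (t i) ((A ^^ l) (s j)))) UNIV) (finite_subsets_at_top UNIV)"
    unfolding Q_def[abs_def]
  proof (intro fps_tendsto_minor fps_tendsto_diff fps_tendsto_mult fps_tendsto_const)
    fix i j
    show "fps_tendsto (\<lambda>F. Abs_fps (\<lambda>l. inner_L2 a b (t i) ((?T F ^^ l) (s j)))) (Abs_fps (\<lambda>l. inner_L2 a b (t i) ((A ^^ l) (s j)))) (finite_subsets_at_top UNIV)"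
      unfolding fps_tendsto_def
    proof
      fix l
      have v: "(A ^^ l) (s j) \<in> L2 a b" by (induction l) (auto simp: sL2 AL2)
      have Tl: "(?T F ^^ l) (s j) \<in> L2 a b" for F by (cases l) (auto simp: sL2 truncated_op_L2[OF zL2])
      have "((\<lambda>F. inner_L2 a b (t i) ((?T F ^^ l) (s j))) \<longlongrightarrow> inner_L2 a b (t i) ((A ^^ l) (s j))) (finite_subsets_at_top UNIV)"
      proof (rule Lim_null[THEN iffD2], rule tendsto_0_le[where K = "norm_L2 a b (t i)"])
        show "((\<lambda>F. norm_L2 a b (\<lambda>x. (?T F ^^ l) (s j) x - (A ^^ l) (s j) x)) \<longlongrightarrow> 0) (finite_subsets_at_top UNIV)"
          by (rule truncated_op_iterate_tendsto[OF nr sL2])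
        show "\<forall>\<^sub>F F in finite_subsets_at_top UNIV. norm (inner_L2 a b (t i) ((?T F ^^ l) (s j)) - inner_L2 a b (t i) ((A ^^ l) (s j)))
            \<le> norm (norm_L2 a b (\<lambda>x. (?T F ^^ l) (s j) x - (A ^^ l) (s j) x)) * norm_L2 a b (t i)"
          using inner_L2_Cauchy_Schwarz[OF tL2 L2_diff[OF Tl v]]
          by (intro always_eventually allI) (simp add: inner_L2_diff_right tL2 Tl v mult.commute)
      qed
      then show "((\<lambda>F. fps_nth (Abs_fps (\<lambda>l. inner_L2 a b (t i) ((?T F ^^ l) (s j)))) l) \<longlongrightarrow> fps_nth (Abs_fps (\<lambda>l. inner_L2 a b (t i) ((A ^^ l) (s j)))) l) (finite_subsets_at_top UNIV)"
        by simp
    qed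
  qed
  have "fps_tendsto (\<lambda>F. minor M (?g F)) (Abs_fps (\<lambda>n. (-1) ^ n * ext_trace a b w z n) *
      minor (\<lambda>i j. (if i = j then 1 else 0) - fps_X * Abs_fps (\<lambda>l. inner_L2 a b (t i) ((A ^^ l) (s j)))) UNIV) (finite_subsets_at_top UNIV)"
    unfolding fps_tendsto_def
  proof
    fix n
    have ev: "\<forall>\<^sub>F F in finite_subsets_at_top UNIV. fps_nth (P F * Q F) n = fps_nth (minor M (?g F)) n"
      by (rule eventually_finite_subsets_at_top_weakI) (simp add: finsec)
    show "((\<lambda>F. fps_nth (minor M (?g F)) n) \<longlongrightarrow> fps_nth (Abs_fps (\<lambda>n. (-1) ^ n * ext_trace a b w z n) *
      minor (\<lambda>i j. (if i = j then 1 else 0) - fps_X * Abs_fps (\<lambda>l. inner_L2 a b (t i) ((A ^^ l) (s j)))) UNIV) n) (finite_subsets_at_top UNIV)"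
      by (rule Lim_transform_eventually[OF fps_tendsto_mult[OF limP limQ, unfolded fps_tendsto_def, rule_format] ev])
  qed
  then show ?thesis by (rule fps_tendsto_unique[OF limK]) simp
qed

lemma has_sum_sum_type:
  fixes h :: "'k + 'r \<Rightarrow> 'v::{topological_comm_monoid_add,t2_space}"
  assumes "((\<lambda>k. h (Inl k)) has_sum c) UNIV" "((\<lambda>r. h (Inr r)) has_sum d) UNIV"
  shows "(h has_sum (c + d)) UNIV"
proof -
  have "(h has_sum c) (range Inl)" "(h has_sum d) (range Inr)"
    using assms has_sum_reindex[of Inl UNIV h c] has_sum_reindex[of Inr UNIV h d] by (simp_all add: o_def)
  then have "(h has_sum (c + d)) (range Inl \<union> range Inr)" by (rule has_sum_Un_disjoint) auto
  then show ?thesis by (simp add: UNIV_sum)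
qed

text \<open>The finite rank terms are appended as extra indices, which only adds finitely many
  summands. With the sign of s reversed the same statement removes such terms again.\<close>

lemma nuclear_rep_finite_rank:
  fixes A K :: "(real \<Rightarrow> complex^'m) \<Rightarrow> (real \<Rightarrow> complex^'m)" and s t :: "'r::finite \<Rightarrow> real \<Rightarrow> complex^'m"
    and w z :: "'k \<Rightarrow> real \<Rightarrow> complex^'m"
  assumes nr: "nuclear_rep a b A w z" and st: "\<And>i. s i \<in> L2 a b" "\<And>i. t i \<in> L2 a b"
    and KL2: "\<And>f. f \<in> L2 a b \<Longrightarrow> K f \<in> L2 a b"
    and K: "\<And>f. f \<in> L2 a b \<Longrightarrow> eq_L2 a b (K f) (\<lambda>x. A f x + (\<Sum>i\<in>UNIV. inner_L2 a b (t i) f *s s i x))"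
  shows "nuclear_rep a b K (case_sum w t) (case_sum z s)"
  unfolding nuclear_rep_def
proof (intro conjI allI ballI KL2)
  show "case_sum w t k \<in> L2 a b" "case_sum z s k \<in> L2 a b" for k
    using st nuclear_rep_L2[OF nr] by (auto split: sum.split)
  show "(\<lambda>k. norm_L2 a b (case_sum w t k) * norm_L2 a b (case_sum z s k)) summable_on UNIV"
    unfolding summable_on_def
    by (rule exI, rule has_sum_sum_type) (use nuclear_rep_summable[OF nr] in \<open>auto intro: has_sum_infsum has_sum_finite\<close>)
  fix f g :: "real \<Rightarrow> complex^'m" assume f: "f \<in> L2 a b" and g: "g \<in> L2 a b"
  have "inner_L2 a b g (K f) = inner_L2 a b g (\<lambda>x. A f x + (\<Sum>i\<in>UNIV. inner_L2 a b (t i) f *s s i x))"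
    by (intro inner_L2_cong g KL2 f L2_add L2_sum L2_smult st nuclear_rep_L2[OF nr] K eq_L2_refl)
  also have "\<dots> = inner_L2 a b g (A f) + (\<Sum>i\<in>UNIV. inner_L2 a b (t i) f * inner_L2 a b g (s i))"
    by (simp add: inner_L2_add_right inner_L2_sum_right inner_L2_smult_right g f st nuclear_rep_L2[OF nr] L2_sum L2_smult)
  finally have eq: "inner_L2 a b g (K f) = inner_L2 a b g (A f) + (\<Sum>i\<in>UNIV. inner_L2 a b (t i) f * inner_L2 a b g (s i))" .
  show "((\<lambda>k. inner_L2 a b (case_sum w t k) f * inner_L2 a b g (case_sum z s k)) has_sum inner_L2 a b g (K f)) UNIV"
    unfolding eq by (rule has_sum_sum_type) (use nuclear_rep_has_sum[OF nr f g] in auto)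
qed

section \<open>Fredholm determinants as power series\<close>

lemma nuclear_rep_scale:
  fixes A :: "(real \<Rightarrow> complex^'m) \<Rightarrow> (real \<Rightarrow> complex^'m)"
  assumes nr: "nuclear_rep a b A w z"
  shows "nuclear_rep a b (scale_op \<alpha> A) w (\<lambda>k x. \<alpha> *s z k x)"
  unfolding nuclear_rep_def
proof (intro conjI allI ballI)
  show "(\<lambda>k. norm_L2 a b (w k) * norm_L2 a b (\<lambda>x. \<alpha> *s z k x)) summable_on UNIV"
    using summable_on_cmult_right[OF nuclear_rep_summable[OF nr], of "cmod \<alpha>"]
    by (simp add: norm_L2_smult mult_ac)
  fix f g :: "real \<Rightarrow> complex^'m" assume f: "f \<in> L2 a b" and g: "g \<in> L2 a b"
  show "((\<lambda>k. inner_L2 a b (w k) f * inner_L2 a b g (\<lambda>x. \<alpha> *s z k x)) has_sum inner_L2 a b g (scale_op \<alpha> A f)) UNIV"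
    using has_sum_cmult_right[OF nuclear_rep_has_sum[OF nr f g], of \<alpha>]
    by (simp add: scale_op_def inner_L2_smult_right mult_ac)
qed (auto simp: scale_op_def intro!: L2_smult nuclear_rep_L2[OF nr])

lemma ext_trace_scale: "ext_trace a b w (\<lambda>k x. \<alpha> *s z k x) n = \<alpha> ^ n * ext_trace a b w z n"
proof -
  have "tuple_det n (gram a b w (\<lambda>k x. \<alpha> *s z k x)) t = \<alpha> ^ n * tuple_det n (gram a b w z) t" for t
    unfolding tuple_det_def gram_def inner_L2_smult_right
    using minor_scale[of "{..<n}" \<alpha> "\<lambda>i j. inner_L2 a b (w (t i)) (z (t j))"] by simp
  then have "tuple_det n (gram a b w (\<lambda>k x. \<alpha> *s z k x)) = (\<lambda>t. \<alpha> ^ n * tuple_det n (gram a b w z) t)"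
    by (rule ext)
  then show ?thesis by (simp add: ext_trace_def infsum_cmult_right')
qed

lemma ext_trace_0: "ext_trace a b w z 0 = 1"
  by (simp add: ext_trace_def tuple_det_def)

text \<open>Scaling by \<alpha> multiplies the n-th exterior trace by \<alpha>^n. The two sides are
  the same infinite sum term by term; no convergence is asserted.\<close>

lemma fredholm_det_eval_fps:
  assumes "nuclear_rep a b A w z"
  shows "fredholm_det_I_minus a b (scale_op \<alpha> A) = eval_fps (Abs_fps (\<lambda>n. (-1) ^ n * ext_trace a b w z n)) \<alpha>"
  unfolding fredholm_det_I_minus_def eval_fps_def op_trace_ext_nuclear[OF nuclear_rep_scale[OF assms]] ext_trace_scale
  by (simp add: mult_ac)

lemma ext_trace_fps_causal:
  assumes "nuclear_rep a b A w z" "causal a b \<sigma> A" "\<sigma> = 1 \<or> \<sigma> = -1"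
  shows "Abs_fps (\<lambda>n. (-1) ^ n * ext_trace a b w z n) = 1"
proof (rule fps_ext)
  fix n
  show "fps_nth (Abs_fps (\<lambda>n. (-1) ^ n * ext_trace a b w z n)) n = fps_nth 1 n"
    using ext_trace_causal[OF assms, of n] by (cases "n = 0") (auto simp: ext_trace_0)
qed

lemma fredholm_det_causal:
  assumes "nuclear_rep a b A w z" "causal a b \<sigma> A" "\<sigma> = 1 \<or> \<sigma> = -1"
  shows "fredholm_det_I_minus a b (scale_op \<alpha> A) = 1"
  by (simp add: fredholm_det_eval_fps[OF assms(1)] ext_trace_fps_causal[OF assms])

section \<open>Evaluation of everywhere convergent power series\<close>

lemma fps_conv_radius_infI:
  assumes "\<And>\<beta>. summable (\<lambda>n. fps_nth f n * \<beta> ^ n :: complex)"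
  shows "fps_conv_radius f = \<infinity>"
  unfolding fps_conv_radius_def by (rule conv_radius_inftyI'') (use assms in blast)

lemma fps_conv_radius_inf_add:
  "fps_conv_radius f = \<infinity> \<Longrightarrow> fps_conv_radius g = \<infinity> \<Longrightarrow> fps_conv_radius (f + g :: complex fps) = \<infinity>"
  using fps_conv_radius_add[of f g] by simp

lemma fps_conv_radius_inf_mult:
  "fps_conv_radius f = \<infinity> \<Longrightarrow> fps_conv_radius g = \<infinity> \<Longrightarrow> fps_conv_radius (f * g :: complex fps) = \<infinity>"
  using fps_conv_radius_mult[of f g] by simp

lemma eval_fps_sum_entire:
  assumes "\<And>i. i \<in> I \<Longrightarrow> fps_conv_radius (f i :: complex fps) = \<infinity>"
  shows "fps_conv_radius (\<Sum>i\<in>I. f i) = \<infinity> \<and> eval_fps (\<Sum>i\<in>I. f i) \<beta> = (\<Sum>i\<in>I. eval_fps (f i) \<beta>)"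
  using assms
  by (induction I rule: infinite_finite_induct) (auto simp: eval_fps_add fps_conv_radius_inf_add)

lemma eval_fps_prod_entire:
  assumes "\<And>i. i \<in> I \<Longrightarrow> fps_conv_radius (f i :: complex fps) = \<infinity>"
  shows "fps_conv_radius (\<Prod>i\<in>I. f i) = \<infinity> \<and> eval_fps (\<Prod>i\<in>I. f i) \<beta> = (\<Prod>i\<in>I. eval_fps (f i) \<beta>)"
  using assms
  by (induction I rule: infinite_finite_induct) (auto simp: eval_fps_mult fps_conv_radius_inf_mult)

text \<open>Evaluation is compatible with products inside the radii of convergence, hence the
  requirement that all entries be entire.\<close>

lemma eval_fps_minor:
  fixes M :: "'i \<Rightarrow> 'i \<Rightarrow> complex fps"
  assumes M: "\<And>i j. fps_conv_radius (M i j) = \<infinity>"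
  shows "eval_fps (minor M I) \<beta> = minor (\<lambda>i j. eval_fps (M i j) \<beta>) I"
proof -
  have i: "(of_int m :: complex fps) = fps_const (of_int m)" for m by (simp add: fps_of_int)
  have p: "fps_conv_radius (\<Prod>i\<in>I. M i (p i)) = \<infinity>"
    "eval_fps (\<Prod>i\<in>I. M i (p i)) \<beta> = (\<Prod>i\<in>I. eval_fps (M i (p i)) \<beta>)" for p
    using eval_fps_prod_entire[of I "\<lambda>i. M i (p i)" \<beta>] M by auto
  have "eval_fps (minor M I) \<beta> = (\<Sum>p | p permutes I. eval_fps (of_int (sign p) * (\<Prod>i\<in>I. M i (p i))) \<beta>)"
    unfolding minor_def
    by (rule eval_fps_sum_entire[THEN conjunct2]) (intro fps_conv_radius_inf_mult p, simp add: i)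
  also have "\<dots> = minor (\<lambda>i j. eval_fps (M i j) \<beta>) I"
    unfolding minor_def by (intro sum.cong refl) (simp add: i eval_fps_mult p)
  finally show ?thesis .
qed

text \<open>The causal factor is the constant series 1, so the Fredholm series of K is a polynomial
  in finitely many entire series and may be evaluated at every \<alpha>.\<close>

theorem fredholm_det_finite_rank:
  fixes A K :: "(real \<Rightarrow> complex^'m) \<Rightarrow> (real \<Rightarrow> complex^'m)" and s t :: "'r::finite \<Rightarrow> real \<Rightarrow> complex^'m"
  assumes nr: "nuclear_rep a b A w z" and nrK: "nuclear_rep a b K (case_sum w t) (case_sum z s)"
    and causal: "causal a b \<sigma> A" "\<sigma> = 1 \<or> \<sigma> = -1"
    and summ: "\<And>i j \<beta>. summable (\<lambda>l. \<beta> ^ l * inner_L2 a b (t i) ((A ^^ l) (s j)))"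
  shows "fredholm_det_I_minus a b (scale_op \<alpha> K)
    = det (mat 1 - \<alpha> *\<^sub>m (\<chi> i j. \<Sum>l. \<alpha> ^ l * inner_L2 a b (t i) ((A ^^ l) (s j))))"
proof -
  let ?f = "\<lambda>i j. Abs_fps (\<lambda>l. inner_L2 a b (t i) ((A ^^ l) (s j)))"
  let ?M = "\<lambda>i j. (if i = j then 1 else 0) - fps_X * ?f i j"
  have f: "fps_conv_radius (?f i j) = \<infinity>" for i j
    by (rule fps_conv_radius_infI) (use summ in \<open>simp add: mult.commute\<close>)
  have Xf: "fps_conv_radius (fps_X * ?f i j) = \<infinity>" for i j
    by (intro fps_conv_radius_inf_mult f) simp
  have d: "fps_conv_radius (if i = j then 1 else 0 :: complex fps) = \<infinity>" for i j :: 'r by simp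
  have M: "fps_conv_radius (?M i j) = \<infinity>" for i j
    using fps_conv_radius_diff[of "if i = j then 1 else 0" "fps_X * ?f i j"] d[of i j] Xf[of i j] by simp
  have ev: "eval_fps (?M i j) \<alpha> = (if i = j then 1 else 0) - \<alpha> * (\<Sum>l. \<alpha> ^ l * inner_L2 a b (t i) ((A ^^ l) (s j)))" for i j
  proof -
    have "eval_fps (?M i j) \<alpha> = eval_fps (if i = j then 1 else 0) \<alpha> - eval_fps (fps_X * ?f i j) \<alpha>"
      by (rule eval_fps_diff) (simp_all only: d Xf, simp_all)
    also have "eval_fps (fps_X * ?f i j) \<alpha> = \<alpha> * eval_fps (?f i j) \<alpha>"
      by (subst eval_fps_mult) (simp_all add: f)
    finally show ?thesis by (simp add: eval_fps_def[of "?f i j"] mult.commute)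
  qed
  have "fredholm_det_I_minus a b (scale_op \<alpha> K) = eval_fps (minor ?M UNIV) \<alpha>"
    unfolding fredholm_det_eval_fps[OF nrK] ext_trace_finite_rank[OF nr nrK] ext_trace_fps_causal[OF nr causal] by simp
  also have "\<dots> = minor (\<lambda>i j. eval_fps (?M i j) \<alpha>) UNIV" by (rule eval_fps_minor[OF M])
  also have "\<dots> = det (mat 1 - \<alpha> *\<^sub>m (\<chi> i j. \<Sum>l. \<alpha> ^ l * inner_L2 a b (t i) ((A ^^ l) (s j))))"
    unfolding det_eq_minor ev by (rule minor_cong) (simp add: mat_scale_def mat_def)
  finally show ?thesis .
qed

section \<open>Equations of the second kind\<close>

text \<open>The representation is tested against A f itself, and one factor of its norm is
  cancelled.\<close>

lemma nuclear_rep_bounded: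
  fixes A :: "(real \<Rightarrow> complex^'m) \<Rightarrow> (real \<Rightarrow> complex^'m)"
  assumes nr: "nuclear_rep a b A w z" and f: "f \<in> L2 a b"
  shows "norm_L2 a b (A f) \<le> infsum (\<lambda>k. norm_L2 a b (w k) * norm_L2 a b (z k)) UNIV * norm_L2 a b f"
proof -
  let ?N = "\<lambda>k. norm_L2 a b (w k) * norm_L2 a b (z k)"
  note wL2 = nuclear_rep_L2(1)[OF nr] and zL2 = nuclear_rep_L2(2)[OF nr] and AL2 = nuclear_rep_L2(3)[OF nr]
  have "norm (inner_L2 a b (A f) (A f)) \<le> norm_L2 a b f * norm_L2 a b (A f) * infsum ?N UNIV"
  proof (rule norm_infsum_le[OF nuclear_rep_has_sum[OF nr f AL2[OF f]]])
    show "((\<lambda>k. norm_L2 a b f * norm_L2 a b (A f) * ?N k) has_sum norm_L2 a b f * norm_L2 a b (A f) * infsum ?N UNIV) UNIV"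
      by (intro has_sum_cmult_right has_sum_infsum nuclear_rep_summable[OF nr])
    fix k
    have "cmod (inner_L2 a b (w k) f) * cmod (inner_L2 a b (A f) (z k)) \<le> (norm_L2 a b (w k) * norm_L2 a b f) * (norm_L2 a b (A f) * norm_L2 a b (z k))"
      by (intro mult_mono inner_L2_Cauchy_Schwarz wL2 zL2 f AL2) auto
    then show "norm (inner_L2 a b (w k) f * inner_L2 a b (A f) (z k)) \<le> norm_L2 a b f * norm_L2 a b (A f) * ?N k"
      by (simp add: norm_mult mult_ac)
  qed
  then have "norm_L2 a b (A f) * norm_L2 a b (A f) \<le> norm_L2 a b (A f) * (infsum ?N UNIV * norm_L2 a b f)"
    unfolding inner_L2_self by (simp add: power2_eq_square norm_mult mult_ac)
  moreover have "0 \<le> infsum ?N UNIV" by (rule infsum_nonneg) simp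
  ultimately show ?thesis
    by (cases "norm_L2 a b (A f) = 0") (auto simp: mult_le_cancel_left less_le)
qed

text \<open>Linearity is read off the representation. The combination of f1 and f2 is assumed only
  against scalar products, so that equations valid almost everywhere can be fed in.\<close>

lemma nuclear_rep_linear:
  fixes A :: "(real \<Rightarrow> complex^'m) \<Rightarrow> (real \<Rightarrow> complex^'m)"
  assumes nr: "nuclear_rep a b A w z" and L2: "f \<in> L2 a b" "f1 \<in> L2 a b" "f2 \<in> L2 a b" and g: "g \<in> L2 a b"
    and eq: "\<And>v. v \<in> L2 a b \<Longrightarrow> inner_L2 a b v f = inner_L2 a b v f1 + c * inner_L2 a b v f2"
  shows "inner_L2 a b g (A f) = inner_L2 a b g (A f1) + c * inner_L2 a b g (A f2)"
proof -
  have "((\<lambda>k. inner_L2 a b (w k) f1 * inner_L2 a b g (z k) + c * (inner_L2 a b (w k) f2 * inner_L2 a b g (z k)))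
      has_sum inner_L2 a b g (A f1) + c * inner_L2 a b g (A f2)) UNIV"
    by (intro has_sum_add has_sum_cmult_right nuclear_rep_has_sum[OF nr _ g] L2)
  then have "((\<lambda>k. inner_L2 a b (w k) f * inner_L2 a b g (z k)) has_sum inner_L2 a b g (A f1) + c * inner_L2 a b g (A f2)) UNIV"
    unfolding eq[OF nuclear_rep_L2(1)[OF nr]] by (simp add: algebra_simps)
  then show ?thesis using nuclear_rep_has_sum[OF nr L2(1) g] has_sum_unique by blast
qed

lemma eq_L2_inner:
  fixes f g :: "real \<Rightarrow> complex^'m"
  assumes f: "f \<in> L2 a b" and g: "g \<in> L2 a b"
    and eq: "\<And>v. v \<in> L2 a b \<Longrightarrow> inner_L2 a b v f = inner_L2 a b v g"
  shows "eq_L2 a b f g"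
proof -
  have "inner_L2 a b (\<lambda>x. f x - g x) (\<lambda>x. f x - g x) = 0"
    using eq[OF L2_diff[OF f g]] by (simp add: inner_L2_diff_right L2_diff f g)
  then show ?thesis by (intro eq_L2_diff_0 f g) (simp add: inner_L2_self)
qed

text \<open>Iterating f = h + \<alpha> A f leaves a remainder \<alpha>^n A^n f, which tends to 0 by
  summability at f. All solutions thus have the same scalar products, which makes the choices in
  \<open>inverse_op\<close>, \<open>f1_hat\<close> and \<open>f2_hat\<close> harmless.\<close>

lemma second_kind_inner:
  fixes A :: "(real \<Rightarrow> complex^'m) \<Rightarrow> (real \<Rightarrow> complex^'m)"
  assumes nr: "nuclear_rep a b A w z" and h: "h \<in> L2 a b" and f: "f \<in> L2 a b" and t: "t \<in> L2 a b"
    and sol: "eq_L2 a b (I_minus_op (scale_op \<alpha> A) f) h"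
    and summ: "\<And>u. u \<in> L2 a b \<Longrightarrow> summable (\<lambda>l. cmod \<alpha> ^ l * norm_L2 a b ((A ^^ l) u))"
  shows "(\<lambda>l. \<alpha> ^ l * inner_L2 a b t ((A ^^ l) h)) sums inner_L2 a b t f"
proof -
  note AL2 = nuclear_rep_L2(3)[OF nr]
  have Al: "(A ^^ l) u \<in> L2 a b" if "u \<in> L2 a b" for l u using that by (induction l) (auto intro: AL2)
  have step: "inner_L2 a b v ((A ^^ l) f) = inner_L2 a b v ((A ^^ l) h) + \<alpha> * inner_L2 a b v ((A ^^ Suc l) f)"
    if "v \<in> L2 a b" for v l
    using that
  proof (induction l arbitrary: v)
    case 0
    have "inner_L2 a b v h = inner_L2 a b v (\<lambda>x. f x - \<alpha> *s A f x)"
      using sol by (intro inner_L2_cong 0 h L2_diff f L2_smult AL2 eq_L2_refl)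
        (auto simp: I_minus_op_def scale_op_def intro: eq_L2_sym)
    also have "\<dots> = inner_L2 a b v f - \<alpha> * inner_L2 a b v (A f)"
      by (simp add: inner_L2_diff_right 0 f L2_smult AL2 inner_L2_smult_right)
    finally show ?case by simp
  next
    case (Suc l)
    have "inner_L2 a b v (A ((A ^^ l) f)) = inner_L2 a b v (A ((A ^^ l) h)) + \<alpha> * inner_L2 a b v (A ((A ^^ Suc l) f))"
      by (rule nuclear_rep_linear[OF nr Al[OF f] Al[OF h] Al[OF f] Suc.prems Suc.IH])
    then show ?case by simp
  qed
  have "inner_L2 a b t f = (\<Sum>l<n. \<alpha> ^ l * inner_L2 a b t ((A ^^ l) h)) + \<alpha> ^ n * inner_L2 a b t ((A ^^ n) f)" for n
  proof (induction n)
    case (Suc n)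
    then show ?case using step[OF t, of n] by (simp add: algebra_simps)
  qed simp
  then have eq: "(\<Sum>l<n. \<alpha> ^ l * inner_L2 a b t ((A ^^ l) h)) = inner_L2 a b t f - \<alpha> ^ n * inner_L2 a b t ((A ^^ n) f)" for n
    by (simp add: algebra_simps)
  have "(\<lambda>n. \<alpha> ^ n * inner_L2 a b t ((A ^^ n) f)) \<longlonglongrightarrow> 0"
  proof (rule tendsto_0_le[where K = "norm_L2 a b t"])
    show "(\<lambda>n. cmod \<alpha> ^ n * norm_L2 a b ((A ^^ n) f)) \<longlonglongrightarrow> 0" by (rule summable_LIMSEQ_zero[OF summ[OF f]])
    show "\<forall>\<^sub>F n in sequentially. norm (\<alpha> ^ n * inner_L2 a b t ((A ^^ n) f)) \<le> norm (cmod \<alpha> ^ n * norm_L2 a b ((A ^^ n) f)) * norm_L2 a b t"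
    proof (intro always_eventually allI)
      fix n
      have "cmod \<alpha> ^ n * cmod (inner_L2 a b t ((A ^^ n) f)) \<le> cmod \<alpha> ^ n * (norm_L2 a b t * norm_L2 a b ((A ^^ n) f))"
        by (intro mult_left_mono inner_L2_Cauchy_Schwarz t Al f) simp
      then show "norm (\<alpha> ^ n * inner_L2 a b t ((A ^^ n) f)) \<le> norm (cmod \<alpha> ^ n * norm_L2 a b ((A ^^ n) f)) * norm_L2 a b t"
        by (simp add: norm_mult norm_power abs_mult mult_ac)
    qed
  qed
  from tendsto_diff[OF tendsto_const[of "inner_L2 a b t f"] this]
  show ?thesis unfolding sums_def eq by simp
qed

text \<open>The Neumann series converges in \<open>L2\<close>; boundedness of A lets the equation
  for its partial sums pass to the limit in scalar products.\<close>

lemma second_kind_solution: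
  fixes A :: "(real \<Rightarrow> complex^'m) \<Rightarrow> (real \<Rightarrow> complex^'m)"
  assumes nr: "nuclear_rep a b A w z" and h: "h \<in> L2 a b"
    and summ: "\<And>u. u \<in> L2 a b \<Longrightarrow> summable (\<lambda>l. cmod \<alpha> ^ l * norm_L2 a b ((A ^^ l) u))"
  shows "\<exists>f\<in>L2 a b. eq_L2 a b (I_minus_op (scale_op \<alpha> A) f) h"
proof -
  note AL2 = nuclear_rep_L2(3)[OF nr]
  have Al: "(A ^^ l) u \<in> L2 a b" if "u \<in> L2 a b" for l u using that by (induction l) (auto intro: AL2)
  define d where "d l = (\<lambda>x. \<alpha> ^ l *s (A ^^ l) h x)" for l
  have d: "d l \<in> L2 a b" for l unfolding d_def by (intro L2_smult Al h)
  have "summable (\<lambda>l. norm_L2 a b (d l))"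
    unfolding d_def norm_L2_smult using summ[OF h] by (simp add: norm_power)
  then obtain f where f: "f \<in> L2 a b" and lim: "(\<lambda>n. norm_L2 a b (\<lambda>x. f x - (\<Sum>k<n. d k x))) \<longlonglongrightarrow> 0"
    using L2_complete_series[of d a b] d by blast
  define s where "s n = (\<lambda>x. \<Sum>k<n. d k x)" for n
  have s: "s n \<in> L2 a b" for n unfolding s_def by (intro L2_sum d)
  have conv: "(\<lambda>n. inner_L2 a b v (s n)) \<longlonglongrightarrow> inner_L2 a b v f" if v: "v \<in> L2 a b" for v
  proof (rule Lim_null[THEN iffD2], rule tendsto_0_le[where K = "norm_L2 a b v"])
    show "(\<lambda>n. norm_L2 a b (\<lambda>x. f x - s n x)) \<longlonglongrightarrow> 0" using lim by (simp add: s_def)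
    show "\<forall>\<^sub>F n in sequentially. norm (inner_L2 a b v (s n) - inner_L2 a b v f) \<le> norm (norm_L2 a b (\<lambda>x. f x - s n x)) * norm_L2 a b v"
    proof (intro always_eventually allI)
      fix n
      have "inner_L2 a b v (s n) - inner_L2 a b v f = - inner_L2 a b v (\<lambda>x. f x - s n x)"
        by (simp add: inner_L2_diff_right v f s)
      then show "norm (inner_L2 a b v (s n) - inner_L2 a b v f) \<le> norm (norm_L2 a b (\<lambda>x. f x - s n x)) * norm_L2 a b v"
        using inner_L2_Cauchy_Schwarz[OF v L2_diff[OF f s[of n]]] by (simp add: mult.commute)
    qed
  qed
  have convA: "(\<lambda>n. inner_L2 a b v (A (s n))) \<longlonglongrightarrow> inner_L2 a b v (A f)" if v: "v \<in> L2 a b" for v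
  proof (rule Lim_null[THEN iffD2], rule tendsto_0_le[where K = "norm_L2 a b v * infsum (\<lambda>k. norm_L2 a b (w k) * norm_L2 a b (z k)) UNIV"])
    let ?C = "infsum (\<lambda>k. norm_L2 a b (w k) * norm_L2 a b (z k)) UNIV"
    show "(\<lambda>n. norm_L2 a b (\<lambda>x. f x - s n x)) \<longlonglongrightarrow> 0" using lim by (simp add: s_def)
    show "\<forall>\<^sub>F n in sequentially. norm (inner_L2 a b v (A (s n)) - inner_L2 a b v (A f)) \<le> norm (norm_L2 a b (\<lambda>x. f x - s n x)) * (norm_L2 a b v * ?C)"
    proof (intro always_eventually allI)
      fix n
      have r: "(\<lambda>x. f x - s n x) \<in> L2 a b" by (rule L2_diff[OF f s])
      have "inner_L2 a b v (A (\<lambda>x. f x - s n x)) = inner_L2 a b v (A f) + (-1) * inner_L2 a b v (A (s n))"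
        by (rule nuclear_rep_linear[OF nr r f s v]) (simp add: inner_L2_diff_right f s)
      then have "norm (inner_L2 a b v (A (s n)) - inner_L2 a b v (A f)) = norm (inner_L2 a b v (A (\<lambda>x. f x - s n x)))"
        by (simp add: norm_minus_commute)
      also have "\<dots> \<le> norm_L2 a b v * norm_L2 a b (A (\<lambda>x. f x - s n x))"
        by (rule inner_L2_Cauchy_Schwarz[OF v AL2[OF r]])
      also have "\<dots> \<le> norm_L2 a b v * (?C * norm_L2 a b (\<lambda>x. f x - s n x))"
        by (intro mult_left_mono nuclear_rep_bounded[OF nr r]) simp
      finally show "norm (inner_L2 a b v (A (s n)) - inner_L2 a b v (A f)) \<le> norm (norm_L2 a b (\<lambda>x. f x - s n x)) * (norm_L2 a b v * ?C)"
        by (simp add: mult_ac)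
    qed
  qed
  \<comment> \<open>The partial sums satisfy the equation with the index shifted by one.\<close>
  have telescope: "inner_L2 a b v (s (Suc n)) = inner_L2 a b v h + \<alpha> * inner_L2 a b v (A (s n))" if v: "v \<in> L2 a b" for v n
  proof -
    have lin: "inner_L2 a b v (A (s n)) = (\<Sum>k<n. \<alpha> ^ k * inner_L2 a b v ((A ^^ Suc k) h))" for n
    proof (induction n)
      case 0
      have "inner_L2 a b v (A (s 0)) = inner_L2 a b v (A (s 0)) + (-1) * inner_L2 a b v (A (s 0))"
        by (rule nuclear_rep_linear[OF nr s s s v]) (simp add: s_def)
      then show ?case by simp
    next
      case (Suc n)
      have "inner_L2 a b v (A (s (Suc n))) = inner_L2 a b v (A (s n)) + \<alpha> ^ n * inner_L2 a b v (A ((A ^^ n) h))"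
      proof (rule nuclear_rep_linear[OF nr s s Al[OF h] v])
        fix u :: "real \<Rightarrow> complex^'m" assume u: "u \<in> L2 a b"
        have "s (Suc n) = (\<lambda>x. s n x + d n x)" by (simp add: s_def)
        then have "inner_L2 a b u (s (Suc n)) = inner_L2 a b u (s n) + inner_L2 a b u (d n)"
          by (simp only: inner_L2_add_right[OF u s d])
        then show "inner_L2 a b u (s (Suc n)) = inner_L2 a b u (s n) + \<alpha> ^ n * inner_L2 a b u ((A ^^ n) h)"
          by (simp add: d_def inner_L2_smult_right)
      qed
      with Suc show ?case by simp
    qed
    have "inner_L2 a b v (s (Suc n)) = (\<Sum>k<Suc n. \<alpha> ^ k * inner_L2 a b v ((A ^^ k) h))"
      unfolding s_def by (subst inner_L2_sum_right[OF v d]) (simp add: d_def inner_L2_smult_right)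
    also have "\<dots> = inner_L2 a b v h + \<alpha> * (\<Sum>k<n. \<alpha> ^ k * inner_L2 a b v ((A ^^ Suc k) h))"
      by (subst sum.lessThan_Suc_shift) (simp add: sum_distrib_left mult_ac)
    finally show ?thesis by (simp only: lin)
  qed
  have "inner_L2 a b v f = inner_L2 a b v h + \<alpha> * inner_L2 a b v (A f)" if v: "v \<in> L2 a b" for v
  proof (rule LIMSEQ_unique[OF LIMSEQ_Suc[OF conv[OF v]]])
    show "(\<lambda>n. inner_L2 a b v (s (Suc n))) \<longlonglongrightarrow> inner_L2 a b v h + \<alpha> * inner_L2 a b v (A f)"
      unfolding telescope[OF v] by (intro tendsto_intros convA[OF v])
  qed
  then have "eq_L2 a b (\<lambda>x. f x - \<alpha> *s A f x) h"
    by (intro eq_L2_inner L2_diff f L2_smult AL2 h) (simp add: inner_L2_diff_right f L2_smult AL2 inner_L2_smult_right)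
  then show ?thesis using f by (auto simp: I_minus_op_def scale_op_def)
qed

section \<open>Volterra operators\<close>

text \<open>The integral of \<Phi>^j d\<Phi> for the distribution function \<Phi> of a finite
  measure without atoms, the source of the factorials in iterated Volterra kernels. Fubini replaces
  differentiation, as \<Phi> need not be differentiable. A negative \<sigma> reverses the order of
  the line.\<close>

lemma iterated_integral_power:
  fixes N :: "real measure" and \<sigma> :: real
  assumes fin: "finite_measure N" and m [measurable]: "(\<lambda>x. x) \<in> borel_measurable N"
    and atom: "\<And>x. AE y in N. y \<noteq> x" and \<sigma>: "\<sigma> \<noteq> 0"
  defines "\<Phi> \<equiv> \<lambda>x. \<integral>\<^sup>+y. (if \<sigma> * y < \<sigma> * x then 1 else 0) \<partial>N"
  shows "\<Phi> \<in> borel_measurable N"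
    and "(\<integral>\<^sup>+y. (if \<sigma> * y < \<sigma> * x then \<Phi> y ^ j else 0) \<partial>N) * of_nat (Suc j) = \<Phi> x ^ Suc j"
proof -
  interpret finite_measure N by fact
  interpret pair_sigma_finite N N ..
  have [measurable]: "\<Phi> \<in> borel_measurable borel"
    unfolding \<Phi>_def by measurable
  show \<Phi>m [measurable]: "\<Phi> \<in> borel_measurable N"
    by (rule measurable_compose[OF m]) fact
  show "(\<integral>\<^sup>+y. (if \<sigma> * y < \<sigma> * x then \<Phi> y ^ j else 0) \<partial>N) * of_nat (Suc j) = \<Phi> x ^ Suc j"
  proof (induction j arbitrary: x)
    case 0
    show ?case by (simp add: \<Phi>_def cong: if_cong)
  next
    case (Suc j)
    define I where "I = (\<integral>\<^sup>+y. (if \<sigma> * y < \<sigma> * x then \<Phi> y ^ Suc j else 0) \<partial>N)"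
    \<comment> \<open>The measure of the points strictly between z and x; it is what remains of the
      inner integral once the order of integration is exchanged.\<close>
    define G where "G z = (\<integral>\<^sup>+y. (if \<sigma> * z < \<sigma> * y \<and> \<sigma> * y < \<sigma> * x then 1 else 0) \<partial>N)" for z
    have [measurable]: "G \<in> borel_measurable N"
    proof -
      have "G \<in> borel_measurable borel" unfolding G_def[abs_def] by measurable
      then show ?thesis by (rule measurable_compose[OF m])
    qed
    have "I = (\<integral>\<^sup>+y. (\<integral>\<^sup>+z. (if \<sigma> * z < \<sigma> * y \<and> \<sigma> * y < \<sigma> * x then \<Phi> z ^ j * of_nat (Suc j) else 0) \<partial>N) \<partial>N)"
      unfolding I_def
    proof (rule nn_integral_cong)
      fix y
      have "\<Phi> y ^ Suc j = (\<integral>\<^sup>+z. (if \<sigma> * z < \<sigma> * y then \<Phi> z ^ j else 0) * of_nat (Suc j) \<partial>N)"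
        unfolding Suc.IH[symmetric] by (rule nn_integral_multc[symmetric]) measurable
      also have "\<dots> = (\<integral>\<^sup>+z. (if \<sigma> * z < \<sigma> * y then \<Phi> z ^ j * of_nat (Suc j) else 0) \<partial>N)"
        by (intro nn_integral_cong) auto
      finally show "(if \<sigma> * y < \<sigma> * x then \<Phi> y ^ Suc j else 0)
          = (\<integral>\<^sup>+z. (if \<sigma> * z < \<sigma> * y \<and> \<sigma> * y < \<sigma> * x then \<Phi> z ^ j * of_nat (Suc j) else 0) \<partial>N)"
        by (cases "\<sigma> * y < \<sigma> * x") simp_all
    qed
    also have "\<dots> = (\<integral>\<^sup>+z. (\<integral>\<^sup>+y. (if \<sigma> * z < \<sigma> * y \<and> \<sigma> * y < \<sigma> * x then \<Phi> z ^ j * of_nat (Suc j) else 0) \<partial>N) \<partial>N)"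
      by (rule Fubini') measurable
    also have "\<dots> = (\<integral>\<^sup>+z. of_nat (Suc j) * (\<Phi> z ^ j * G z) \<partial>N)"
    proof (rule nn_integral_cong)
      fix z
      have "(\<integral>\<^sup>+y. (if \<sigma> * z < \<sigma> * y \<and> \<sigma> * y < \<sigma> * x then \<Phi> z ^ j * of_nat (Suc j) else 0) \<partial>N)
          = (\<integral>\<^sup>+y. (\<Phi> z ^ j * of_nat (Suc j)) * (if \<sigma> * z < \<sigma> * y \<and> \<sigma> * y < \<sigma> * x then 1 else 0) \<partial>N)"
        by (intro nn_integral_cong) auto
      also have "\<dots> = (\<Phi> z ^ j * of_nat (Suc j)) * G z"
        unfolding G_def by (rule nn_integral_cmult) measurable
      finally show "(\<integral>\<^sup>+y. (if \<sigma> * z < \<sigma> * y \<and> \<sigma> * y < \<sigma> * x then \<Phi> z ^ j * of_nat (Suc j) else 0) \<partial>N)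
          = of_nat (Suc j) * (\<Phi> z ^ j * G z)" by (simp only: mult_ac)
    qed
    also have "\<dots> = of_nat (Suc j) * (\<integral>\<^sup>+z. \<Phi> z ^ j * G z \<partial>N)"
      by (rule nn_integral_cmult) measurable
    finally have I1: "I = of_nat (Suc j) * (\<integral>\<^sup>+z. \<Phi> z ^ j * G z \<partial>N)" .
    \<comment> \<open>Points being null, \<Phi> x is \<Phi> z plus the measure between z and x. This
      merges the two integrals into one covered by the induction hypothesis.\<close>
    have split: "\<Phi> z ^ j * G z + (if \<sigma> * z < \<sigma> * x then \<Phi> z ^ Suc j else 0) = (if \<sigma> * z < \<sigma> * x then \<Phi> z ^ j else 0) * \<Phi> x" for z
    proof (cases "\<sigma> * z < \<sigma> * x")
      case True
      have "G z + \<Phi> z = (\<integral>\<^sup>+y. (if \<sigma> * z < \<sigma> * y \<and> \<sigma> * y < \<sigma> * x then 1 else 0) + (if \<sigma> * y < \<sigma> * z then 1 else 0) \<partial>N)"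
        unfolding G_def \<Phi>_def by (rule nn_integral_add[symmetric]) measurable
      also have "\<dots> = \<Phi> x"
        unfolding \<Phi>_def
      proof (rule nn_integral_cong_AE, rule AE_mp[OF atom[of z]], intro AE_I2 impI)
        fix y assume "y \<noteq> z"
        then have "\<sigma> * y \<noteq> \<sigma> * z" using \<sigma> by simp
        then show "(if \<sigma> * z < \<sigma> * y \<and> \<sigma> * y < \<sigma> * x then 1 else 0) + (if \<sigma> * y < \<sigma> * z then 1 else 0)
            = (if \<sigma> * y < \<sigma> * x then 1 else 0 :: ennreal)" using True by auto
      qed
      finally have "\<Phi> z ^ j * (G z + \<Phi> z) = \<Phi> z ^ j * \<Phi> x" by simp
      then show ?thesis using True by (simp add: distrib_left mult_ac)
    next
      case False
      then have "G z = (\<integral>\<^sup>+y. 0 \<partial>N)" unfolding G_def by (intro nn_integral_cong) auto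
      then show ?thesis using False by simp
    qed
    have "I * of_nat (Suc (Suc j)) = I + of_nat (Suc j) * I" by (simp add: distrib_left distrib_right mult_ac)
    also have "\<dots> = of_nat (Suc j) * ((\<integral>\<^sup>+z. \<Phi> z ^ j * G z \<partial>N) + (\<integral>\<^sup>+z. (if \<sigma> * z < \<sigma> * x then \<Phi> z ^ Suc j else 0) \<partial>N))"
      by (subst (1) I1) (simp only: I_def distrib_left)
    also have "(\<integral>\<^sup>+z. \<Phi> z ^ j * G z \<partial>N) + (\<integral>\<^sup>+z. (if \<sigma> * z < \<sigma> * x then \<Phi> z ^ Suc j else 0) \<partial>N)
        = (\<integral>\<^sup>+z. \<Phi> z ^ j * G z + (if \<sigma> * z < \<sigma> * x then \<Phi> z ^ Suc j else 0) \<partial>N)"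
      by (rule nn_integral_add[symmetric]) measurable
    also have "\<dots> = (\<integral>\<^sup>+z. (if \<sigma> * z < \<sigma> * x then \<Phi> z ^ j else 0) \<partial>N) * \<Phi> x"
      unfolding split by (rule nn_integral_multc) measurable
    also have "of_nat (Suc j) * \<dots> = \<Phi> x ^ Suc (Suc j)"
      using Suc.IH[of x] by (simp add: mult_ac)
    finally show ?case unfolding I_def .
  qed
qed

lemma measurable_ident_lebesgue_ab: "(\<lambda>x. x) \<in> borel_measurable (lebesgue_ab a b)"
  by (rule measurable_restrict_space1) (rule measurable_completion, simp)

lemma AE_lebesgue_ab_neq: "AE y in lebesgue_ab a b. y \<noteq> x"
proof -
  have "AE y in lebesgue. y \<noteq> x" by (rule AE_completion) (rule AE_lborel_singleton)
  then show ?thesis by (subst AE_restrict_space_iff) auto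
qed

lemma norm_L2_mono:
  fixes f :: "real \<Rightarrow> 'c::euclidean_space" and g :: "real \<Rightarrow> 'd::euclidean_space"
  assumes "f \<in> L2 a b" "g \<in> L2 a b" "C \<ge> 0" "\<And>x. x \<in> einterval a b \<Longrightarrow> norm (f x) \<le> C * norm (g x)"
  shows "norm_L2 a b f \<le> C * norm_L2 a b g"
proof (rule power2_le_imp_le)
  have "(norm_L2 a b f)\<^sup>2 \<le> (LINT x|lebesgue_ab a b. C\<^sup>2 * (norm (g x))\<^sup>2)"
    unfolding norm_L2_power2
  proof (rule integral_mono)
    fix x assume "x \<in> space (lebesgue_ab a b)"
    then have "norm (f x) \<le> C * norm (g x)" using assms(4) by simp
    then have "(norm (f x))\<^sup>2 \<le> (C * norm (g x))\<^sup>2" by (intro power_mono) auto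
    then show "(norm (f x))\<^sup>2 \<le> C\<^sup>2 * (norm (g x))\<^sup>2" by (simp add: power_mult_distrib)
  qed (use assms L2_integrable_norm2 in auto)
  then show "(norm_L2 a b f)\<^sup>2 \<le> (C * norm_L2 a b g)\<^sup>2"
    by (simp add: power_mult_distrib norm_L2_power2)
qed (use assms in auto)

text \<open>Pointwise, iterate j + 1 is at most \<phi> times C \<Phi>^j / j!, where \<Phi> is the
  distribution function of \<phi> \<psi> dx. Extended nonnegative integrals keep integrability
  questions out of the induction.\<close>

theorem volterra_iterates_summable:
  fixes A :: "(real \<Rightarrow> complex^'m) \<Rightarrow> (real \<Rightarrow> complex^'m)" and \<phi> \<psi> :: "real \<Rightarrow> real"
  assumes \<phi>: "\<phi> \<in> L2 a b" "\<And>x. 0 \<le> \<phi> x" and \<psi>: "\<psi> \<in> L2 a b" "\<And>x. 0 \<le> \<psi> x"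
    and AL2: "\<And>f. f \<in> L2 a b \<Longrightarrow> A f \<in> L2 a b" and \<sigma>: "\<sigma> \<noteq> 0"
    and bound: "\<And>f x. f \<in> L2 a b \<Longrightarrow> x \<in> einterval a b \<Longrightarrow> ennreal (norm (A f x))
      \<le> ennreal (\<phi> x) * (\<integral>\<^sup>+y. (if \<sigma> * y < \<sigma> * x then ennreal (\<psi> y * norm (f y)) else 0) \<partial>lebesgue_ab a b)"
    and f: "f \<in> L2 a b" and \<beta>: "0 \<le> \<beta>"
  shows "summable (\<lambda>l. \<beta> ^ l * norm_L2 a b ((A ^^ l) f))"
proof -
  let ?M = "lebesgue_ab a b"
  have [measurable]: "\<phi> \<in> borel_measurable ?M" "\<psi> \<in> borel_measurable ?M" "f \<in> borel_measurable ?M"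
    using \<phi> \<psi> f by (auto intro: L2_measurable)
  have idm [measurable]: "(\<lambda>x. x) \<in> borel_measurable ?M"
    by (rule measurable_ident_lebesgue_ab)
  define \<rho> where "\<rho> y = ennreal (\<phi> y * \<psi> y)" for y
  have [measurable]: "\<rho> \<in> borel_measurable ?M" unfolding \<rho>_def[abs_def] by measurable
  \<comment> \<open>The density arises because the bound \<phi> y of one iterate meets the factor
    \<psi> y of the next.\<close>
  define N where "N = density ?M \<rho>"
  have int: "integrable ?M (\<lambda>y. \<phi> y * \<psi> y)" "integrable ?M (\<lambda>y. \<psi> y * norm (f y))"
    using L2_integrable_mult[OF \<phi>(1) \<psi>(1)] L2_integrable_mult[OF \<psi>(1) f] \<phi>(2) \<psi>(2) by simp_all
  have nnf: "(\<integral>\<^sup>+y. \<rho> y \<partial>?M) = ennreal (LINT y|?M. \<phi> y * \<psi> y)"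
    unfolding \<rho>_def by (rule nn_integral_eq_integral[OF int(1)]) (simp add: \<phi> \<psi>)
  have finN: "finite_measure N"
  proof
    have "emeasure N (space N) = (\<integral>\<^sup>+y. 1 \<partial>N)" by simp
    also have "\<dots> = (\<integral>\<^sup>+y. \<rho> y \<partial>?M)" unfolding N_def by (subst nn_integral_density) simp_all
    finally show "emeasure N (space N) \<noteq> \<infinity>" by (simp add: nnf)
  qed
  have mN: "(\<lambda>x. x) \<in> borel_measurable N" unfolding N_def by simp
  have atom: "AE y in N. y \<noteq> x" for x
    unfolding N_def by (subst AE_density) (use AE_lebesgue_ab_neq[of x a b] in auto)
  define \<Phi> where "\<Phi> x = (\<integral>\<^sup>+y. (if \<sigma> * y < \<sigma> * x then 1 else 0) \<partial>N)" for x
  note pw = iterated_integral_power[OF finN mN atom \<sigma>, folded \<Phi>_def]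
  have [measurable]: "\<Phi> \<in> borel_measurable ?M" using pw(1) by (simp add: N_def \<Phi>_def[abs_def])
  define R where "R = (LINT y|?M. \<phi> y * \<psi> y)"
  define C where "C = (LINT y|?M. \<psi> y * norm (f y))"
  have RC: "R \<ge> 0" "C \<ge> 0" unfolding R_def C_def using \<phi>(2) \<psi>(2) by (auto intro!: integral_nonneg_AE)
  have \<Phi>R: "\<Phi> x \<le> ennreal R" for x
  proof -
    have "\<Phi> x \<le> (\<integral>\<^sup>+y. 1 \<partial>N)" unfolding \<Phi>_def by (intro nn_integral_mono) auto
    also have "\<dots> = (\<integral>\<^sup>+y. \<rho> y \<partial>?M)" unfolding N_def by (subst nn_integral_density) simp_all
    finally show ?thesis by (simp add: nnf R_def)
  qed
  have Al: "(A ^^ l) f \<in> L2 a b" for l using f by (induction l) (auto intro: AL2)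
  \<comment> \<open>The first application of A is spent on replacing f by the constant C, hence the
    exponent j for the iterate \<open>Suc j\<close>.\<close>
  have claim: "ennreal (fact j * norm ((A ^^ Suc j) f x)) \<le> ennreal (\<phi> x * C) * \<Phi> x ^ j" if "x \<in> einterval a b" for x j
    using that
  proof (induction j arbitrary: x)
    case 0
    have "ennreal (norm (A f x)) \<le> ennreal (\<phi> x) * (\<integral>\<^sup>+y. (if \<sigma> * y < \<sigma> * x then ennreal (\<psi> y * norm (f y)) else 0) \<partial>?M)"
      by (rule bound[OF f 0])
    also have "\<dots> \<le> ennreal (\<phi> x) * (\<integral>\<^sup>+y. ennreal (\<psi> y * norm (f y)) \<partial>?M)"
      by (intro mult_left_mono nn_integral_mono) auto
    also have "(\<integral>\<^sup>+y. ennreal (\<psi> y * norm (f y)) \<partial>?M) = ennreal C"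
      unfolding C_def by (rule nn_integral_eq_integral[OF int(2)]) (simp add: \<psi>)
    finally show ?case using \<phi>(2) RC by (simp add: ennreal_mult)
  next
    case (Suc j)
    let ?u = "(A ^^ Suc j) f"
    have [measurable]: "?u \<in> borel_measurable ?M" by (rule L2_measurable[OF Al])
    have "ennreal (fact j * norm (A ?u x)) = ennreal (fact j) * ennreal (norm (A ?u x))"
      by (simp add: ennreal_mult)
    also have "\<dots> \<le> ennreal (fact j) * (ennreal (\<phi> x) * (\<integral>\<^sup>+y. (if \<sigma> * y < \<sigma> * x then ennreal (\<psi> y * norm (?u y)) else 0) \<partial>?M))"
      by (intro mult_left_mono bound[OF Al Suc.prems]) simp
    also have "\<dots> = ennreal (\<phi> x) * (\<integral>\<^sup>+y. ennreal (fact j) * (if \<sigma> * y < \<sigma> * x then ennreal (\<psi> y * norm (?u y)) else 0) \<partial>?M)"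
      by (subst nn_integral_cmult) (simp_all add: mult_ac)
    also have "\<dots> \<le> ennreal (\<phi> x) * (\<integral>\<^sup>+y. ennreal C * (\<rho> y * (if \<sigma> * y < \<sigma> * x then \<Phi> y ^ j else 0)) \<partial>?M)"
    proof (intro mult_left_mono nn_integral_mono)
      fix y assume "y \<in> space ?M"
      then have y: "y \<in> einterval a b" by simp
      have "ennreal (fact j) * ennreal (\<psi> y * norm (?u y)) = ennreal (\<psi> y) * ennreal (fact j * norm (?u y))"
        using \<psi>(2) by (simp add: mult_ac flip: ennreal_mult)
      also have "\<dots> \<le> ennreal (\<psi> y) * (ennreal (\<phi> y * C) * \<Phi> y ^ j)"
        by (intro mult_left_mono Suc.IH y) simp
      also have "\<dots> = ennreal C * (\<rho> y * \<Phi> y ^ j)"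
        using \<phi>(2) \<psi>(2) RC by (simp add: \<rho>_def ennreal_mult mult_ac)
      finally show "ennreal (fact j) * (if \<sigma> * y < \<sigma> * x then ennreal (\<psi> y * norm (?u y)) else 0)
          \<le> ennreal C * (\<rho> y * (if \<sigma> * y < \<sigma> * x then \<Phi> y ^ j else 0))" by auto
    qed simp
    also have "(\<integral>\<^sup>+y. ennreal C * (\<rho> y * (if \<sigma> * y < \<sigma> * x then \<Phi> y ^ j else 0)) \<partial>?M)
        = ennreal C * (\<integral>\<^sup>+y. \<rho> y * (if \<sigma> * y < \<sigma> * x then \<Phi> y ^ j else 0) \<partial>?M)"
      by (rule nn_integral_cmult) measurable
    also have "(\<integral>\<^sup>+y. \<rho> y * (if \<sigma> * y < \<sigma> * x then \<Phi> y ^ j else 0) \<partial>?M) = (\<integral>\<^sup>+y. (if \<sigma> * y < \<sigma> * x then \<Phi> y ^ j else 0) \<partial>N)"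
      unfolding N_def by (rule nn_integral_density[symmetric]) measurable
    finally have 1: "ennreal (fact j * norm (A ?u x)) \<le> ennreal (\<phi> x) * (ennreal C * (\<integral>\<^sup>+y. (if \<sigma> * y < \<sigma> * x then \<Phi> y ^ j else 0) \<partial>N))" .
    have "ennreal (fact (Suc j) * norm ((A ^^ Suc (Suc j)) f x)) = ennreal ((fact j * norm (A ?u x)) * real (Suc j))"
      by (simp only: fact_Suc funpow.simps o_apply mult_ac of_nat_id)
    also have "\<dots> = ennreal (fact j * norm (A ?u x)) * of_nat (Suc j)"
      unfolding ennreal_of_nat_eq_real_of_nat by (rule ennreal_mult) simp_all
    also have "\<dots> \<le> ennreal (\<phi> x) * (ennreal C * (\<integral>\<^sup>+y. (if \<sigma> * y < \<sigma> * x then \<Phi> y ^ j else 0) \<partial>N)) * of_nat (Suc j)"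
      by (rule mult_right_mono[OF 1]) simp
    also have "\<dots> = ennreal (\<phi> x) * (ennreal C * ((\<integral>\<^sup>+y. (if \<sigma> * y < \<sigma> * x then \<Phi> y ^ j else 0) \<partial>N) * of_nat (Suc j)))"
      by (simp only: mult_ac)
    also have "\<dots> = ennreal (\<phi> x) * (ennreal C * \<Phi> x ^ Suc j)"
      using pw(2)[of x j] by (simp only: \<Phi>_def)
    also have "\<dots> = ennreal (\<phi> x * C) * \<Phi> x ^ Suc j"
      using \<phi>(2) RC by (simp only: ennreal_mult mult_ac)
    finally show ?case .
  qed
  have pointwise: "norm ((A ^^ Suc j) f x) \<le> (C * R ^ j / fact j) * norm (\<phi> x)" if x: "x \<in> einterval a b" for x j
  proof -
    have "ennreal (fact j * norm ((A ^^ Suc j) f x)) \<le> ennreal (\<phi> x * C) * \<Phi> x ^ j" by (rule claim[OF x])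
    also have "\<dots> \<le> ennreal (\<phi> x * C) * ennreal R ^ j" by (intro mult_left_mono power_mono \<Phi>R) auto
    also have "\<dots> = ennreal (\<phi> x * C * R ^ j)" using \<phi>(2) RC by (simp add: ennreal_mult ennreal_power)
    finally have "fact j * norm ((A ^^ Suc j) f x) \<le> \<phi> x * C * R ^ j"
      using \<phi>(2) RC by (subst (asm) ennreal_le_iff) auto
    then show ?thesis using \<phi>(2)[of x] by (simp add: field_simps)
  qed
  have nb: "norm_L2 a b ((A ^^ Suc j) f) \<le> (C * R ^ j / fact j) * norm_L2 a b \<phi>" for j
    by (rule norm_L2_mono[OF Al \<phi>(1) _ pointwise]) (use RC in auto)
  have "summable (\<lambda>j. \<beta> * C * norm_L2 a b \<phi> * (inverse (fact j) * (\<beta> * R) ^ j))"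
    by (intro summable_mult summable_exp)
  then have "summable (\<lambda>j. \<beta> ^ Suc j * norm_L2 a b ((A ^^ Suc j) f))"
  proof (rule summable_comparison_test'[where N = 0])
    fix j
    have "\<beta> ^ Suc j * norm_L2 a b ((A ^^ Suc j) f) \<le> \<beta> ^ Suc j * ((C * R ^ j / fact j) * norm_L2 a b \<phi>)"
      by (intro mult_left_mono nb) (use \<beta> in auto)
    then show "norm (\<beta> ^ Suc j * norm_L2 a b ((A ^^ Suc j) f)) \<le> \<beta> * C * norm_L2 a b \<phi> * (inverse (fact j) * (\<beta> * R) ^ j)"
      using \<beta> by (simp add: field_simps)
  qed
  then show ?thesis by (rule summable_Suc_iff[THEN iffD1])
qed

section \<open>Semi-separable kernels\<close>

lemma norm_matrix_vector_mult: "norm (A *v v) \<le> norm A * norm (v :: complex^'n)" for A :: "complex^'n^'m"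
proof -
  have c: "cmod ((A *v v) $ i) \<le> norm (A $ i) * norm v" for i
  proof -
    have "(A *v v) $ i = hdot (\<chi> j. cnj (A $ i $ j)) v" by (simp add: matrix_vector_mult_def hdot_def)
    then have "cmod ((A *v v) $ i) \<le> norm (\<chi> j. cnj (A $ i $ j)) * norm v" using norm_hdot_le by metis
    also have "norm (\<chi> j. cnj (A $ i $ j)) = norm (A $ i)" by (simp add: norm_vec_def)
    finally show ?thesis .
  qed
  have "norm (A *v v) \<le> L2_set (\<lambda>i. norm (A $ i) * norm v) UNIV"
    unfolding norm_vec_def[of "A *v v"] by (rule L2_set_mono) (use c in auto)
  also have "\<dots> = norm A * norm v"
    by (simp add: norm_vec_def[of A] L2_set_left_distrib)
  finally show ?thesis .
qed

lemma norm_column: "norm (column j A) \<le> norm (A :: complex^'n^'m)"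
  unfolding norm_vec_def[of A] norm_vec_def[of "column j A"]
  by (rule L2_set_mono) (auto simp: column_def intro: Finite_Cartesian_Product.norm_nth_le)

lemma norm_cnj_row: "norm (\<chi> c. cnj (A $ i $ c)) \<le> norm (A :: complex^'n^'m)"
proof -
  have "norm (\<chi> c. cnj (A $ i $ c)) = norm (A $ i)" by (simp add: norm_vec_def)
  then show ?thesis using Finite_Cartesian_Product.norm_nth_le[of A i] by simp
qed

lemma measurable_matrix_vector_mult [measurable (raw)]:
  fixes F :: "'x \<Rightarrow> complex^'n^'m"
  assumes "F \<in> borel_measurable M" "f \<in> borel_measurable M"
  shows "(\<lambda>x. F x *v f x) \<in> borel_measurable M"
proof -
  have "continuous_on UNIV (\<lambda>p :: (complex^'n^'m) \<times> (complex^'n). fst p *v snd p)"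
    unfolding matrix_vector_mult_def by (intro continuous_intros)
  from borel_measurable_continuous_Pair[OF assms this] show ?thesis by simp
qed

lemma measurable_matrix_matrix_mult [measurable (raw)]:
  fixes F :: "'x \<Rightarrow> complex^'n^'m" and G :: "'x \<Rightarrow> complex^'p^'n"
  assumes "F \<in> borel_measurable M" "G \<in> borel_measurable M"
  shows "(\<lambda>x. F x ** G x) \<in> borel_measurable M"
proof -
  have "continuous_on UNIV (\<lambda>p :: (complex^'n^'m) \<times> (complex^'p^'n). fst p ** snd p)"
    unfolding matrix_matrix_mult_def by (intro continuous_intros)
  from borel_measurable_continuous_Pair[OF assms this] show ?thesis by simp
qed

lemma L2_column:
  fixes F :: "real \<Rightarrow> complex^'n^'m"
  assumes F: "F \<in> L2 a b"
  shows "(\<lambda>x. column j (F x)) \<in> L2 a b"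
proof (rule L2_bound[OF _ F, where C = 1])
  have "continuous_on UNIV (\<lambda>A :: complex^'n^'m. column j A)"
    unfolding column_def by (intro continuous_intros)
  then show "(\<lambda>x. column j (F x)) \<in> borel_measurable (lebesgue_ab a b)"
    using L2_measurable[OF F] by (rule borel_measurable_continuous_on)
qed (simp add: norm_column)

lemma L2_cnj_row:
  fixes G :: "real \<Rightarrow> complex^'m^'n"
  assumes G: "G \<in> L2 a b"
  shows "(\<lambda>x. \<chi> c. cnj (G x $ i $ c)) \<in> L2 a b"
proof (rule L2_bound[OF _ G, where C = 1])
  have "continuous_on UNIV (\<lambda>A :: complex^'m^'n. \<chi> c. cnj (A $ i $ c))"
    by (intro continuous_intros)
  then show "(\<lambda>x. \<chi> c. cnj (G x $ i $ c)) \<in> borel_measurable (lebesgue_ab a b)"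
    using L2_measurable[OF G] by (rule borel_measurable_continuous_on)
qed (simp add: norm_cnj_row)

lemma L2_norm:
  fixes F :: "real \<Rightarrow> 'c::euclidean_space"
  assumes F: "F \<in> L2 a b"
  shows "(\<lambda>x. norm (F x)) \<in> L2 a b"
proof (rule L2_bound[OF _ F, where C = 1])
  show "(\<lambda>x. norm (F x)) \<in> borel_measurable (lebesgue_ab a b)" using L2_measurable[OF F] by measurable
qed simp

lemma L2_cong:
  fixes f g :: "real \<Rightarrow> 'c::euclidean_space"
  assumes "f \<in> L2 a b" "\<And>x. x \<in> einterval a b \<Longrightarrow> f x = g x"
  shows "g \<in> L2 a b"
proof (rule L2_eq_L2[OF assms(1)])
  show "g \<in> borel_measurable (lebesgue_ab a b)"
    using L2_measurable[OF assms(1)] by (subst measurable_cong[of _ g f]) (auto simp: assms(2))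
qed (auto simp: eq_L2_def assms(2) intro!: AE_I2)

lemma integrable_matrix_vector:
  fixes G :: "real \<Rightarrow> complex^'m^'n"
  assumes "G \<in> L2 a b" "f \<in> L2 a b"
  shows "integrable (lebesgue_ab a b) (\<lambda>y. G y *v f y)"
  by (rule Bochner_Integration.integrable_bound[OF L2_integrable_mult[OF assms]])
    (use assms norm_matrix_vector_mult in auto)

text \<open>A is the sum of its columns, each padded with zeros. This transfers integrability from
  columns to matrix functions.\<close>

lemma norm_matrix_le_columns:
  fixes A :: "complex^'n^'m"
  shows "norm A \<le> (\<Sum>j\<in>UNIV. norm (column j A))"
proof -
  have A: "A = (\<Sum>j\<in>UNIV. \<chi> i k. if k = j then A $ i $ k else 0)"
    by (simp add: vec_eq_iff)
  have "norm (\<chi> i k. if k = j then A $ i $ k else 0) = norm (column j A)" for j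
  proof -
    have "norm (\<chi> k. if k = j then A $ i $ k else 0) = cmod (A $ i $ j)" for i
    proof -
      have "(\<Sum>k\<in>UNIV. (cmod (if k = j then A $ i $ k else 0))\<^sup>2) = (\<Sum>k\<in>UNIV. if k = j then (cmod (A $ i $ j))\<^sup>2 else 0)"
        by (intro sum.cong) auto
      then show ?thesis by (simp add: norm_vec_def L2_set_def)
    qed
    then show ?thesis
      unfolding norm_vec_def[of "column j A"] norm_vec_def[of "\<chi> i k. if k = j then A $ i $ k else 0"]
      by (simp add: column_def)
  qed
  then show ?thesis using norm_sum[of "\<lambda>j. \<chi> i k. if k = j then A $ i $ k else 0" UNIV] A by simp
qed

lemma L2_columns:
  fixes h :: "real \<Rightarrow> complex^'n^'m"
  assumes col: "\<And>j. (\<lambda>x. column j (h x)) \<in> L2 a b"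
  shows "h \<in> L2 a b"
proof (rule L2_bound[where C = 1 and g = "\<lambda>x. \<Sum>j\<in>UNIV. norm (column j (h x))"])
  show "(\<lambda>x. \<Sum>j\<in>UNIV. norm (column j (h x))) \<in> L2 a b" by (intro L2_sum L2_norm col)
  have "(\<lambda>x. column j (h x) $ i) \<in> borel_measurable (lebesgue_ab a b)" for i j
    using L2_measurable[OF col] by measurable
  then have "(\<lambda>x. h x $ i $ j) \<in> borel_measurable (lebesgue_ab a b)" for i j by (simp add: column_def)
  then have "(\<lambda>x. h x $ i $ j \<bullet> c) \<in> borel_measurable (lebesgue_ab a b)" for i j and c :: complex
    by (intro borel_measurable_inner borel_measurable_const)
  then show "h \<in> borel_measurable (lebesgue_ab a b)"
    by (subst borel_measurable_euclidean_space) (auto simp: Basis_vec_def inner_axis)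
  show "AE x in lebesgue_ab a b. norm (h x) \<le> 1 * norm (\<Sum>j\<in>UNIV. norm (column j (h x)))"
    by (rule AE_I2) (use norm_matrix_le_columns in \<open>auto simp: sum_nonneg\<close>)
qed

text \<open>The rows of G are conjugated because \<open>inner_L2\<close> is antilinear in its first
  argument; this turns the maps \<open>op_R\<close> and \<open>op_T\<close> into finitely many
  functionals on \<open>L2\<close>.\<close>

lemma integral_matrix_vector_nth:
  fixes G :: "real \<Rightarrow> complex^'m^'n"
  assumes "G \<in> L2 a b" "f \<in> L2 a b"
  shows "(LINT y|lebesgue_ab a b. G y *v f y) $ i = inner_L2 a b (\<lambda>x. \<chi> c. cnj (G x $ i $ c)) f"
proof -
  have "(LINT y|lebesgue_ab a b. G y *v f y) $ i = (LINT y|lebesgue_ab a b. (G y *v f y) $ i)"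
    by (rule integral_bounded_linear[OF bounded_linear_vec_nth integrable_matrix_vector[OF assms], symmetric])
  then show ?thesis by (simp add: inner_L2_hdot hdot_def matrix_vector_mult_def)
qed

lemma integrable_matrix_entries:
  fixes M :: "real \<Rightarrow> complex^'n^'m"
  assumes "M \<in> borel_measurable (lebesgue_ab a b)" "\<And>j. integrable (lebesgue_ab a b) (\<lambda>y. column j (M y))"
  shows "integrable (lebesgue_ab a b) M"
proof (rule Bochner_Integration.integrable_bound[OF _ assms(1)])
  show "integrable (lebesgue_ab a b) (\<lambda>y. \<Sum>j\<in>UNIV. norm (column j (M y)))"
    by (intro Bochner_Integration.integrable_sum integrable_norm assms(2))
  show "AE x in lebesgue_ab a b. norm (M x) \<le> norm (\<Sum>j\<in>UNIV. norm (column j (M x)))"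
    by (rule AE_I2) (use norm_matrix_le_columns in \<open>auto simp: sum_nonneg\<close>)
qed

lemma bounded_linear_column: "bounded_linear (column j :: complex^'n^'m \<Rightarrow> complex^'m)"
proof (rule bounded_linear_intro[where K = 1])
  show "norm (column j A) \<le> norm A * 1" for A :: "complex^'n^'m" using norm_column by simp
qed (simp_all add: column_def vec_eq_iff)

lemma column_matrix_mult: "column j (A ** B) = A *v column j B"
  by (simp add: matrix_matrix_mult_def matrix_vector_mult_def column_def)

lemma integral_matrix_mult:
  fixes G :: "real \<Rightarrow> complex^'m^'n" and h :: "real \<Rightarrow> complex^'p^'m"
  assumes G: "G \<in> L2 a b" and h: "h \<in> L2 a b"
  shows "(LINT y|lebesgue_ab a b. G y ** h y) $ i $ j = inner_L2 a b (\<lambda>x. \<chi> c. cnj (G x $ i $ c)) (\<lambda>x. column j (h x))"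
proof -
  have int: "integrable (lebesgue_ab a b) (\<lambda>y. G y ** h y)"
  proof (rule integrable_matrix_entries)
    show "(\<lambda>y. G y ** h y) \<in> borel_measurable (lebesgue_ab a b)" using G h by measurable
    show "integrable (lebesgue_ab a b) (\<lambda>y. column j (G y ** h y))" for j
      unfolding column_matrix_mult by (rule integrable_matrix_vector[OF G L2_column[OF h]])
  qed
  have "(LINT y|lebesgue_ab a b. G y ** h y) $ i $ j = column j (LINT y|lebesgue_ab a b. G y ** h y) $ i"
    by (simp add: column_def)
  also have "column j (LINT y|lebesgue_ab a b. G y ** h y) = (LINT y|lebesgue_ab a b. G y *v column j (h y))"
    using integral_bounded_linear[OF bounded_linear_column int, of j] by (simp add: column_matrix_mult)
  finally show ?thesis by (simp add: integral_matrix_vector_nth[OF G L2_column[OF h]])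
qed

lemma matrix_vector_mult_columns: "A *v u = (\<Sum>i\<in>UNIV. u $ i *s column i A)" for A :: "complex^'n^'m"
  by (simp add: vec_eq_iff matrix_vector_mult_def column_def mult.commute)

lemma matrix_vector_mult_axis: "A *v axis j 1 = column j A" for A :: "complex^'n^'m"
proof -
  have "(\<Sum>k\<in>UNIV. A $ i $ k * axis j 1 $ k) = (\<Sum>k\<in>UNIV. if k = j then A $ i $ j else 0)" for i
    by (intro sum.cong) (auto simp: axis_def)
  then show ?thesis by (simp add: vec_eq_iff matrix_vector_mult_def column_def)
qed

lemma integral_trace:
  fixes G :: "real \<Rightarrow> complex^'m^'n" and F :: "real \<Rightarrow> complex^'n^'m"
  assumes G: "G \<in> L2 a b" and F: "F \<in> L2 a b"
  shows "(LINT x|lebesgue_ab a b. trace (G x ** F x))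
    = (\<Sum>i\<in>UNIV. inner_L2 a b (\<lambda>x. \<chi> c. cnj (G x $ i $ c)) (\<lambda>x. column i (F x)))"
proof -
  have "trace (G x ** F x) = (\<Sum>i\<in>UNIV. hdot (\<chi> c. cnj (G x $ i $ c)) (column i (F x)))" for x
    by (simp add: trace_def matrix_matrix_mult_def hdot_def column_def)
  then show ?thesis
    unfolding inner_L2_hdot
    by (simp add: Bochner_Integration.integral_sum integrable_hdot L2_cnj_row[OF G] L2_column[OF F])
qed

text \<open>
  Used with \<open>A = H\<^sub>a\<close>, \<open>F = f\<^sub>2\<close>, \<open>G = g\<^sub>2\<close> and with \<open>A = H\<^sub>b\<close>, \<open>F = f\<^sub>1\<close>, \<open>G = g\<^sub>1\<close>.
\<close>

theorem causal_plus_separable: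
  fixes A K :: "(real \<Rightarrow> complex^'m) \<Rightarrow> (real \<Rightarrow> complex^'m)"
    and F :: "real \<Rightarrow> complex^'n^'m" and G :: "real \<Rightarrow> complex^'m^'n"
  assumes tc: "trace_class a b K" and F: "F \<in> L2 a b" and G: "G \<in> L2 a b"
    and K: "\<And>f x. f \<in> L2 a b \<Longrightarrow> x \<in> einterval a b \<Longrightarrow>
      K f x = A f x + F x *v (LINT y|lebesgue_ab a b. G y *v f y)"
    and causal: "causal a b \<sigma> A" "\<sigma> = 1 \<or> \<sigma> = -1"
    and iterates: "\<And>\<beta> f. (\<And>f. f \<in> L2 a b \<Longrightarrow> A f \<in> L2 a b) \<Longrightarrow> f \<in> L2 a b \<Longrightarrow> 0 \<le> \<beta> \<Longrightarrow>
      summable (\<lambda>l. \<beta> ^ l * norm_L2 a b ((A ^^ l) f))"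
  shows "op_trace a b A = 0"
    and "fredholm_det_I_minus a b (scale_op \<alpha> A) = 1"
    and "op_trace a b K = (LINT x|lebesgue_ab a b. trace (G x ** F x))"
    and "fredholm_det_I_minus a b (scale_op \<alpha> K) = det (mat 1 - \<alpha> *\<^sub>m
      matrix (\<lambda>u. LINT y|lebesgue_ab a b. G y *v inverse_op a b (I_minus_op (scale_op \<alpha> A)) (\<lambda>x. F x *v u) y))"
    and "\<exists>h\<in>L2 a b. \<forall>j. eq_L2 a b (I_minus_op (scale_op \<alpha> A) (\<lambda>x. column j (h x))) (\<lambda>x. column j (F x))"
    and "\<And>h. h \<in> L2 a b \<Longrightarrow>
      (\<forall>j. eq_L2 a b (I_minus_op (scale_op \<alpha> A) (\<lambda>x. column j (h x))) (\<lambda>x. column j (F x))) \<Longrightarrow>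
      fredholm_det_I_minus a b (scale_op \<alpha> K) = det (mat 1 - \<alpha> *\<^sub>m (LINT y|lebesgue_ab a b. G y ** h y))"
proof -
  \<comment> \<open>Columns of F and, below, conjugated rows of G: K differs from A by the finite
    rank operator built from the \<open>t i\<close> and \<open>s i\<close>.\<close>
  define s where "s j = (\<lambda>x. column j (F x))" for j
  define t where "t i = (\<lambda>x. \<chi> c. cnj (G x $ i $ c))" for i
  have s: "s j \<in> L2 a b" and t: "t j \<in> L2 a b" for j
    by (auto simp: s_def t_def intro!: L2_column L2_cnj_row F G)
  have Ks: "K f x = A f x + (\<Sum>i\<in>UNIV. inner_L2 a b (t i) f *s s i x)" if "f \<in> L2 a b" "x \<in> einterval a b" for f x
    unfolding K[OF that] matrix_vector_mult_columns[of "F x"] integral_matrix_vector_nth[OF G that(1)]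
    by (simp add: s_def t_def)
  obtain w z :: "nat \<Rightarrow> real \<Rightarrow> complex^'m" where nrK0: "nuclear_rep a b K w z"
    using trace_class_nuclear_rep[OF tc] by blast
  have KL2: "K f \<in> L2 a b" if "f \<in> L2 a b" for f by (rule nuclear_rep_L2(3)[OF nrK0 that])
  have AL2: "A f \<in> L2 a b" if f: "f \<in> L2 a b" for f
  proof (rule L2_cong)
    show "(\<lambda>x. K f x - (\<Sum>i\<in>UNIV. inner_L2 a b (t i) f *s s i x)) \<in> L2 a b"
      by (intro L2_diff KL2 f L2_sum L2_smult s)
  qed (simp add: Ks f)
  \<comment> \<open>A is K with the finite rank part subtracted, the minus sign being put into the
    vectors.\<close>
  define w' z' where "w' = case_sum w t" and "z' = case_sum z (\<lambda>i x. - s i x)"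
  have nr: "nuclear_rep a b A w' z'"
    unfolding w'_def z'_def
  proof (rule nuclear_rep_finite_rank[OF nrK0 L2_uminus[OF s] t AL2])
    fix f :: "real \<Rightarrow> complex^'m" assume "f \<in> L2 a b"
    then show "eq_L2 a b (A f) (\<lambda>x. K f x + (\<Sum>i\<in>UNIV. inner_L2 a b (t i) f *s - s i x))"
      unfolding eq_L2_def by (intro AE_I2) (simp add: Ks sum_negf)
  qed
  \<comment> \<open>K is represented anew as A plus finite rank, the shape that
    \<open>fredholm_det_finite_rank\<close> expects; traces do not depend on the
    representation.\<close>
  have nrK: "nuclear_rep a b K (case_sum w' t) (case_sum z' s)"
  proof (rule nuclear_rep_finite_rank[OF nr s t KL2])
    fix f :: "real \<Rightarrow> complex^'m" assume "f \<in> L2 a b"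
    then show "eq_L2 a b (K f) (\<lambda>x. A f x + (\<Sum>i\<in>UNIV. inner_L2 a b (t i) f *s s i x))"
      unfolding eq_L2_def by (intro AE_I2) (simp add: Ks)
  qed
  have tr0: "ext_trace a b w' z' 1 = 0" by (rule ext_trace_causal[OF nr causal]) simp
  show "op_trace a b A = 0" using op_trace_nuclear(1)[OF nr] tr0 by simp
  show "fredholm_det_I_minus a b (scale_op \<alpha> A) = 1" by (rule fredholm_det_causal[OF nr causal])
  have "((\<lambda>k. inner_L2 a b (case_sum w' t k) (case_sum z' s k)) has_sum (0 + (\<Sum>i\<in>UNIV. inner_L2 a b (t i) (s i)))) UNIV"
    by (rule has_sum_sum_type) (use op_trace_nuclear(2)[OF nr] tr0 in auto)
  then have "op_trace a b K = 0 + (\<Sum>i\<in>UNIV. inner_L2 a b (t i) (s i))"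
    unfolding op_trace_nuclear(1)[OF nrK] using op_trace_nuclear(2)[OF nrK] has_sum_unique by blast
  then show "op_trace a b K = (LINT x|lebesgue_ab a b. trace (G x ** F x))"
    by (simp add: integral_trace[OF G F] s_def t_def)
  \<comment> \<open>\<open>iterates\<close> is conditional on A preserving \<open>L2\<close>, which
    becomes available only through the decomposition of K.\<close>
  have summ: "summable (\<lambda>l. cmod \<beta> ^ l * norm_L2 a b ((A ^^ l) u))" if "u \<in> L2 a b" for u and \<beta> :: complex
    by (rule iterates[OF AL2 that]) simp_all
  have Al: "(A ^^ l) u \<in> L2 a b" if "u \<in> L2 a b" for l u using that by (induction l) (auto intro: AL2)
  have summ_entries: "summable (\<lambda>l. \<beta> ^ l * inner_L2 a b (t i) ((A ^^ l) (s j)))" for i j \<beta>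
  proof (rule summable_comparison_test'[where N = 0])
    show "summable (\<lambda>l. norm_L2 a b (t i) * (cmod \<beta> ^ l * norm_L2 a b ((A ^^ l) (s j))))"
      by (intro summable_mult summ s)
    fix l
    have "cmod \<beta> ^ l * cmod (inner_L2 a b (t i) ((A ^^ l) (s j))) \<le> cmod \<beta> ^ l * (norm_L2 a b (t i) * norm_L2 a b ((A ^^ l) (s j)))"
      by (intro mult_left_mono inner_L2_Cauchy_Schwarz t Al s) simp
    then show "norm (\<beta> ^ l * inner_L2 a b (t i) ((A ^^ l) (s j))) \<le> norm_L2 a b (t i) * (cmod \<beta> ^ l * norm_L2 a b ((A ^^ l) (s j)))"
      by (simp add: norm_mult norm_power mult_ac)
  qed
  let ?S = "\<lambda>i j. \<Sum>l. \<alpha> ^ l * inner_L2 a b (t i) ((A ^^ l) (s j))"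
  have det: "fredholm_det_I_minus a b (scale_op \<alpha> K) = det (mat 1 - \<alpha> *\<^sub>m (\<chi> i j. ?S i j))"
    by (rule fredholm_det_finite_rank[OF nr nrK causal summ_entries])
  have val: "inner_L2 a b (t i) f = ?S i j" if "f \<in> L2 a b" "eq_L2 a b (I_minus_op (scale_op \<alpha> A) f) (s j)" for f i j
    by (rule sums_unique[OF second_kind_inner[OF nr s that(1) t that(2) summ]])
  have ex: "\<exists>f. f \<in> L2 a b \<and> eq_L2 a b (I_minus_op (scale_op \<alpha> A) f) (s j)" for j
    using second_kind_solution[OF nr s[of j] summ, of \<alpha>] by blast
  show "fredholm_det_I_minus a b (scale_op \<alpha> K) = det (mat 1 - \<alpha> *\<^sub>m
      matrix (\<lambda>u. LINT y|lebesgue_ab a b. G y *v inverse_op a b (I_minus_op (scale_op \<alpha> A)) (\<lambda>x. F x *v u) y))"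
  proof -
    have "matrix (\<lambda>u. LINT y|lebesgue_ab a b. G y *v inverse_op a b (I_minus_op (scale_op \<alpha> A)) (\<lambda>x. F x *v u) y) = (\<chi> i j. ?S i j)"
      unfolding matrix_def vec_eq_iff vec_lambda_beta
    proof (intro allI)
      fix i j
      let ?f = "inverse_op a b (I_minus_op (scale_op \<alpha> A)) (\<lambda>x. F x *v axis j 1)"
      have "(\<lambda>x. F x *v axis j 1) = s j" by (simp add: s_def matrix_vector_mult_axis)
      then have "?f \<in> L2 a b \<and> eq_L2 a b (I_minus_op (scale_op \<alpha> A) ?f) (s j)"
        unfolding inverse_op_def using someI_ex[OF ex[of j]] by simp
      then show "(LINT y|lebesgue_ab a b. G y *v ?f y) $ i = ?S i j"
        using integral_matrix_vector_nth[OF G, of ?f i] val[of ?f j i] by (simp add: t_def)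
    qed
    then show ?thesis using det by simp
  qed
  show "\<exists>h\<in>L2 a b. \<forall>j. eq_L2 a b (I_minus_op (scale_op \<alpha> A) (\<lambda>x. column j (h x))) (\<lambda>x. column j (F x))"
  proof -
    obtain u where u: "\<And>j. u j \<in> L2 a b \<and> eq_L2 a b (I_minus_op (scale_op \<alpha> A) (u j)) (s j)" using ex by metis
    define h where "h x = (\<chi> i j. u j x $ i)" for x
    have c: "(\<lambda>x. column j (h x)) = u j" for j by (simp add: h_def column_def)
    have "h \<in> L2 a b" by (rule L2_columns) (use u c in auto)
    moreover have "\<forall>j. eq_L2 a b (I_minus_op (scale_op \<alpha> A) (\<lambda>x. column j (h x))) (\<lambda>x. column j (F x))"
    proof
      show "eq_L2 a b (I_minus_op (scale_op \<alpha> A) (\<lambda>x. column j (h x))) (\<lambda>x. column j (F x))" for j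
        unfolding c using u[of j] by (simp add: s_def)
    qed
    ultimately show ?thesis by blast
  qed
  fix h assume h: "h \<in> L2 a b"
    and eq: "\<forall>j. eq_L2 a b (I_minus_op (scale_op \<alpha> A) (\<lambda>x. column j (h x))) (\<lambda>x. column j (F x))"
  have "(LINT y|lebesgue_ab a b. G y ** h y) = (\<chi> i j. ?S i j)"
    unfolding vec_eq_iff vec_lambda_beta
    using val[OF L2_column[OF h]] eq integral_matrix_mult[OF G h] by (simp add: s_def t_def)
  then show "fredholm_det_I_minus a b (scale_op \<alpha> K) = det (mat 1 - \<alpha> *\<^sub>m (LINT y|lebesgue_ab a b. G y ** h y))"
    using det by simp
qed

text \<open>One formula for both operators: for \<sigma> = -1 the condition reads y > x and the
  prefactor is the minus sign of \<open>op_Hb\<close>. Integrating over the whole interval keeps the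
  measure independent of x.\<close>

definition volterra ::
  "ereal \<Rightarrow> ereal \<Rightarrow> real \<Rightarrow> (real \<Rightarrow> real \<Rightarrow> complex^'m^'m) \<Rightarrow> (real \<Rightarrow> complex^'m) \<Rightarrow> (real \<Rightarrow> complex^'m)" where
  "volterra a b \<sigma> H f = (\<lambda>x. \<sigma> *\<^sub>R (LINT y|lebesgue_ab a b. (if \<sigma> * y < \<sigma> * x then H x y *v f y else 0)))"

section \<open>The operators \<open>op_Ha\<close> and \<open>op_Hb\<close> in Volterra form\<close>

lemma integral_lower:
  fixes G :: "real \<Rightarrow> 'c::euclidean_space"
  assumes "x \<in> einterval a b"
  shows "(LINT y|lebesgue_ab a (ereal x). G y) = (LINT y|lebesgue_ab a b. (if 1 * y < 1 * x then G y else 0))"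
  unfolding integral_lebesgue_ab
  by (intro Bochner_Integration.integral_cong refl)
    (use assms in \<open>auto simp: einterval_iff indicator_def intro: less_trans[of _ "ereal x" b]\<close>)

lemma integral_upper:
  fixes G :: "real \<Rightarrow> 'c::euclidean_space"
  assumes "x \<in> einterval a b"
  shows "(LINT y|lebesgue_ab (ereal x) b. G y) = (LINT y|lebesgue_ab a b. (if (-1) * y < (-1) * x then G y else 0))"
  unfolding integral_lebesgue_ab
  by (intro Bochner_Integration.integral_cong refl)
    (use assms in \<open>auto simp: einterval_iff indicator_def intro: less_trans[of a "ereal x"]\<close>)

lemma op_Ha_volterra: "x \<in> einterval a b \<Longrightarrow> op_Ha a f1 g1 f2 g2 f x = volterra a b 1 (kernel_H f1 g1 f2 g2) f x"
  unfolding op_Ha_def volterra_def by (subst integral_lower) simp_all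

lemma op_Hb_volterra: "x \<in> einterval a b \<Longrightarrow> op_Hb b f1 g1 f2 g2 f x = volterra a b (-1) (kernel_H f1 g1 f2 g2) f x"
  unfolding op_Hb_def volterra_def by (subst integral_upper) simp_all

text \<open>For \<sigma> x < c only points y with \<sigma> y < c enter the integral, and there f
  vanishes.\<close>

lemma causal_volterra:
  fixes A :: "(real \<Rightarrow> complex^'m) \<Rightarrow> (real \<Rightarrow> complex^'m)"
  assumes A: "\<And>f x. x \<in> einterval a b \<Longrightarrow> A f x = volterra a b \<sigma> H f x"
  shows "causal a b \<sigma> A"
  unfolding causal_def
proof (intro allI ballI impI AE_I2)
  fix c and f :: "real \<Rightarrow> complex^'m" and x
  assume f0: "AE x in lebesgue_ab a b. \<sigma> * x < c \<longrightarrow> f x = 0"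
    and x: "x \<in> space (lebesgue_ab a b)" "\<sigma> * x < c"
  have "(LINT y|lebesgue_ab a b. (if \<sigma> * y < \<sigma> * x then H x y *v f y else 0)) = 0"
    by (rule integral_eq_zero_AE) (rule AE_mp[OF f0], use x in \<open>auto intro!: AE_I2\<close>)
  then show "A f x = 0" using x by (simp add: A volterra_def)
qed

lemma kernel_H_mult: "kernel_H f1 g1 f2 g2 x y *v v = f1 x *v (g1 y *v v) - f2 x *v (g2 y *v v)"
  by (simp add: kernel_H_def matrix_vector_mult_diff_rdistrib matrix_vector_mul_assoc)

lemma norm_kernel_H_mult:
  fixes v :: "complex^'m"
  shows "norm (kernel_H f1 g1 f2 g2 x y *v v) \<le> (norm (f1 x) + norm (f2 x)) * ((norm (g1 y) + norm (g2 y)) * norm v)"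
proof -
  have "norm (kernel_H f1 g1 f2 g2 x y *v v) \<le> norm (f1 x *v (g1 y *v v)) + norm (f2 x *v (g2 y *v v))"
    unfolding kernel_H_mult by (rule norm_triangle_ineq4)
  also have "\<dots> \<le> norm (f1 x) * (norm (g1 y) * norm v) + norm (f2 x) * (norm (g2 y) * norm v)"
    by (intro add_mono order_trans[OF norm_matrix_vector_mult] mult_left_mono norm_matrix_vector_mult) auto
  also have "\<dots> \<le> (norm (f1 x) + norm (f2 x)) * ((norm (g1 y) + norm (g2 y)) * norm v)"
    by (simp add: algebra_simps)
  finally show ?thesis .
qed

text \<open>The kernel is bounded by \<phi> x times \<psi> y, where \<phi> adds the norms of f1 and
  f2 and \<psi> those of g1 and g2; both are square integrable.\<close>

lemma volterra_summable:
  fixes A :: "(real \<Rightarrow> complex^'m) \<Rightarrow> (real \<Rightarrow> complex^'m)"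
  assumes L2: "f1 \<in> L2 a b" "g1 \<in> L2 a b" "f2 \<in> L2 a b" "g2 \<in> L2 a b"
    and A: "\<And>f x. x \<in> einterval a b \<Longrightarrow> A f x = volterra a b \<sigma> (kernel_H f1 g1 f2 g2) f x"
    and \<sigma>: "\<sigma> = 1 \<or> \<sigma> = -1"
    and AL2: "\<And>f. f \<in> L2 a b \<Longrightarrow> A f \<in> L2 a b" and f: "f \<in> L2 a b" and \<beta>: "0 \<le> \<beta>"
  shows "summable (\<lambda>l. \<beta> ^ l * norm_L2 a b ((A ^^ l) f))"
proof (rule volterra_iterates_summable[where \<sigma> = \<sigma>, OF _ _ _ _ AL2 _ _ f \<beta>])
  let ?\<phi> = "\<lambda>x. norm (f1 x) + norm (f2 x)" and ?\<psi> = "\<lambda>x. norm (g1 x) + norm (g2 x)"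
  show "?\<phi> \<in> L2 a b" "?\<psi> \<in> L2 a b" by (intro L2_add L2_norm L2)+
  fix u :: "real \<Rightarrow> complex^'m" and x assume u: "u \<in> L2 a b" and x: "x \<in> einterval a b"
  let ?h = "\<lambda>y. if \<sigma> * y < \<sigma> * x then kernel_H f1 g1 f2 g2 x y *v u y else 0"
  have [measurable]: "?\<psi> \<in> borel_measurable (lebesgue_ab a b)" "u \<in> borel_measurable (lebesgue_ab a b)"
    by (intro L2_measurable L2_add L2_norm L2 u)+
  have "(\<lambda>x. x) \<in> borel_measurable (lebesgue_ab a b)"
    by (rule measurable_ident_lebesgue_ab)
  note [measurable] = this
  have "ennreal (norm (A u x)) = ennreal (norm (LINT y|lebesgue_ab a b. ?h y))"
    using \<sigma> by (auto simp: A[OF x] volterra_def)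
  also have "\<dots> \<le> (\<integral>\<^sup>+y. ennreal (norm (?h y)) \<partial>lebesgue_ab a b)"
  \<comment> \<open>A function that is not integrable has integral 0 by convention, for which the
    bound is trivial.\<close>
  proof (cases "integrable (lebesgue_ab a b) ?h")
    case True
    then show ?thesis by (rule integral_norm_bound_ennreal)
  qed (simp add: not_integrable_integral_eq)
  also have "\<dots> \<le> (\<integral>\<^sup>+y. ennreal (?\<phi> x) * (if \<sigma> * y < \<sigma> * x then ennreal (?\<psi> y * norm (u y)) else 0) \<partial>lebesgue_ab a b)"
  proof (rule nn_integral_mono)
    fix y
    have "ennreal (norm (kernel_H f1 g1 f2 g2 x y *v u y)) \<le> ennreal (?\<phi> x * (?\<psi> y * norm (u y)))"
      by (rule ennreal_leI[OF norm_kernel_H_mult])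
    also have "\<dots> = ennreal (?\<phi> x) * ennreal (?\<psi> y * norm (u y))" by (rule ennreal_mult) auto
    finally show "ennreal (norm (?h y)) \<le> ennreal (?\<phi> x) * (if \<sigma> * y < \<sigma> * x then ennreal (?\<psi> y * norm (u y)) else 0)"
      by (cases "\<sigma> * y < \<sigma> * x") (simp_all only: if_True if_False, simp)
  qed
  also have "\<dots> = ennreal (?\<phi> x) * (\<integral>\<^sup>+y. (if \<sigma> * y < \<sigma> * x then ennreal (?\<psi> y * norm (u y)) else 0) \<partial>lebesgue_ab a b)"
    by (rule nn_integral_cmult) measurable
  finally show "ennreal (norm (A u x)) \<le> ennreal (?\<phi> x) * (\<integral>\<^sup>+y. (if \<sigma> * y < \<sigma> * x then ennreal (?\<psi> y * norm (u y)) else 0) \<partial>lebesgue_ab a b)" .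
qed (use \<sigma> in auto)

lemma integrable_kernel:
  fixes f :: "real \<Rightarrow> complex^'m" and g :: "real \<Rightarrow> complex^'m^'n" and B :: "complex^'n^'m"
  assumes "g \<in> L2 a b" "f \<in> L2 a b" "S \<in> sets lebesgue"
  shows "integrable (lebesgue_ab a b) (\<lambda>y. if y \<in> S then B *v (g y *v f y) else 0)"
proof -
  have "(\<lambda>y. if y \<in> S then f y else 0) \<in> L2 a b" by (rule L2_indicator[OF assms(2,3)])
  from integrable_matrix_vector[OF assms(1) this]
  have "integrable (lebesgue_ab a b) (\<lambda>y. B *v (g y *v (if y \<in> S then f y else 0)))"
    by (rule integrable_bounded_linear[OF matrix_vector_mul_bounded_linear])
  also have "(\<lambda>y. B *v (g y *v (if y \<in> S then f y else 0))) = (\<lambda>y. if y \<in> S then B *v (g y *v f y) else 0)"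
    by (auto simp: fun_eq_iff)
  finally show ?thesis .
qed

lemma integrable_volterra:
  fixes f :: "real \<Rightarrow> complex^'m"
  assumes L2: "g1 \<in> L2 a b" "g2 \<in> L2 a b" and f: "f \<in> L2 a b"
  shows "integrable (lebesgue_ab a b) (\<lambda>y. if \<sigma> * y < \<sigma> * x then kernel_H f1 g1 f2 g2 x y *v f y else 0)"
proof -
  have "{y. \<sigma> * y < \<sigma> * x} \<in> sets borel" by measurable
  then have S: "{y. \<sigma> * y < \<sigma> * x} \<in> sets lebesgue" by (intro sets_completionI_sets) simp
  have "integrable (lebesgue_ab a b) (\<lambda>y. (if y \<in> {y. \<sigma> * y < \<sigma> * x} then f1 x *v (g1 y *v f y) else 0)
      - (if y \<in> {y. \<sigma> * y < \<sigma> * x} then f2 x *v (g2 y *v f y) else 0))"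
    by (intro Bochner_Integration.integrable_diff integrable_kernel L2 f S)
  also have "(\<lambda>y. (if y \<in> {y. \<sigma> * y < \<sigma> * x} then f1 x *v (g1 y *v f y) else 0)
      - (if y \<in> {y. \<sigma> * y < \<sigma> * x} then f2 x *v (g2 y *v f y) else 0))
    = (\<lambda>y. if \<sigma> * y < \<sigma> * x then kernel_H f1 g1 f2 g2 x y *v f y else 0)"
    by (auto simp: kernel_H_mult)
  finally show ?thesis .
qed

text \<open>Covers both decompositions K = H_a + Q R and K = H_b + S T, with \<sigma> choosing
  between them. The kernel identity is asked for off the diagonal, whose section at x is a null
  set.\<close>

lemma op_K_eq_volterra_plus:
  fixes f :: "real \<Rightarrow> complex^'m" and F :: "real \<Rightarrow> complex^'n^'m" and G :: "real \<Rightarrow> complex^'m^'n"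
  assumes L2: "g1 \<in> L2 a b" "g2 \<in> L2 a b" "G \<in> L2 a b" and f: "f \<in> L2 a b"
    and ptw: "\<And>y. y \<noteq> x \<Longrightarrow> kernel_K f1 g1 f2 g2 x y
      = (if \<sigma> * y < \<sigma> * x then \<sigma> *\<^sub>R kernel_H f1 g1 f2 g2 x y else 0) + F x ** G y"
  shows "op_K a b f1 g1 f2 g2 f x
    = volterra a b \<sigma> (kernel_H f1 g1 f2 g2) f x + F x *v (LINT y|lebesgue_ab a b. G y *v f y)"
proof -
  let ?H = "kernel_H f1 g1 f2 g2"
  let ?h = "\<lambda>y. if \<sigma> * y < \<sigma> * x then ?H x y *v f y else 0"
  note i1 = integrable_volterra[OF L2(1,2) f, of \<sigma> x f1 f2]
  note i2 = integrable_matrix_vector[OF L2(3) f]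
  have i3: "integrable (lebesgue_ab a b) (\<lambda>y. F x *v (G y *v f y))"
    by (rule integrable_bounded_linear[OF matrix_vector_mul_bounded_linear i2])
  have scale: "(c *\<^sub>R M) *v v = c *\<^sub>R (M *v v)" for c :: real and M :: "complex^'m^'m" and v
    by (simp add: matrix_vector_mult_def vec_eq_iff scaleR_sum_right)
  have sum: "integrable (lebesgue_ab a b) (\<lambda>y. \<sigma> *\<^sub>R ?h y + F x *v (G y *v f y))"
    using i1 i3 by (intro Bochner_Integration.integrable_add integrable_scaleR_right)
  have ae: "AE y in lebesgue_ab a b. kernel_K f1 g1 f2 g2 x y *v f y = \<sigma> *\<^sub>R ?h y + F x *v (G y *v f y)"
  proof (rule AE_mp[OF AE_lebesgue_ab_neq[of x]], intro AE_I2 impI)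
    fix y assume "y \<noteq> x"
    then show "kernel_K f1 g1 f2 g2 x y *v f y = \<sigma> *\<^sub>R ?h y + F x *v (G y *v f y)"
      unfolding ptw[OF \<open>y \<noteq> x\<close>]
      by (simp add: matrix_vector_mult_add_rdistrib matrix_vector_mul_assoc scale)
  qed
  have "op_K a b f1 g1 f2 g2 f x = (LINT y|lebesgue_ab a b. \<sigma> *\<^sub>R ?h y + F x *v (G y *v f y))"
    unfolding op_K_def
  proof (rule integral_cong_AE[OF _ _ ae])
    note [measurable] = L2[THEN L2_measurable] L2_measurable[OF f] measurable_ident_lebesgue_ab
    show "(\<lambda>y. kernel_K f1 g1 f2 g2 x y *v f y) \<in> borel_measurable (lebesgue_ab a b)"
      unfolding kernel_K_def by measurable
    show "(\<lambda>y. \<sigma> *\<^sub>R ?h y + F x *v (G y *v f y)) \<in> borel_measurable (lebesgue_ab a b)"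
      using sum by (rule borel_measurable_integrable)
  qed
  also have "\<dots> = (LINT y|lebesgue_ab a b. \<sigma> *\<^sub>R ?h y) + (LINT y|lebesgue_ab a b. F x *v (G y *v f y))"
    using i1 i3 by (intro Bochner_Integration.integral_add integrable_scaleR_right)
  also have "(LINT y|lebesgue_ab a b. F x *v (G y *v f y)) = F x *v (LINT y|lebesgue_ab a b. G y *v f y)"
    by (rule integral_bounded_linear[OF matrix_vector_mul_bounded_linear i2])
  finally show ?thesis by (simp add: volterra_def)
qed

lemma column_integral_kernel_H:
  fixes h :: "real \<Rightarrow> complex^'n^'m"
  assumes L2: "g1 \<in> L2 a b" "g2 \<in> L2 a b" and h: "h \<in> L2 a b"
  shows "\<sigma> *\<^sub>R column j (LINT y|lebesgue_ab a b. (if \<sigma> * y < \<sigma> * x then kernel_H f1 g1 f2 g2 x y ** h y else 0))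
    = volterra a b \<sigma> (kernel_H f1 g1 f2 g2) (\<lambda>y. column j (h y)) x"
proof -
  let ?M = "\<lambda>y. if \<sigma> * y < \<sigma> * x then kernel_H f1 g1 f2 g2 x y ** h y else 0"
  have idm [measurable]: "(\<lambda>x. x) \<in> borel_measurable (lebesgue_ab a b)"
    by (rule measurable_ident_lebesgue_ab)
  have [measurable]: "g1 \<in> borel_measurable (lebesgue_ab a b)" "g2 \<in> borel_measurable (lebesgue_ab a b)"
    "h \<in> borel_measurable (lebesgue_ab a b)"
    using L2 h by (auto intro: L2_measurable)
  have m: "?M \<in> borel_measurable (lebesgue_ab a b)" unfolding kernel_H_def by measurable
  have c: "column j (?M y) = (if \<sigma> * y < \<sigma> * x then kernel_H f1 g1 f2 g2 x y *v column j (h y) else 0)" for y j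
    by (simp add: column_matrix_mult) (simp add: column_def zero_vec_def)
  have int: "integrable (lebesgue_ab a b) ?M"
    by (rule integrable_matrix_entries[OF m]) (unfold c, rule integrable_volterra[OF L2 L2_column[OF h]])
  from integral_bounded_linear[OF bounded_linear_column int, of j]
  show ?thesis unfolding c volterra_def by simp
qed

text \<open>Turns the matrix equation for a hat function into one equation of the second kind per
  column; the factor \<alpha> times \<sigma> absorbs the different signs of the two
  equations.\<close>

lemma volterra_columns_iff:
  fixes A :: "(real \<Rightarrow> complex^'m) \<Rightarrow> (real \<Rightarrow> complex^'m)" and h F :: "real \<Rightarrow> complex^'n^'m"
  assumes L2: "g1 \<in> L2 a b" "g2 \<in> L2 a b" and h: "h \<in> L2 a b"
    and A: "\<And>f x. x \<in> einterval a b \<Longrightarrow> A f x = volterra a b \<sigma> (kernel_H f1 g1 f2 g2) f x"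
    and rhs: "\<And>x. x \<in> einterval a b \<Longrightarrow> rhs x = F x + (\<alpha> * of_real \<sigma>) *\<^sub>m
      (LINT y|lebesgue_ab a b. (if \<sigma> * y < \<sigma> * x then kernel_H f1 g1 f2 g2 x y ** h y else 0))"
  shows "eq_L2 a b h rhs \<longleftrightarrow> (\<forall>j. eq_L2 a b (I_minus_op (scale_op \<alpha> A) (\<lambda>x. column j (h x))) (\<lambda>x. column j (F x)))"
proof -
  have ptw: "h x = rhs x \<longleftrightarrow> (\<forall>j. I_minus_op (scale_op \<alpha> A) (\<lambda>x. column j (h x)) x = column j (F x))"
    if x: "x \<in> einterval a b" for x
  proof -
    let ?L = "LINT y|lebesgue_ab a b. (if \<sigma> * y < \<sigma> * x then kernel_H f1 g1 f2 g2 x y ** h y else 0)"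
    have "I_minus_op (scale_op \<alpha> A) (\<lambda>x. column j (h x)) x = column j (h x) - \<alpha> *s (\<sigma> *\<^sub>R column j ?L)" for j
      by (simp only: I_minus_op_def scale_op_def A[OF x] column_integral_kernel_H[OF L2 h])
    moreover have "column j (rhs x) = column j (F x) + \<alpha> *s (\<sigma> *\<^sub>R column j ?L)" for j
    proof -
      have "\<sigma> *\<^sub>R c = of_real \<sigma> * c" for c :: complex
        by (rule scaleR_conv_of_real)
      then show ?thesis
        by (simp add: rhs[OF x] column_def mat_scale_def vec_eq_iff mult.assoc)
    qed
    moreover have "h x = rhs x \<longleftrightarrow> (\<forall>j. column j (h x) = column j (rhs x))"
      by (auto simp: column_def vec_eq_iff)
    ultimately show ?thesis by (simp add: diff_eq_eq)
  qed
  have "eq_L2 a b h rhs \<longleftrightarrow> (AE x in lebesgue_ab a b. \<forall>j. I_minus_op (scale_op \<alpha> A) (\<lambda>x. column j (h x)) x = column j (F x))"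
    unfolding eq_L2_def by (rule AE_cong) (simp add: ptw)
  then show ?thesis unfolding eq_L2_def AE_all_countable .
qed

text \<open>The shape of \<open>U_mat\<close> at x = a, where the integrals from a to x are
  empty.\<close>

lemma det_block_mat_lower: "det (block_mat A 0 C (mat 1)) = det A"
proof -
  have "det (block_mat A 0 C (mat 1)) = minor (\<lambda>i j. block_mat A 0 C (mat 1) $ i $ j) (range Inl)
      * minor (\<lambda>i j. block_mat A 0 C (mat 1) $ i $ j) (range Inr)"
    unfolding det_eq_minor UNIV_sum by (rule minor_block) (auto simp: block_mat_def)
  also have "\<dots> = det A"
    unfolding minor_reindex[OF inj_Inl finite] minor_reindex[OF inj_Inr finite]
    by (simp add: block_mat_def flip: det_eq_minor)
  finally show ?thesis by simp
qed

text \<open>The shape of \<open>U_mat\<close> at x = b, where the integrals from x to b are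
  empty.\<close>

lemma det_block_mat_upper: "det (block_mat (mat 1) B 0 D) = det D"
proof -
  have "det (block_mat (mat 1) B 0 D) = minor (\<lambda>i j. block_mat (mat 1) B 0 D $ i $ j) (range Inr)
      * minor (\<lambda>i j. block_mat (mat 1) B 0 D $ i $ j) (range Inl)"
    unfolding det_eq_minor UNIV_sum Un_commute[of "range Inl"] by (rule minor_block) (auto simp: block_mat_def)
  also have "\<dots> = det D"
    unfolding minor_reindex[OF inj_Inl finite] minor_reindex[OF inj_Inr finite]
    by (simp add: block_mat_def flip: det_eq_minor)
  finally show ?thesis by simp
qed

lemma integral_lebesgue_ab_empty: "(LINT y|lebesgue_ab a a. G y) = (0 :: 'c::euclidean_space)"
  unfolding integral_lebesgue_ab by (simp add: einterval_same)

lemma mat_scale_zero: "\<alpha> *\<^sub>m 0 = 0"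
  by (simp add: mat_scale_def vec_eq_iff)

theorem theorem3p2:
  fixes a b :: ereal
    and f1 :: "real \<Rightarrow> complex^'n1^'m" and g1 :: "real \<Rightarrow> complex^'m^'n1"
    and f2 :: "real \<Rightarrow> complex^'n2^'m" and g2 :: "real \<Rightarrow> complex^'m^'n2"
    and \<alpha> :: complex
  assumes "a < b"
    and "f1 \<in> L2 a b" and "g1 \<in> L2 a b" and "f2 \<in> L2 a b" and "g2 \<in> L2 a b"
    and "trace_class a b (op_K a b f1 g1 f2 g2)"
  shows "let K = op_K a b f1 g1 f2 g2;
             Ha = op_Ha a f1 g1 f2 g2;
             Hb = op_Hb b f1 g1 f2 g2;
             Q = op_Q f2; R = op_R a b g2; S = op_S f1; T = op_T a b g1;
             f1h = f1_hat a b f1 g1 f2 g2 \<alpha>;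
             f2h = f2_hat a b f1 g1 f2 g2 \<alpha>;
             U = (\<lambda>x. U_mat a b f1 g1 f2 g2 x \<alpha>);
             detK = fredholm_det_I_minus a b (scale_op \<alpha> K)
         in
           op_trace a b Ha = 0 \<and> op_trace a b Hb = 0 \<and>
           fredholm_det_I_minus a b (scale_op \<alpha> Ha) = 1 \<and>
           fredholm_det_I_minus a b (scale_op \<alpha> Hb) = 1 \<and>
           op_trace a b K = (LINT x|lebesgue_ab a b. trace (g1 x ** f1 x)) \<and>
           op_trace a b K = (LINT x|lebesgue_ab a b. trace (f1 x ** g1 x)) \<and>
           op_trace a b K = (LINT x|lebesgue_ab a b. trace (g2 x ** f2 x)) \<and>
           op_trace a b K = (LINT x|lebesgue_ab a b. trace (f2 x ** g2 x)) \<and>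
           detK = det (mat 1 - \<alpha> *\<^sub>m
             matrix (\<lambda>v. T (inverse_op a b (I_minus_op (scale_op \<alpha> Hb)) (S v)))) \<and>
           detK = det (mat 1 - \<alpha> *\<^sub>m (LINT x|lebesgue_ab a b. g1 x ** f1h x)) \<and>
           detK = det (U a) \<and>
           detK = det (mat 1 - \<alpha> *\<^sub>m
             matrix (\<lambda>u. R (inverse_op a b (I_minus_op (scale_op \<alpha> Ha)) (Q u)))) \<and>
           detK = det (mat 1 - \<alpha> *\<^sub>m (LINT x|lebesgue_ab a b. g2 x ** f2h x)) \<and>
           detK = det (U b)"
proof -
  note L2 = assms(2-5)
  define K where "K = op_K a b f1 g1 f2 g2"
  define Ha where "Ha = op_Ha a f1 g1 f2 g2"
  define Hb where "Hb = op_Hb b f1 g1 f2 g2"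
  let ?H = "kernel_H f1 g1 f2 g2"
  have tc: "trace_class a b K" using assms(6) by (simp add: K_def)
  have Ha: "Ha f x = volterra a b 1 ?H f x" if "x \<in> einterval a b" for f x
    unfolding Ha_def by (rule op_Ha_volterra[OF that])
  have Hb: "Hb f x = volterra a b (-1) ?H f x" if "x \<in> einterval a b" for f x
    unfolding Hb_def by (rule op_Hb_volterra[OF that])
  have KHa: "K f x = Ha f x + f2 x *v (LINT y|lebesgue_ab a b. g2 y *v f y)"
    if "f \<in> L2 a b" "x \<in> einterval a b" for f x
    unfolding Ha[OF that(2)] K_def
    by (rule op_K_eq_volterra_plus[OF L2(2,4,4) that(1)]) (auto simp: kernel_K_def kernel_H_def)
  have KHb: "K f x = Hb f x + f1 x *v (LINT y|lebesgue_ab a b. g1 y *v f y)"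
    if "f \<in> L2 a b" "x \<in> einterval a b" for f x
    unfolding Hb[OF that(2)] K_def
    by (rule op_K_eq_volterra_plus[OF L2(2,4,2) that(1)]) (auto simp: kernel_K_def kernel_H_def)
  have pm: "(1::real) = 1 \<or> (1::real) = -1" "(-1::real) = 1 \<or> (-1::real) = -1" by auto
  note a_half = causal_plus_separable[OF tc L2(3,4) KHa causal_volterra[of a b Ha 1 ?H, OF Ha] pm(1)
      volterra_summable[OF L2, of Ha 1, OF Ha pm(1)]]
  note b_half = causal_plus_separable[OF tc L2(1,2) KHb causal_volterra[of a b Hb "-1" ?H, OF Hb] pm(2)
      volterra_summable[OF L2, of Hb "-1", OF Hb pm(2)]]
  \<comment> \<open>\<open>f2_hat\<close> is an arbitrary choice among solutions; that one exists is
    obtained from the columnwise equations for \<open>Ha\<close>.\<close>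
  have f2h: "f2_hat a b f1 g1 f2 g2 \<alpha> \<in> L2 a b \<and> (\<forall>j. eq_L2 a b (I_minus_op (scale_op \<alpha> Ha)
      (\<lambda>x. column j (f2_hat a b f1 g1 f2 g2 \<alpha> x))) (\<lambda>x. column j (f2 x)))"
  proof -
    let ?rhs = "\<lambda>h x. f2 x + \<alpha> *\<^sub>m (LINT x'|lebesgue_ab a (ereal x). ?H x x' ** h x')"
    have iff: "eq_L2 a b h (?rhs h) \<longleftrightarrow> (\<forall>j. eq_L2 a b (I_minus_op (scale_op \<alpha> Ha) (\<lambda>x. column j (h x))) (\<lambda>x. column j (f2 x)))"
      if "h \<in> L2 a b" for h
      by (rule volterra_columns_iff[OF L2(2,4) that Ha]) (simp_all add: integral_lower)
    have "\<exists>h. h \<in> L2 a b \<and> eq_L2 a b h (?rhs h)" using a_half(5)[of \<alpha>] iff by blast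
    then show ?thesis unfolding f2_hat_def using someI_ex[of "\<lambda>h. h \<in> L2 a b \<and> eq_L2 a b h (?rhs h)"] iff by blast
  qed
  have f1h: "f1_hat a b f1 g1 f2 g2 \<alpha> \<in> L2 a b \<and> (\<forall>j. eq_L2 a b (I_minus_op (scale_op \<alpha> Hb)
      (\<lambda>x. column j (f1_hat a b f1 g1 f2 g2 \<alpha> x))) (\<lambda>x. column j (f1 x)))"
  proof -
    let ?rhs = "\<lambda>h x. f1 x - \<alpha> *\<^sub>m (LINT x'|lebesgue_ab (ereal x) b. ?H x x' ** h x')"
    \<comment> \<open>The minus sign in the equation for \<open>f1_hat\<close> is the factor
      \<sigma> = -1 of \<open>volterra_columns_iff\<close>.\<close>
    have neg: "A - \<alpha> *\<^sub>m B = A + (\<alpha> * of_real (-1)) *\<^sub>m B" for A B :: "complex^'n1^'m"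
      by (simp add: mat_scale_def vec_eq_iff)
    have iff: "eq_L2 a b h (?rhs h) \<longleftrightarrow> (\<forall>j. eq_L2 a b (I_minus_op (scale_op \<alpha> Hb) (\<lambda>x. column j (h x))) (\<lambda>x. column j (f1 x)))"
      if "h \<in> L2 a b" for h
      by (rule volterra_columns_iff[OF L2(2,4) that Hb]) (simp_all only: neg integral_upper)
    have "\<exists>h. h \<in> L2 a b \<and> eq_L2 a b h (?rhs h)" using b_half(5)[of \<alpha>] iff by blast
    then show ?thesis unfolding f1_hat_def using someI_ex[of "\<lambda>h. h \<in> L2 a b \<and> eq_L2 a b h (?rhs h)"] iff by blast
  qed
  have Ua: "det (U_mat a b f1 g1 f2 g2 a \<alpha>) = det (mat 1 - \<alpha> *\<^sub>m (LINT x|lebesgue_ab a b. g1 x ** f1_hat a b f1 g1 f2 g2 \<alpha> x))"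
    unfolding U_mat_def integral_lebesgue_ab_empty mat_scale_zero diff_0_right by (rule det_block_mat_lower)
  have Ub: "det (U_mat a b f1 g1 f2 g2 b \<alpha>) = det (mat 1 - \<alpha> *\<^sub>m (LINT x|lebesgue_ab a b. g2 x ** f2_hat a b f1 g1 f2 g2 \<alpha> x))"
    unfolding U_mat_def integral_lebesgue_ab_empty mat_scale_zero diff_0_right by (rule det_block_mat_upper)
  have tr: "trace (f1 x ** g1 x) = trace (g1 x ** f1 x)" "trace (f2 x ** g2 x) = trace (g2 x ** f2 x)" for x
    by (rule trace_mul_sym)+
  have detb: "fredholm_det_I_minus a b (scale_op \<alpha> K) = det (mat 1 - \<alpha> *\<^sub>m (LINT x|lebesgue_ab a b. g1 x ** f1_hat a b f1 g1 f2 g2 \<alpha> x))"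
    using b_half(6) f1h by blast
  have deta: "fredholm_det_I_minus a b (scale_op \<alpha> K) = det (mat 1 - \<alpha> *\<^sub>m (LINT x|lebesgue_ab a b. g2 x ** f2_hat a b f1 g1 f2 g2 \<alpha> x))"
    using a_half(6) f2h by blast
  show ?thesis
    unfolding Let_def K_def[symmetric] Ha_def[symmetric] Hb_def[symmetric] op_T_def op_R_def op_S_def op_Q_def tr Ua Ub
    by (intro conjI a_half(1-4) b_half(1-4) deta detb)
qed

end
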